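(* A sequent $\Gamma \to C$ is derivable in $\mathbf{Lb^{*}}$ if and only if there exists a proof net $\mathcal{E}$ over $\Omega_{\Gamma\to C}$ that respects sisterhood.
   Context: Formulas of $\mathbf{Lb^{*}}$: built from variables $p_1,p_2,\dots$ by $\backslash$, $/$, $\cdot$, $\langle\rangle$, $\Box^{\downarrow}$. Meta-formulas: built from formulas by comma (associative, with empty meta-formula) and bracketing $[\Gamma]$. Sequent: $\Gamma\to C$, $\Gamma$ a possibly empty meta-formula, $C$ a formula. Axioms $p_i\to p_i$; rules: $(\backslash\to)$ from $\Pi\to A$, $\Delta(B)\to C$ infer $\Delta(\Pi,A\backslash B)\to C$; $(\to\backslash)$ from $A,\Pi\to B$ infer $\Pi\to A\backslash B$; $(/\to)$ from $\Pi\to A$, $\Delta(B)\to C$ infer $\Delta(B/A,\Pi)\to C$; $(\to/)$ from $\Pi,A\to B$ infer $\Pi\to B/A$; $(\cdot\to)$ from $\Gamma(A,B)\to C$ infer $\Gamma(A\cdot B)\to C$; $(\to\cdot)$ from $\Gamma\to A$, $\Delta\to B$ infer $\Gamma,\Delta\to A\cdot B$; $(\langle\rangle\to)$ from $\Delta([A])\to C$ infer $\Delta(\langle\rangle A)\to C$; $(\to\langle\rangle)$ from $\Pi\to A$ infer $[\Pi]\to\langle\rangle A$; $(\Box^{\downarrow}\to)$ from $\Delta(A)\to C$ infer $\Delta([\Box^{\downarrow}A])\to C$; $(\to\Box^{\downarrow})$ from $[\Pi]\to A$ infer $\Pi\to\Box^{\downarrow}A$ (empty $\Pi$ allowed). Literals: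 $p_i,\bar p_i$ for each variable, and $[$, $]$, $\bar{[}$, $\bar{]}$. Translations: $p_i^+=p_i$, $p_i^-=\bar p_i$; $(A\cdot B)^+=A^+\otimes B^+$, $(A\cdot B)^-=B^-⅋A^-$; $(A\backslash B)^+=A^-⅋B^+$, $(A\backslash B)^-=B^-\otimes A^+$; $(B/A)^+=B^+⅋A^-$, $(B/A)^-=A^+\otimes B^-$; $(\langle\rangle A)^+={]}\otimes A^+\otimes{[}$, $(\langle\rangle A)^-=\bar{[}⅋A^-⅋\bar{]}$; $(\Box^{\downarrow}A)^+=\bar{]}⅋A^+⅋\bar{[}$, $(\Box^{\downarrow}A)^-={[}\otimes A^-\otimes{]}$ (the two $⅋$'s associate to the left, the two $\otimes$'s to the right). Meta-formulas: $(\Gamma,\Delta)^-=\Delta^-\diamond\Gamma^-$, $[\Gamma]^-=\bar{[}\diamond\Gamma^-\diamond\bar{]}$. The sequent $\Gamma\to C$ is translated as $\diamond\Gamma^-\diamond C^+$ (as $\diamond C^+$ if $\Gamma$ is empty); $\Omega_{\Gamma\to C}$ is the linearly ordered set of literal and connective occurrences in this translation, alternating $c_1,\ell_1,\dots,c_n,\ell_n$. Dominance $\prec$: for a subexpression $X⅋Y$ or $X\otimes Y$ with central occurrence $c_i$, $c_j\prec c_i$ for all connective occurrences $c_j$ in $X$ or $Y$. Sisterhood: $\mathcal{S}_b$ relates the two occurrences $[$, $]$ or $\bar{[}$, $\bar{]}$ coming from the same $\langle\rangle A$, $\Box^{\downarrow}A$ or $[\Gamma]$; $\mathcal{S}_c$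 likewise relates the two connective occurrences coming from the same $\langle\rangle A$, $\Box^{\downarrow}A$ or $[\Gamma]$. A proof structure is a symmetric relation $\mathcal{E}$ on $\{\ell_1,\dots,\ell_n\}$ relating each occurrence to exactly one occurrence, each occurrence of $q$ ($q$ a variable, $[$ or $]$) to an occurrence of $\bar q$. It is planar if it can be drawn without crossings in the upper half-plane with $\ell_1,\dots,\ell_n$ in order on the boundary line; $c_i$ sits on the boundary just before $\ell_i$ and lies in the adjacent region (the unbounded region counts). A planar proof structure is a proof net iff (1) every region contains exactly one occurrence of $⅋$ or $\diamond$, and (2) with $\mathcal{A}$ the directed graph sending each $\otimes$ occurrence to the unique $⅋$ or $\diamond$ occurrence in its region, $\mathcal{A}\cup{\prec}$ is acyclic. $\mathcal{E}$ respects sisterhood iff whenever $\langle\ell_i,\ell_{i'}\rangle\in\mathcal{E}$, $\langle\ell_i,\ell_j\rangle\in\mathcal{S}_b$ and $\langle\ell_{i'},\ell_{j'}\rangle\in\mathcal{S}_b$, also $\langle\ell_j,\ell_{j'}\rangle\in\mathcal{E}$. *)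

theory Defs
  imports Main
begin

(* LDiv A B is A \ B, RDiv B A is B / A, Dia and Box are the bracket modalities. *)
datatype form =
    Var nat
  | LDiv form form
  | RDiv form form
  | Prod form form
  | Dia form
  | Box form

(* Comma is list append and the empty meta-formula is [], so associativity and the unit laws
   hold definitionally. *)
datatype item = Fm form | Br "item list"

type_synonym meta = "item list"

(* Meta-formulas with one hole, possibly below brackets. *)
datatype ctxt = Hole meta meta | InBr meta ctxt meta

primrec plug :: "ctxt \<Rightarrow> meta \<Rightarrow> meta" where
  "plug (Hole L R) X = L @ X @ R"
| "plug (InBr L D R) X = L @ [Br (plug D X)] @ R"

inductive derivable :: "meta \<Rightarrow> form \<Rightarrow> bool" where
  ax: "derivable [Fm (Var i)] (Var i)"
| LDivL: "derivable P A \<Longrightarrow> derivable (plug D [Fm B]) C \<Longrightarrow>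
    derivable (plug D (P @ [Fm (LDiv A B)])) C"
| LDivR: "derivable (Fm A # P) B \<Longrightarrow> derivable P (LDiv A B)"
| RDivL: "derivable P A \<Longrightarrow> derivable (plug D [Fm B]) C \<Longrightarrow>
    derivable (plug D (Fm (RDiv B A) # P)) C"
| RDivR: "derivable (P @ [Fm A]) B \<Longrightarrow> derivable P (RDiv B A)"
| ProdL: "derivable (plug G [Fm A, Fm B]) C \<Longrightarrow> derivable (plug G [Fm (Prod A B)]) C"
| ProdR: "derivable G A \<Longrightarrow> derivable D B \<Longrightarrow> derivable (G @ D) (Prod A B)"
| DiaL: "derivable (plug D [Br [Fm A]]) C \<Longrightarrow> derivable (plug D [Fm (Dia A)]) C"
| DiaR: "derivable P A \<Longrightarrow> derivable [Br P] (Dia A)"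
| BoxL: "derivable (plug D [Fm A]) C \<Longrightarrow> derivable (plug D [Br [Fm (Box A)]]) C"
| BoxR: "derivable [Br P] A \<Longrightarrow> derivable P (Box A)"

datatype atom = Prim nat | Opening | Closing

datatype literal = Pos atom | Neg atom

primrec dual :: "literal \<Rightarrow> literal" where
  "dual (Pos q) = Neg q"
| "dual (Neg q) = Pos q"

datatype expr = Lit literal | Par expr expr | Tensor expr expr

fun pos :: "form \<Rightarrow> expr" and neg :: "form \<Rightarrow> expr" where
  "pos (Var i) = Lit (Pos (Prim i))"
| "pos (LDiv A B) = Par (neg A) (pos B)"
| "pos (RDiv B A) = Par (pos B) (neg A)"
| "pos (Prod A B) = Tensor (pos A) (pos B)"
| "pos (Dia A) = Tensor (Lit (Pos Closing)) (Tensor (pos A) (Lit (Pos Opening)))"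
| "pos (Box A) = Par (Par (Lit (Neg Closing)) (pos A)) (Lit (Neg Opening))"
| "neg (Var i) = Lit (Neg (Prim i))"
| "neg (LDiv A B) = Tensor (neg B) (pos A)"
| "neg (RDiv B A) = Tensor (pos A) (neg B)"
| "neg (Prod A B) = Par (neg B) (neg A)"
| "neg (Dia A) = Par (Par (Lit (Neg Opening)) (neg A)) (Lit (Neg Closing))"
| "neg (Box A) = Tensor (Lit (Pos Opening)) (Tensor (neg A) (Lit (Pos Closing)))"

(* A list [X1, ..., Xm] of expressions stands for X1, ..., Xm joined by the diamond connective.
   In particular the empty bracket becomes its two literals joined by a single diamond. *)
fun item_neg :: "item \<Rightarrow> expr list" and meta_neg :: "meta \<Rightarrow> expr list" where
  "item_neg (Fm A) = [neg A]"
| "item_neg (Br G) = [Lit (Neg Opening)] @ meta_neg G @ [Lit (Neg Closing)]"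
| "meta_neg [] = []"
| "meta_neg (x # G) = meta_neg G @ item_neg x"

(* Here each expression of the list, including the first, is preceded by a diamond. *)
definition sequent_exprs :: "meta \<Rightarrow> form \<Rightarrow> expr list" where
  "sequent_exprs G C = meta_neg G @ [pos C]"

datatype connective = CPar | CTensor | CDiamond

primrec lits :: "expr \<Rightarrow> literal list" where
  "lits (Lit q) = [q]"
| "lits (Par X Y) = lits X @ lits Y"
| "lits (Tensor X Y) = lits X @ lits Y"

primrec conns :: "expr \<Rightarrow> connective list" where
  "conns (Lit q) = []"
| "conns (Par X Y) = conns X @ [CPar] @ conns Y"
| "conns (Tensor X Y) = conns X @ [CTensor] @ conns Y"

abbreviation width :: "expr \<Rightarrow> nat" where
  "width X \<equiv> length (lits X)"

(* Omega consists of the occurrences c_0, l_0, ..., c_(n-1), l_(n-1) in this order, where c_i is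
   entry i of omega_conns and l_i is entry i of omega_lits. Literal and connective occurrences
   are both referred to by their index, counted from 0. *)
definition omega_lits :: "expr list \<Rightarrow> literal list" where
  "omega_lits Xs = concat (map lits Xs)"

definition omega_conns :: "expr list \<Rightarrow> connective list" where
  "omega_conns Xs = concat (map (\<lambda>X. CDiamond # conns X) Xs)"

(* If the literals of X have indices k, ..., k + width X - 1, then the connectives of X have
   indices k + 1, ..., k + width X - 1, as c_k precedes X. The central occurrence of a compound
   expression precedes its right component. *)
primrec expr_dominance :: "nat \<Rightarrow> expr \<Rightarrow> (nat \<times> nat) set" where
  "expr_dominance k (Lit q) = {}"
| "expr_dominance k (Par X Y) =
    expr_dominance k X \<union> expr_dominance (k + width X) Y \<union>
    ({k <..< k + width X} \<union> {k + width X <..< k + width X + width Y}) \<times> {k + width X}"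
| "expr_dominance k (Tensor X Y) =
    expr_dominance k X \<union> expr_dominance (k + width X) Y \<union>
    ({k <..< k + width X} \<union> {k + width X <..< k + width X + width Y}) \<times> {k + width X}"

primrec dominance_from :: "nat \<Rightarrow> expr list \<Rightarrow> (nat \<times> nat) set" where
  "dominance_from k [] = {}"
| "dominance_from k (X # Xs) = expr_dominance k X \<union> dominance_from (k + width X) Xs"

(* The pair (j, i) is in the relation iff c_j is dominated by c_i. *)
definition dominance :: "expr list \<Rightarrow> (nat \<times> nat) set" where
  "dominance Xs = dominance_from 0 Xs"

definition sister_pair :: "nat \<Rightarrow> nat \<Rightarrow> (nat \<times> nat) set" where
  "sister_pair i j = {(i, j), (j, i)}"

(* Bracket sisterhood among the literals of pos A and neg A, when these start at index k.
   Each equation follows the order of the components in the corresponding translation. *)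
fun pos_sisters :: "nat \<Rightarrow> form \<Rightarrow> (nat \<times> nat) set"
  and neg_sisters :: "nat \<Rightarrow> form \<Rightarrow> (nat \<times> nat) set" where
  "pos_sisters k (Var i) = {}"
| "pos_sisters k (LDiv A B) = neg_sisters k A \<union> pos_sisters (k + width (neg A)) B"
| "pos_sisters k (RDiv B A) = pos_sisters k B \<union> neg_sisters (k + width (pos B)) A"
| "pos_sisters k (Prod A B) = pos_sisters k A \<union> pos_sisters (k + width (pos A)) B"
| "pos_sisters k (Dia A) = pos_sisters (k + 1) A \<union> sister_pair k (k + 1 + width (pos A))"
| "pos_sisters k (Box A) = pos_sisters (k + 1) A \<union> sister_pair k (k + 1 + width (pos A))"
| "neg_sisters k (Var i) = {}"
| "neg_sisters k (LDiv A B) = neg_sisters k B \<union> pos_sisters (k + width (neg B)) A"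
| "neg_sisters k (RDiv B A) = pos_sisters k A \<union> neg_sisters (k + width (pos A)) B"
| "neg_sisters k (Prod A B) = neg_sisters k B \<union> neg_sisters (k + width (neg B)) A"
| "neg_sisters k (Dia A) = neg_sisters (k + 1) A \<union> sister_pair k (k + 1 + width (neg A))"
| "neg_sisters k (Box A) = neg_sisters (k + 1) A \<union> sister_pair k (k + 1 + width (neg A))"

fun item_sisters :: "nat \<Rightarrow> item \<Rightarrow> (nat \<times> nat) set"
  and meta_sisters :: "nat \<Rightarrow> meta \<Rightarrow> (nat \<times> nat) set" where
  "item_sisters k (Fm A) = neg_sisters k A"
| "item_sisters k (Br G) =
    meta_sisters (k + 1) G \<union> sister_pair k (k + 1 + length (omega_lits (meta_neg G)))"
| "meta_sisters k [] = {}"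
| "meta_sisters k (x # G) =
    meta_sisters k G \<union> item_sisters (k + length (omega_lits (meta_neg G))) x"

definition sisters :: "meta \<Rightarrow> form \<Rightarrow> (nat \<times> nat) set" where
  "sisters G C = meta_sisters 0 G \<union> pos_sisters (length (omega_lits (meta_neg G))) C"

definition proof_structure :: "literal list \<Rightarrow> (nat \<times> nat) set \<Rightarrow> bool" where
  "proof_structure ls E \<longleftrightarrow>
    E \<subseteq> {..<length ls} \<times> {..<length ls} \<and> sym E \<and>
    (\<forall>i<length ls. \<exists>!j. (i, j) \<in> E) \<and>
    (\<forall>(i, j)\<in>E. ls ! j = dual (ls ! i))"

(* Links can be drawn in the upper half-plane without crossings iff no two of them interleave
   on the boundary line. *)
definition planar :: "(nat \<times> nat) set \<Rightarrow> bool" where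
  "planar E \<longleftrightarrow> \<not> (\<exists>i j k l. (i, k) \<in> E \<and> (j, l) \<in> E \<and> i < j \<and> j < k \<and> k < l)"

(* Boundary points lie in the same region iff no link separates them. As c_i sits just before
   l_i, it is beneath the link joining l_a and l_b, a < b, iff a < i and i <= b. *)
definition beneath :: "nat \<Rightarrow> nat \<times> nat \<Rightarrow> bool" where
  "beneath i = (\<lambda>(a, b). a < i \<and> i \<le> b)"

definition same_region :: "nat \<Rightarrow> (nat \<times> nat) set \<Rightarrow> (nat \<times> nat) set" where
  "same_region n E =
    {(i, j). i < n \<and> j < n \<and> (\<forall>(a, b)\<in>E. a < b \<longrightarrow> (beneath i (a, b) \<longleftrightarrow> beneath j (a, b)))}"

(* A region is given by the set of indices of the connective occurrences in it. No region is lost: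
   c_0 lies in the unbounded region, and c_(a+1) in the region immediately beneath the link
   joining l_a and l_b, a < b. *)
definition regions :: "nat \<Rightarrow> (nat \<times> nat) set \<Rightarrow> nat set set" where
  "regions n E = {..<n} // same_region n E"

(* When every region contains exactly one occurrence of par or diamond, this relates each tensor
   occurrence to exactly one connective occurrence. *)
definition region_graph :: "connective list \<Rightarrow> (nat \<times> nat) set \<Rightarrow> (nat \<times> nat) set" where
  "region_graph cs E =
    {(i, j) \<in> same_region (length cs) E. cs ! i = CTensor \<and> cs ! j \<in> {CPar, CDiamond}}"

definition proof_net :: "expr list \<Rightarrow> (nat \<times> nat) set \<Rightarrow> bool" where
  "proof_net Xs E \<longleftrightarrow>
    proof_structure (omega_lits Xs) E \<and> planar E \<and>
    (\<forall>R\<in>regions (length (omega_conns Xs)) E. \<exists>!i. i \<in> R \<and> omega_conns Xs ! i \<in> {CPar, CDiamond}) \<and>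
    acyclic (region_graph (omega_conns Xs) E \<union> dominance Xs)"

definition respects_sisterhood :: "(nat \<times> nat) set \<Rightarrow> (nat \<times> nat) set \<Rightarrow> bool" where
  "respects_sisterhood S E \<longleftrightarrow>
    (\<forall>i i' j j'. (i, i') \<in> E \<and> (i, j) \<in> S \<and> (i', j') \<in> S \<longrightarrow> (j, j') \<in> E)"

end

(* Occurrences of literals are given unique names, so that a net becomes a property of a cyclic list
   of expressions: the sides of a link are sets of names, and rotating the list changes neither the
   regions nor dominance. A par can be replaced by a diamond, and two nets can be joined at a tensor.
   Conversely, if no outermost connective is a par, then acyclicity yields an outermost tensor that
   shares its region with a diamond, and the net splits there. Induction along these steps shows that
   a net over translated formulas has exactly one positive expression, so that the splits are
   instances of the rules of the Lambek calculus.

   For the brackets, each pair of sisters is given one label, shared with the pair that it is linked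
   to. The region beneath a link between two literals, of which one is followed and the other preceded
   by a diamond, contains just one diamond, so these literals are adjacent. Hence a modality whose
   brackets are linked to those of a bracketed meta-formula stands alone in these brackets, and the
   bracket rules apply. *)
theory Submission
  imports Defs "HOL-Library.Nat_Bijection"
begin

text \<open>The tree of brackets is the obstacle. A net sees the antecedent only as a word, in which
  the brackets of an item are ordinary negative literals, so a split might cut through a bracketed
  item; moreover the left rules act in contexts, whereas a net yields only factors of a word. What
  helps is that a piece which is again a sequent is closed under duality. Positive brackets occur
  only inside modalities, where sisters come together; hence the negative brackets of the piece come
  in pairs too, and with distinct names this weak pairing already forces the cut to fall between
  items. Sharing one label between two linked pairs of sisters turns respect for sisterhood into a
  property of names: the links are determined by the word alone, as duality of distinct literals,
  and the sisters of linked brackets are linked automatically. The relation \<open>E\<close> and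
  sisterhood thus vanish from the inductions and return only where indices are compared with
  names.\<close>

lemma dual_dual [simp]: "dual (dual q) = q"
  by (cases q) auto

lemma dual_neq [simp]: "dual q \<noteq> q" "q \<noteq> dual q"
  by (cases q; auto)+

lemma dual_eq_iff [simp]: "dual q = dual r \<longleftrightarrow> q = r"
  by (metis dual_dual)

section \<open>Acyclicity of unions\<close>

text \<open>A path cannot be continued beyond \<open>s\<close>, so an edge into \<open>s\<close>
  lies on no cycle. Pars and diamonds of outermost expressions are such sinks.\<close>

lemma acyclic_add_sink:
  assumes "acyclic R" "s \<notin> Domain R" "s \<notin> X"
  shows "acyclic (R \<union> X \<times> {s})"
proof -
  have "(x, y) \<in> (R \<union> X \<times> {s})\<^sup>+ \<Longrightarrow> x \<noteq> s \<and> (y = s \<or> (x, y) \<in> R\<^sup>+)" for x y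
    by (induction rule: trancl_induct) (use assms in \<open>auto intro: trancl_into_trancl\<close>)
  then show ?thesis
    using assms(1) unfolding acyclic_def by blast
qed

lemma acyclic_Un_disjoint:
  assumes "acyclic R" "acyclic S" "Field R \<inter> Field S = {}"
  shows "acyclic (R \<union> S)"
proof -
  have "(x, y) \<in> (R \<union> S)\<^sup>+ \<Longrightarrow> (x, y) \<in> R\<^sup>+ \<or> (x, y) \<in> S\<^sup>+" for x y
  proof (induction rule: trancl_induct)
    case (step y z)
    have "y \<in> Field R \<or> y \<in> Field S"
      using step.IH by (metis FieldI2 trancl.cases)
    moreover have "(x, y) \<in> R\<^sup>+ \<Longrightarrow> y \<in> Field R" "(x, y) \<in> S\<^sup>+ \<Longrightarrow> y \<in> Field S"
      by (metis FieldI2 trancl.cases)+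
    moreover have "(y, z) \<in> R \<Longrightarrow> y \<in> Field R" "(y, z) \<in> S \<Longrightarrow> y \<in> Field S"
      by (auto simp: Field_def)
    ultimately show ?case
      using step assms(3) by (blast intro: trancl_into_trancl)
  qed auto
  then show ?thesis
    using assms unfolding acyclic_def by blast
qed

subsection \<open>Nets over words of distinct literals\<close>

text \<open>A word of distinct literals whose set is closed under duals carries its own proof
  structure: each literal is linked to its dual.\<close>

definition dual_closed :: "literal set \<Rightarrow> bool" where
  "dual_closed S \<longleftrightarrow> (\<forall>q\<in>S. dual q \<in> S)"

text \<open>For \<open>q\<close> outside \<open>L\<close> this is all of \<open>set L\<close>, which
  suits \<open>before_append\<close>: a literal not in \<open>A\<close> has the whole of
  \<open>A\<close> before it.\<close>

definition before :: "literal list \<Rightarrow> literal \<Rightarrow> literal set" where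
  "before L q = set (takeWhile (\<lambda>x. x \<noteq> q) L)"

(* The link of x separates the position just before q from the unbounded region. *)
definition under :: "literal list \<Rightarrow> literal \<Rightarrow> literal \<Rightarrow> bool" where
  "under L q x \<longleftrightarrow> (x \<in> before L q) \<noteq> (dual x \<in> before L q)"

definition same_face :: "literal list \<Rightarrow> literal \<Rightarrow> literal \<Rightarrow> bool" where
  "same_face L q r \<longleftrightarrow> q \<in> set L \<and> r \<in> set L \<and> (\<forall>x. under L q x \<longleftrightarrow> under L r x)"

text \<open>Two links do not cross when both ends of the one lie on the same side of the other. As
  \<open>y\<close> is neither \<open>x\<close> nor \<open>dual x\<close>, the position just before
  an end of the link of \<open>x\<close> is as good as the end itself.\<close>

definition noncrossing :: "literal list \<Rightarrow> bool" where
  "noncrossing L \<longleftrightarrow>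
    (\<forall>x\<in>set L. \<forall>y. y \<noteq> x \<longrightarrow> y \<noteq> dual x \<longrightarrow> (under L x y \<longleftrightarrow> under L (dual x) y))"

definition switches :: "literal list \<Rightarrow> literal set \<Rightarrow> (literal \<times> literal) set" where
  "switches L T = {(q, r). same_face L q r \<and> q \<in> T \<and> r \<notin> T}"

text \<open>Expressions are reduced to the names \<open>T\<close> of the tensors and a relation
  \<open>D\<close> for dominance. Pars and diamonds are not told apart, so replacing an outermost
  par by a diamond affects \<open>D\<close> alone.\<close>

definition net :: "literal list \<Rightarrow> literal set \<Rightarrow> (literal \<times> literal) set \<Rightarrow> bool" where
  "net L T D \<longleftrightarrow> distinct L \<and> dual_closed (set L) \<and> noncrossing L \<and>
    (\<forall>q\<in>set L. \<exists>!r. same_face L q r \<and> r \<notin> T) \<and> acyclic (switches L T \<union> D)"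

lemma dual_closedD: "dual_closed S \<Longrightarrow> dual q \<in> S \<longleftrightarrow> q \<in> S"
  unfolding dual_closed_def by (metis dual_dual)

lemma before_append:
  "before (A @ B) q = (if q \<in> set A then before A q else set A \<union> before B q)"
  by (auto simp: before_def takeWhile_append takeWhile_eq_all_conv)

lemma before_subset: "before L q \<subseteq> set L"
  by (auto simp: before_def dest: set_takeWhileD)

lemma before_Cons: "before (x # L) q = (if x = q then {} else insert x (before L q))"
  by (cases "x = q") (simp_all add: before_def)

lemma before_hd [simp]: "L \<noteq> [] \<Longrightarrow> before L (hd L) = {}"
  by (cases L) (auto simp: before_def)

lemma before_total:
  "q \<in> set L \<Longrightarrow> r \<in> set L \<Longrightarrow> q \<noteq> r \<Longrightarrow> q \<in> before L r \<longleftrightarrow> r \<notin> before L q"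
  by (induction L) (use before_subset in \<open>auto simp: before_Cons\<close>)

lemma under_hd [simp]: "L \<noteq> [] \<Longrightarrow> \<not> under L (hd L) x"
  by (simp add: under_def)

lemma same_face_refl: "q \<in> set L \<Longrightarrow> same_face L q q"
  by (simp add: same_face_def)

lemma same_face_sym: "same_face L q r \<Longrightarrow> same_face L r q"
  by (simp add: same_face_def)

lemma same_face_commute: "same_face L q r \<longleftrightarrow> same_face L r q"
  by (auto simp: same_face_def)

lemma same_face_unique:
  assumes "\<exists>!s. same_face L q s \<and> s \<notin> T" "q \<in> set L" "q \<notin> T" "same_face L r q" "r \<notin> T"
  shows "r = q"
proof -
  obtain s where s: "\<And>t. same_face L q t \<Longrightarrow> t \<notin> T \<Longrightarrow> t = s"
    using assms(1) by blast
  have "r = s" "q = s"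
    using s[OF same_face_sym] s[OF same_face_refl] assms by simp_all
  then show ?thesis by simp
qed

lemma same_face_trans: "same_face L q r \<Longrightarrow> same_face L r s \<Longrightarrow> same_face L q s"
  by (simp add: same_face_def)

(* Moving a suffix to the front negates "under" exactly for the links joining the two parts. *)
lemma under_rotate:
  assumes "distinct (A @ B)" "dual_closed (set (A @ B))" "q \<in> set (A @ B)"
  shows "under (B @ A) q x \<longleftrightarrow> (under (A @ B) q x \<noteq> ((x \<in> set A) \<noteq> (dual x \<in> set A)))"
proof -
  have "(x \<in> set A \<or> x \<in> set B) = (dual x \<in> set A \<or> dual x \<in> set B)"
    using dual_closedD[OF assms(2), of x] by simp
  moreover have "\<not> (x \<in> set A \<and> x \<in> set B)" "\<not> (dual x \<in> set A \<and> dual x \<in> set B)"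
    using assms(1) by auto
  moreover have "q \<in> set A \<Longrightarrow> q \<notin> set B" "q \<notin> set A \<Longrightarrow> q \<in> set B"
    using assms by auto
  ultimately show ?thesis
    using before_subset[of A q] before_subset[of B q]
    by (cases "q \<in> set A") (auto simp: under_def before_append)
qed

text \<open>Rotation changes \<open>under\<close> at every position by the same bit, which depends
  on \<open>x\<close> alone, so the agreement of two positions is not affected.\<close>

lemma same_face_rotate:
  assumes "distinct (A @ B)" "dual_closed (set (A @ B))"
  shows "same_face (B @ A) q r \<longleftrightarrow> same_face (A @ B) q r"
proof (cases "q \<in> set (A @ B) \<and> r \<in> set (A @ B)")
  case True
  then have "under (B @ A) q x = under (B @ A) r x \<longleftrightarrow> under (A @ B) q x = under (A @ B) r x" for x
    using under_rotate[OF assms] by blast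
  then show ?thesis
    using True by (auto simp: same_face_def)
qed (auto simp: same_face_def)

lemma net_rotate:
  assumes "net (A @ B) T D"
  shows "net (B @ A) T D"
proof -
  have L: "distinct (A @ B)" "dual_closed (set (A @ B))"
    using assms by (auto simp: net_def)
  have sf: "same_face (B @ A) = same_face (A @ B)"
    using same_face_rotate[OF L] by (intro ext)
  have "noncrossing (B @ A)"
    unfolding noncrossing_def
  proof (intro ballI allI impI)
    fix x y assume x: "x \<in> set (B @ A)" and y: "y \<noteq> x" "y \<noteq> dual x"
    then have "x \<in> set (A @ B)" "dual x \<in> set (A @ B)"
      using L(2) by (auto simp: dual_closed_def)
    then show "under (B @ A) x y = under (B @ A) (dual x) y"
      using assms y under_rotate[OF L, of x y] under_rotate[OF L, of "dual x" y]
      unfolding net_def noncrossing_def by metis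
  qed
  then show ?thesis
    using assms unfolding net_def switches_def sf by (auto simp: Un_commute)
qed

lemma before_next:
  "distinct (U @ [c, d] @ V) \<Longrightarrow> before (U @ [c, d] @ V) d = insert c (before (U @ [c, d] @ V) c)"
  by (auto simp: before_append before_Cons)

(* Walking around a face: past the literal c one arrives on the same side of the link as just
   before its dual. *)
lemma face_next:
  assumes "net (U @ [c, d] @ V) T D"
  shows "same_face (U @ [c, d] @ V) d (dual c)"
proof -
  let ?L = "U @ [c, d] @ V"
  have L: "distinct ?L" "dual_closed (set ?L)" "noncrossing ?L"
    using assms by (auto simp: net_def)
  have mem: "c \<in> set ?L" "dual c \<in> set ?L" "d \<in> set ?L"
    using L(2) by (auto simp: dual_closed_def)
  have nb: "q \<notin> before ?L q" for q
    by (auto simp: before_def dest: set_takeWhileD)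
  have ord: "c \<in> before ?L (dual c) \<longleftrightarrow> dual c \<notin> before ?L c"
    using mem L(1) before_subset[of U c] before_subset[of U "dual c"] before_total[of c U "dual c"]
    by (auto simp: before_append before_Cons)
  have "under ?L d y = under ?L (dual c) y" for y
  proof (cases "y = c \<or> y = dual c")
    \<comment> \<open>For the link of \<open>c\<close> itself the two positions agree because
      exactly one of its ends precedes the other.\<close>
    case True
    then show ?thesis
      using ord nb[of c] nb[of "dual c"] unfolding under_def before_next[OF L(1)] by auto
  next
    \<comment> \<open>Any other link ignores the step across \<open>c\<close>, and by noncrossing it
      has both ends of the link of \<open>c\<close> on one side.\<close>
    case False
    then have "under ?L d y = under ?L c y"
      unfolding under_def before_next[OF L(1)] by auto
    then show ?thesis
      using L(3) mem False unfolding noncrossing_def by auto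
  qed
  then show ?thesis
    using mem by (simp add: same_face_def)
qed

text \<open>\<open>d\<close> and \<open>dual c\<close> share a region by \<open>face_next\<close>,
  and a region has only one occurrence outside \<open>T\<close>.\<close>

lemma net_next:
  assumes "net (U @ [c, d] @ V) T D" "d \<notin> T" "dual c \<notin> T"
  shows "d = dual c"
proof -
  have "same_face (U @ [c, d] @ V) d (dual c)" "same_face (U @ [c, d] @ V) d d"
    using face_next[OF assms(1)] by (auto intro: same_face_refl)
  then show ?thesis
    using assms unfolding net_def by (metis same_face_def)
qed

text \<open>Two closed words side by side: no link joins them, so their regions stay as they were,
  except that the two unbounded ones, which contain the heads, are merged.\<close>

locale word_concat =
  fixes L M :: "literal list"
  assumes nonempty: "L \<noteq> []" "M \<noteq> []"
    and dist: "distinct (L @ M)"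
    and closed: "dual_closed (set L)" "dual_closed (set M)"
begin

lemma closed_append: "dual_closed (set (L @ M))"
  using closed by (auto simp: dual_closed_def)

lemma under_left: "q \<in> set L \<Longrightarrow> under (L @ M) q x \<longleftrightarrow> under L q x"
  by (simp add: under_def before_append)

lemma under_outside:
  "x \<notin> set L \<Longrightarrow> \<not> under L q x" "x \<notin> set M \<Longrightarrow> \<not> under M q x"
  using before_subset[of L q] before_subset[of M q] dual_closedD[OF closed(1), of x]
    dual_closedD[OF closed(2), of x] by (auto simp: under_def)

lemma under_right: "q \<in> set M \<Longrightarrow> under (L @ M) q x \<longleftrightarrow> under M q x"
proof -
  assume q: "q \<in> set M"
  then have "q \<notin> set L" using dist by auto
  moreover have "\<not> (x \<in> set L \<and> x \<in> before M q)" "\<not> (dual x \<in> set L \<and> dual x \<in> before M q)"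
    using before_subset[of M q] dist by auto
  ultimately show ?thesis
    using dual_closedD[OF closed(1), of x] by (auto simp: under_def before_append)
qed

lemma under_disjoint: "\<not> (under L q x \<and> under M r x)"
  using under_outside dist by (metis disjoint_iff distinct_append)

lemma face_left: "q \<in> set L \<Longrightarrow> r \<in> set L \<Longrightarrow> same_face (L @ M) q r \<longleftrightarrow> same_face L q r"
  by (simp add: same_face_def under_left)

lemma face_right: "q \<in> set M \<Longrightarrow> r \<in> set M \<Longrightarrow> same_face (L @ M) q r \<longleftrightarrow> same_face M q r"
  by (simp add: same_face_def under_right)

text \<open>No link covers positions of both words, so a common region can only be the unbounded
  one.\<close>

lemma face_across:
  "q \<in> set L \<Longrightarrow> r \<in> set M \<Longrightarrow>
    same_face (L @ M) q r \<longleftrightarrow> same_face L q (hd L) \<and> same_face M r (hd M)"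
  using under_disjoint nonempty by (auto simp: same_face_def under_left under_right)

lemma face_across':
  "r \<in> set M \<Longrightarrow> q \<in> set L \<Longrightarrow>
    same_face (L @ M) r q \<longleftrightarrow> same_face L q (hd L) \<and> same_face M r (hd M)"
  using face_across[of q r] same_face_commute by metis

lemma face_right_head: "r \<in> set M \<Longrightarrow> same_face (L @ M) r (hd L) \<longleftrightarrow> same_face M r (hd M)"
  using nonempty by (simp add: face_across' same_face_refl)

lemma noncrossing_append: "noncrossing (L @ M) \<longleftrightarrow> noncrossing L \<and> noncrossing M"
proof -
  have "q \<in> set L \<Longrightarrow> under (L @ M) (dual q) x = under L (dual q) x"
    "q \<in> set M \<Longrightarrow> under (L @ M) (dual q) x = under M (dual q) x" for q x
    using closed by (auto simp: dual_closed_def under_left under_right)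
  then show ?thesis
    unfolding noncrossing_def by (simp add: ball_Un under_left under_right)
qed

end

text \<open>The merged unbounded region would have two occurrences outside the tensors,
  \<open>hd L\<close> and \<open>hd M\<close>; making the latter a tensor leaves one. For
  acyclicity, the edges inside the two words have disjoint fields, then \<open>hd M\<close> is added
  as a sink for \<open>X\<close>, and finally \<open>hd L\<close> as a sink for the edges that come
  from \<open>M\<close>.\<close>

lemma net_join:
  assumes L: "net L T D" and M: "net M T' D'"
    and ne: "L \<noteq> []" "M \<noteq> []" and disj: "set L \<inter> set M = {}"
    and T: "T \<subseteq> set L - {hd L}" "T' \<subseteq> set M - {hd M}"
    and D: "Field D \<subseteq> set L - {hd L}" "Field D' \<subseteq> set M - {hd M}"
    and X: "hd L \<notin> X" "hd M \<notin> X"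
  shows "net (L @ M) (insert (hd M) (T \<union> T')) (D \<union> D' \<union> X \<times> {hd M})"
proof -
  interpret word_concat L M
    using L M ne disj by unfold_locales (auto simp: net_def)
  let ?T = "insert (hd M) (T \<union> T')"
  have hL: "hd L \<in> set L" "hd L \<notin> set M" "hd M \<in> set M" "hd M \<notin> set L"
    using hd_in_set[OF ne(1)] hd_in_set[OF ne(2)] disj by blast+
  have uL: "\<exists>!r. same_face L q r \<and> r \<notin> T" if "q \<in> set L" for q
    using L that by (auto simp: net_def)
  have uM: "\<exists>!r. same_face M q r \<and> r \<notin> T'" if "q \<in> set M" for q
    using M that by (auto simp: net_def)
  have mem: "same_face W q r \<Longrightarrow> q \<in> set W \<and> r \<in> set W" for W q r
    by (simp add: same_face_def)
  have headM: "r = hd M" if "same_face M r (hd M)" "r \<notin> T'" for r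
    using same_face_unique[OF uM[of "hd M"]] that T(2) hL by blast
  have headL: "r = hd L" if "same_face L r (hd L)" "r \<notin> T" for r
    using same_face_unique[OF uL[of "hd L"]] that T(1) hL by blast
  have 1: "\<exists>!r. same_face (L @ M) q r \<and> r \<notin> ?T" if q: "q \<in> set (L @ M)" for q
  proof (cases "q \<in> set L")
    case True
    obtain r where r: "same_face L q r" "r \<notin> T" "\<And>s. same_face L q s \<Longrightarrow> s \<notin> T \<Longrightarrow> s = r"
      using uL[OF True] by blast
    show ?thesis
    proof (rule ex1I[of _ r])
      show "same_face (L @ M) q r \<and> r \<notin> ?T"
        using r(1,2) True mem[OF r(1)] T(2) disj hL by (auto simp: face_left)
    next
      fix s assume s: "same_face (L @ M) q s \<and> s \<notin> ?T"
      show "s = r"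
      proof (cases "s \<in> set L")
        case False
        then have "s \<in> set M" using mem s by force
        then have "s = hd M" using s True by (auto simp: face_across intro: headM)
        then show ?thesis using s by simp
      qed (use s True r(3) in \<open>simp add: face_left\<close>)
    qed
  next
    case False
    then have qM: "q \<in> set M" using q by simp
    show ?thesis
    proof (cases "same_face M q (hd M)")
      \<comment> \<open>The occurrence outside \<open>T'\<close> in this region was
        \<open>hd M\<close>, now a tensor; \<open>hd L\<close> takes over.\<close>
      case True
      show ?thesis
      proof (rule ex1I[of _ "hd L"])
        show "same_face (L @ M) q (hd L) \<and> hd L \<notin> ?T"
          using True hL T disj qM by (auto simp: face_right_head)
      next
        fix s assume s: "same_face (L @ M) q s \<and> s \<notin> ?T"
        show "s = hd L"
        proof (cases "s \<in> set L")
          case True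
          then show ?thesis
            using s qM by (intro headL) (auto simp: face_across')
        next
          case False
          then have "same_face M q s" using s qM mem face_right by force
          then have "same_face M s (hd M)"
            using True same_face_trans[OF same_face_sym] by blast
          then show ?thesis using s headM by auto
        qed
      qed
    next
      case nh: False
      obtain r where r: "same_face M q r" "r \<notin> T'" "\<And>s. same_face M q s \<Longrightarrow> s \<notin> T' \<Longrightarrow> s = r"
        using uM[OF qM] by blast
      show ?thesis
      proof (rule ex1I[of _ r])
        show "same_face (L @ M) q r \<and> r \<notin> ?T"
          using r(1,2) qM mem[OF r(1)] T(1) disj nh by (auto simp: face_right)
      next
        fix s assume s: "same_face (L @ M) q s \<and> s \<notin> ?T"
        have "s \<notin> set L"
          using s nh qM by (auto simp: face_across')
        then have "same_face M q s" using s qM mem face_right by force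
        then show "s = r" using s r(3) by blast
      qed
    qed
  qed
  define RL where "RL = switches L T \<union> D"
  \<comment> \<open>Edges into \<open>hd M\<close> are left out: in the joined word they lead to
    \<open>hd L\<close> instead.\<close>
  define RM where "RM = {(q, r) \<in> switches M T'. r \<noteq> hd M} \<union> D'"
  have FL: "Field RL \<subseteq> set L" and FM: "Field RM \<subseteq> set M - {hd M}"
    using D T mem by (fastforce simp: RL_def RM_def Field_def switches_def)+
  have "acyclic RL" "acyclic RM"
    using L M unfolding net_def RL_def RM_def by (auto elim: acyclic_subset)
  then have "acyclic (RL \<union> RM)"
    using FL FM disj by (intro acyclic_Un_disjoint) auto
  moreover have "hd M \<notin> Domain (RL \<union> RM)"
    using FL FM hL by (auto simp: Field_def)
  ultimately have "acyclic ((RL \<union> RM) \<union> X \<times> {hd M})"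
    using X by (intro acyclic_add_sink)
  moreover have "hd L \<notin> Domain ((RL \<union> RM) \<union> X \<times> {hd M})"
  proof -
    have "hd L \<notin> Domain RL"
      using T(1) D(1) by (auto simp: RL_def switches_def Field_def)
    then show ?thesis using FM hL X by (auto simp: Field_def)
  qed
  ultimately have "acyclic ((RL \<union> RM) \<union> X \<times> {hd M} \<union> (set M \<times> {hd L}))"
    by (rule acyclic_add_sink) (use hL in simp)
  moreover
  have "switches (L @ M) ?T \<subseteq> RL \<union> RM \<union> set M \<times> {hd L}"
  proof
    fix p assume "p \<in> switches (L @ M) ?T"
    then obtain q r where p: "p = (q, r)" and qr: "same_face (L @ M) q r" "q \<in> ?T" "r \<notin> ?T"
      by (auto simp: switches_def)
    have "q \<in> set L \<or> q \<in> set M" "r \<in> set L \<or> r \<in> set M" using mem[OF qr(1)] by auto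
    then consider "q \<in> set L" "r \<in> set L" | "q \<in> set L" "r \<in> set M" | "q \<in> set M" "r \<in> set L"
      | "q \<in> set M" "r \<in> set M" by blast
    then show "p \<in> RL \<union> RM \<union> set M \<times> {hd L}"
    proof cases
      case 1
      then show ?thesis using qr p T(2) disj hL by (auto simp: RL_def switches_def face_left)
    next
      case 2
      then have "r = hd M" using qr face_across headM by auto
      then show ?thesis using qr by simp
    next
      case 3
      then have "r = hd L" using qr by (intro headL) (auto simp: face_across')
      then show ?thesis using 3 p by simp
    next
      case 4
      then have "same_face M q r" using qr face_right by simp
      moreover have "q \<noteq> hd M"
        using headM[of r] same_face_sym[OF calculation] qr by blast
      ultimately show ?thesis
        using qr p T(1) disj 4 by (auto simp: RM_def switches_def)
    qed
  qed
  then have "switches (L @ M) ?T \<union> (D \<union> D' \<union> X \<times> {hd M}) \<subseteq>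
      RL \<union> RM \<union> X \<times> {hd M} \<union> set M \<times> {hd L}"
    by (auto simp: RL_def RM_def)
  ultimately have "acyclic (switches (L @ M) ?T \<union> (D \<union> D' \<union> X \<times> {hd M}))"
    by (rule acyclic_subset)
  then show ?thesis
    using 1 dist closed_append noncrossing_append L M by (simp add: net_def)
qed

text \<open>\<open>L\<close> inherits its edges from the whole word. In \<open>M\<close> the head is
  no tensor any more and receives the edges that led to \<open>hd L\<close>; no edge leaves it
  there, so no cycle arises.\<close>

lemma net_split:
  assumes net: "net (L @ M) (insert (hd M) (T \<union> T')) E"
    and ne: "L \<noteq> []" "M \<noteq> []" and cl: "dual_closed (set L)"
    and T: "T \<subseteq> set L - {hd L}" "T' \<subseteq> set M - {hd M}"
    and D: "D \<subseteq> E" "D' \<subseteq> E" "hd M \<notin> Domain D'"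
  shows "net L T D" "net M T' D'"
proof -
  have "dual_closed (set M)"
    using net cl unfolding net_def dual_closed_def
    by (metis Un_iff disjoint_iff distinct_append dual_dual set_append)
  then interpret word_concat L M
    using net ne cl by unfold_locales (auto simp: net_def)
  let ?T = "insert (hd M) (T \<union> T')"
  have disj: "set L \<inter> set M = {}" using dist by simp
  have hL: "hd L \<in> set L" "hd L \<notin> set M" "hd M \<in> set M" "hd M \<notin> set L"
    using hd_in_set[OF ne(1)] hd_in_set[OF ne(2)] disj by blast+
  have hLT: "hd L \<notin> ?T"
    using T hL by auto
  have u: "\<exists>!r. same_face (L @ M) q r \<and> r \<notin> ?T" if "q \<in> set (L @ M)" for q
    using net that unfolding net_def by blast
  have mem: "same_face W q r \<Longrightarrow> q \<in> set W \<and> r \<in> set W" for W q r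
    by (simp add: same_face_def)
  have head: "r = hd L" if "same_face (L @ M) r (hd L)" "r \<notin> ?T" for r
    using same_face_unique[OF u[of "hd L"] _ hLT that] hL by simp
  have uL: "\<exists>!r. same_face L q r \<and> r \<notin> T" if q: "q \<in> set L" for q
  proof -
    obtain r where r: "same_face (L @ M) q r" "r \<notin> ?T"
      "\<And>s. same_face (L @ M) q s \<Longrightarrow> s \<notin> ?T \<Longrightarrow> s = r"
      using u[of q, unfolded set_append, OF UnI1, OF q] by blast
    have rL: "r \<in> set L"
    proof (rule ccontr)
      assume "r \<notin> set L"
      then have "r \<in> set M" using mem[OF r(1)] by simp
      then have "same_face (L @ M) r (hd L)"
        using r(1) q by (simp add: face_across face_right_head)
      then show False using head r(2) \<open>r \<in> set M\<close> hL by blast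
    qed
    show ?thesis
    proof (rule ex1I[of _ r])
      show "same_face L q r \<and> r \<notin> T" using r(1,2) rL q face_left by auto
    next
      fix s assume s: "same_face L q s \<and> s \<notin> T"
      then have "s \<in> set L" using mem by blast
      moreover have "s \<notin> ?T" using s calculation T(2) disj hL by auto
      ultimately show "s = r" using s q by (intro r(3)) (auto simp: face_left)
    qed
  qed
  have uM: "\<exists>!r. same_face M q r \<and> r \<notin> T'" if q: "q \<in> set M" for q
  proof (cases "same_face M q (hd M)")
    \<comment> \<open>This region was part of the unbounded one, whose only occurrence outside the
      tensors is \<open>hd L\<close>; hence \<open>hd M\<close> is alone in it now.\<close>
    case True
    show ?thesis
    proof (rule ex1I[of _ "hd M"])
      show "same_face M q (hd M) \<and> hd M \<notin> T'" using True T(2) by auto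
    next
      fix s assume s: "same_face M q s \<and> s \<notin> T'"
      then have sM: "s \<in> set M" "same_face M s (hd M)"
        using mem same_face_trans[OF same_face_sym True] by blast+
      show "s = hd M"
      proof (rule ccontr)
        assume "s \<noteq> hd M"
        then have "s \<notin> ?T" using s sM T(1) disj by auto
        moreover have "same_face (L @ M) s (hd L)"
          using sM by (simp add: face_right_head)
        ultimately show False using head sM hL by blast
      qed
    qed
  next
    case nh: False
    obtain r where r: "same_face (L @ M) q r" "r \<notin> ?T"
      "\<And>s. same_face (L @ M) q s \<Longrightarrow> s \<notin> ?T \<Longrightarrow> s = r"
      using u[of q, unfolded set_append, OF UnI2, OF q] by blast
    have rM: "r \<in> set M"
      using mem[OF r(1)] r(1) q nh by (auto simp: face_across')
    show ?thesis
    proof (rule ex1I[of _ r])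
      show "same_face M q r \<and> r \<notin> T'" using r(1,2) rM q face_right by auto
    next
      fix s assume s: "same_face M q s \<and> s \<notin> T'"
      then have "s \<in> set M" using mem by blast
      moreover have "s \<noteq> hd M" using s nh by auto
      moreover have "s \<notin> T" using T(1) disj calculation by auto
      ultimately show "s = r" using s q by (intro r(3)) (auto simp: face_right)
    qed
  qed
  have ac: "acyclic (switches (L @ M) ?T \<union> E)" using net by (simp add: net_def)
  have lift: "same_face L q r \<Longrightarrow> same_face (L @ M) q r"
    "same_face M q r \<Longrightarrow> same_face (L @ M) q r" for q r
    by (metis face_left mem, metis face_right mem)
  have "switches L T \<subseteq> switches (L @ M) ?T"
    using T disj hL by (auto simp: switches_def lift dest: mem)
  then have "acyclic (switches L T \<union> D)"
    using ac D(1) by (auto elim!: acyclic_subset)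
  then show "net L T D"
    using uL dist closed noncrossing_append net by (simp add: net_def)
  define R where "R = {(q, r) \<in> switches M T'. r \<noteq> hd M} \<union> D'"
  have "R \<subseteq> switches (L @ M) ?T \<union> E"
    using T disj hL D(2) by (auto simp: R_def switches_def lift dest: mem)
  with ac have "acyclic R" by (rule acyclic_subset)
  moreover have "hd M \<notin> Domain R"
    using T(2) D(3) by (auto simp: R_def switches_def)
  ultimately have "acyclic (R \<union> (set M - {hd M}) \<times> {hd M})"
    by (rule acyclic_add_sink) simp
  moreover have "switches M T' \<union> D' \<subseteq> R \<union> (set M - {hd M}) \<times> {hd M}"
    using mem[of L] mem[of M] T(2) by (auto simp: R_def switches_def)
  ultimately have "acyclic (switches M T' \<union> D')"
    by (rule acyclic_subset)
  then show "net M T' D'"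
    using uM dist closed noncrossing_append net by (simp add: net_def)
qed

subsection \<open>Nets over lists of expressions\<close>

(* A connective occurrence is represented by the literal that it precedes. *)
primrec tens :: "expr \<Rightarrow> literal set" where
  "tens (Lit q) = {}"
| "tens (Par X Y) = tens X \<union> tens Y"
| "tens (Tensor X Y) = insert (hd (lits Y)) (tens X \<union> tens Y)"

text \<open>The first literal of an expression is preceded by a connective from outside it, hence
  the tails.\<close>

primrec doms :: "expr \<Rightarrow> (literal \<times> literal) set" where
  "doms (Lit q) = {}"
| "doms (Par X Y) =
    doms X \<union> doms Y \<union> (set (tl (lits X)) \<union> set (tl (lits Y))) \<times> {hd (lits Y)}"
| "doms (Tensor X Y) =
    doms X \<union> doms Y \<union> (set (tl (lits X)) \<union> set (tl (lits Y))) \<times> {hd (lits Y)}"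

definition tensors :: "expr list \<Rightarrow> literal set" where
  "tensors Xs = (\<Union>X\<in>set Xs. tens X)"

definition dominations :: "expr list \<Rightarrow> (literal \<times> literal) set" where
  "dominations Xs = (\<Union>X\<in>set Xs. doms X)"

text \<open>These are the names of all connectives inside the expressions; the names of the diamonds
  are the heads.\<close>

definition tails :: "expr list \<Rightarrow> literal set" where
  "tails Xs = (\<Union>X\<in>set Xs. set (tl (lits X)))"

definition expr_net :: "expr list \<Rightarrow> bool" where
  "expr_net Xs \<longleftrightarrow> Xs \<noteq> [] \<and> net (omega_lits Xs) (tensors Xs) (dominations Xs)"

lemma lits_nonempty [simp]: "lits X \<noteq> []"
  by (induction X) auto

lemma omega_lits_simps [simp]:
  "omega_lits [] = []" "omega_lits (X # Xs) = lits X @ omega_lits Xs"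
  "omega_lits (Xs @ Ys) = omega_lits Xs @ omega_lits Ys"
  by (auto simp: omega_lits_def)

lemma omega_lits_nonempty [simp]: "omega_lits Xs = [] \<longleftrightarrow> Xs = []"
  by (cases Xs) auto

lemma hd_omega_lits: "Xs \<noteq> [] \<Longrightarrow> hd (omega_lits Xs) = hd (lits (hd Xs))"
  by (cases Xs) auto

lemma tensors_simps [simp]:
  "tensors [] = {}" "tensors (X # Xs) = tens X \<union> tensors Xs"
  "tensors (Xs @ Ys) = tensors Xs \<union> tensors Ys"
  by (auto simp: tensors_def)

lemma dominations_simps [simp]:
  "dominations [] = {}" "dominations (X # Xs) = doms X \<union> dominations Xs"
  "dominations (Xs @ Ys) = dominations Xs \<union> dominations Ys"
  by (auto simp: dominations_def)

lemma tails_simps [simp]: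
  "tails [] = {}" "tails (X # Xs) = set (tl (lits X)) \<union> tails Xs"
  "tails (Xs @ Ys) = tails Xs \<union> tails Ys"
  by (auto simp: tails_def)

lemma set_conv_hd_tl: "xs \<noteq> [] \<Longrightarrow> set xs = insert (hd xs) (set (tl xs))"
  by (cases xs) auto

lemma set_tl_subset: "set (tl xs) \<subseteq> set xs"
  by (cases xs) auto

lemma tens_subset: "tens X \<subseteq> set (tl (lits X))"
  by (induction X) (use set_tl_subset in fastforce)+

lemma Field_doms: "Field (doms X) \<subseteq> set (tl (lits X))"
proof (induction X)
  case (Par X Y)
  then show ?case
    using set_tl_subset[of "lits Y"] by (auto simp: Field_def)
next
  case (Tensor X Y)
  then show ?case
    using set_tl_subset[of "lits Y"] by (auto simp: Field_def)
qed auto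

lemma tensors_subset: "tensors Xs \<subseteq> tails Xs"
  using tens_subset by (fastforce simp: tensors_def tails_def)

lemma Field_dominations: "Field (dominations Xs) \<subseteq> tails Xs"
  using Field_doms by (fastforce simp: dominations_def tails_def Field_def)

lemma tails_subset: "tails Xs \<subseteq> set (omega_lits Xs)"
  by (induction Xs) (auto dest: list.set_sel(2)[rotated])

lemma head_notin_tails:
  "distinct (omega_lits Xs) \<Longrightarrow> X \<in> set Xs \<Longrightarrow> hd (lits X) \<notin> tails Xs"
proof (induction Xs)
  case (Cons Y Xs)
  have X: "hd (lits X) \<in> set (lits X)" by simp
  have disj: "set (lits Y) \<inter> set (omega_lits Xs) = {}" using Cons.prems by simp
  show ?case
  proof (cases "X \<in> set Xs")
    case True
    then have "hd (lits X) \<in> set (omega_lits Xs)"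
      using X by (force simp: omega_lits_def)
    then show ?thesis
      using True Cons disj set_tl_subset[of "lits Y"] by auto
  next
    case False
    then have "X = Y" using Cons.prems by simp
    moreover have "hd (lits Y) \<notin> set (tl (lits Y))"
      using Cons.prems by (cases "lits Y") auto
    ultimately show ?thesis
      unfolding tails_simps using X disj tails_subset[of Xs] by blast
  qed
qed simp

lemma expr_net_distinct: "expr_net Xs \<Longrightarrow> distinct (omega_lits Xs)"
  and expr_net_closed: "expr_net Xs \<Longrightarrow> dual_closed (set (omega_lits Xs))"
  by (auto simp: expr_net_def net_def)

lemma head_notin_tensors:
  "expr_net Xs \<Longrightarrow> X \<in> set Xs \<Longrightarrow> hd (lits X) \<notin> tensors Xs"
  using head_notin_tails tensors_subset expr_net_distinct by blast

lemma expr_net_rotate: "expr_net (Xs @ Ys) \<Longrightarrow> expr_net (Ys @ Xs)"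
  using net_rotate by (auto simp: expr_net_def Un_commute)

lemma expr_net_axiom: "expr_net [Lit q, Lit (dual q)]"
proof -
  let ?L = "[q, dual q]"
  have u: "under ?L q x \<longleftrightarrow> False" "under ?L (dual q) x \<longleftrightarrow> x = q \<or> x = dual q" for x
    by (auto simp: under_def before_Cons before_def)
  have "same_face ?L a b \<longleftrightarrow> a \<in> {q, dual q} \<and> a = b" for a b
    by (auto simp: same_face_def u)
  then have "\<forall>a\<in>set ?L. \<exists>!b. same_face ?L a b"
    by auto
  moreover have "noncrossing ?L"
    by (auto simp: noncrossing_def u)
  moreover have "dual_closed (set ?L)"
    by (auto simp: dual_closed_def)
  ultimately show ?thesis
    by (simp add: expr_net_def net_def switches_def acyclic_def)
qed

text \<open>Word and tensors stay the same; the par only adds dominance edges into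
  \<open>?s\<close>. In \<open>?Xs\<close> this is the name of a diamond, from which no edge
  departs, so the added edges close no cycle.\<close>

lemma expr_net_par:
  "expr_net (U @ [Par A B] @ V) \<longleftrightarrow> expr_net (U @ [A, B] @ V)"
proof -
  let ?Xs = "U @ [A, B] @ V" and ?s = "hd (lits B)" and ?X = "set (tl (lits A)) \<union> set (tl (lits B))"
  let ?R = "switches (omega_lits ?Xs) (tensors ?Xs)"
  have "acyclic (?R \<union> dominations ?Xs) \<longleftrightarrow> acyclic (?R \<union> (dominations ?Xs \<union> ?X \<times> {?s}))"
    if d: "distinct (omega_lits ?Xs)"
  proof
    have s: "?s \<notin> tails ?Xs"
      using head_notin_tails[OF d, of B] by simp
    then have "?s \<notin> Domain (?R \<union> dominations ?Xs)" "?s \<notin> ?X"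
      using tensors_subset[of ?Xs] Field_dominations[of ?Xs] by (auto simp: switches_def Field_def)
    then show "acyclic (?R \<union> dominations ?Xs) \<Longrightarrow> acyclic (?R \<union> (dominations ?Xs \<union> ?X \<times> {?s}))"
      using acyclic_add_sink by (metis Un_assoc)
  qed (auto elim!: acyclic_subset)
  moreover have eq: "dominations (U @ [Par A B] @ V) = dominations ?Xs \<union> ?X \<times> {?s}"
    "tensors (U @ [Par A B] @ V) = tensors ?Xs"
    "omega_lits (U @ [Par A B] @ V) = omega_lits ?Xs"
    by auto
  ultimately show ?thesis
    unfolding expr_net_def net_def eq by blast
qed

text \<open>The tensor takes the place of the diamond before \<open>B\<close> and keeps its name
  \<open>hd (lits B)\<close>; \<open>?X\<close> holds the connectives that it comes to
  dominate.\<close>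

lemma expr_net_join:
  assumes "expr_net (U @ [A])" "expr_net (B # V)"
    and disj: "set (omega_lits (U @ [A])) \<inter> set (omega_lits (B # V)) = {}"
  shows "expr_net (U @ [Tensor A B] @ V)"
proof -
  let ?L = "omega_lits (U @ [A])" and ?M = "omega_lits (B # V)"
  let ?X = "set (tl (lits A)) \<union> set (tl (lits B))"
  have hL: "hd ?L = hd (lits (hd (U @ [A])))" "hd (U @ [A]) \<in> set (U @ [A])"
    by (simp add: hd_omega_lits del: omega_lits_simps, rule hd_in_set, simp)
  have hM: "hd ?M = hd (lits B)" by simp
  have L: "hd ?L \<notin> tails (U @ [A])"
    using head_notin_tails[OF expr_net_distinct[OF assms(1)] hL(2)] hL(1) by simp
  have M: "hd ?M \<notin> tails (B # V)"
    using head_notin_tails[OF expr_net_distinct[OF assms(2)], of B] hM by simp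
  have in': "hd ?L \<in> set ?L" "hd ?M \<in> set ?M" by (rule hd_in_set, simp)+
  have "hd ?L \<notin> ?X" "hd ?M \<notin> ?X"
    using L M in' disj tails_subset[of "U @ [A]"] tails_subset[of "B # V"] by auto
  moreover have "tensors (U @ [A]) \<subseteq> set ?L - {hd ?L}" "tensors (B # V) \<subseteq> set ?M - {hd ?M}"
    "Field (dominations (U @ [A])) \<subseteq> set ?L - {hd ?L}"
    "Field (dominations (B # V)) \<subseteq> set ?M - {hd ?M}"
    using L M tensors_subset tails_subset Field_dominations by blast+
  ultimately have "net (?L @ ?M) (insert (hd ?M) (tensors (U @ [A]) \<union> tensors (B # V)))
    (dominations (U @ [A]) \<union> dominations (B # V) \<union> ?X \<times> {hd ?M})"
    using assms by (intro net_join) (auto simp: expr_net_def)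
  moreover have "insert (hd ?M) (tensors (U @ [A]) \<union> tensors (B # V)) = tensors (U @ [Tensor A B] @ V)"
    by auto
  moreover have "dominations (U @ [A]) \<union> dominations (B # V) \<union> ?X \<times> {hd ?M} =
      dominations (U @ [Tensor A B] @ V)"
    by auto
  ultimately show ?thesis
    by (simp add: expr_net_def)
qed

lemma expr_net_split:
  assumes net: "expr_net (U @ [Tensor A B] @ V)"
    and closed: "dual_closed (set (omega_lits (U @ [A])))"
  shows "expr_net (U @ [A])" "expr_net (B # V)"
proof -
  let ?L = "omega_lits (U @ [A])" and ?M = "omega_lits (B # V)"
  have d: "distinct (?L @ ?M)"
    using expr_net_distinct[OF net] by simp
  have hL: "hd ?L = hd (lits (hd (U @ [A])))" "hd (U @ [A]) \<in> set (U @ [A])"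
    by (simp add: hd_omega_lits del: omega_lits_simps, rule hd_in_set, simp)
  have hM: "hd ?M = hd (lits B)" by simp
  have L: "hd ?L \<notin> tails (U @ [A])"
    using head_notin_tails[of "U @ [A]"] hL d by auto
  have M: "hd ?M \<notin> tails (B # V)"
    using head_notin_tails[of "B # V" B] hM d by auto
  have T: "tensors (U @ [Tensor A B] @ V) = insert (hd ?M) (tensors (U @ [A]) \<union> tensors (B # V))"
    by auto
  have T': "tensors (U @ [A]) \<subseteq> set ?L - {hd ?L}" "tensors (B # V) \<subseteq> set ?M - {hd ?M}"
    using L M tensors_subset tails_subset by blast+
  have D: "hd ?M \<notin> Domain (dominations (B # V))"
    using M Field_dominations[of "B # V"] by (auto simp: Field_def)
  have n: "net (?L @ ?M) (insert (hd ?M) (tensors (U @ [A]) \<union> tensors (B # V)))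
      (dominations (U @ [Tensor A B] @ V))"
    using net T by (simp add: expr_net_def)
  have "net ?L (tensors (U @ [A])) (dominations (U @ [A]))"
       "net ?M (tensors (B # V)) (dominations (B # V))"
    by (rule net_split[OF n _ _ closed T' _ _ D]; auto)+
  then show "expr_net (U @ [A])" "expr_net (B # V)"
    by (simp_all add: expr_net_def)
qed

subsection \<open>Sequentialization\<close>

(* The successor of a literal at the end of an expression lies just after a diamond. *)
lemma expr_net_next:
  assumes net: "expr_net (U @ [X, Y] @ V)" and last: "lits X = xs @ [c]"
    and "dual c \<notin> tensors (U @ [X, Y] @ V)"
  shows "hd (lits Y) = dual c"
proof -
  have "omega_lits (U @ [X, Y] @ V) =
      (omega_lits U @ xs) @ [c, hd (lits Y)] @ (tl (lits Y) @ omega_lits V)"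
    using last by (cases "lits Y") auto
  with net have "net ((omega_lits U @ xs) @ [c, hd (lits Y)] @ (tl (lits Y) @ omega_lits V))
      (tensors (U @ [X, Y] @ V)) (dominations (U @ [X, Y] @ V))"
    by (simp only: expr_net_def)
  then show ?thesis
    by (rule net_next) (use head_notin_tensors[OF net, of Y] assms(3) in auto)
qed

text \<open>Without tensors \<open>expr_net_next\<close> applies everywhere: each literal is
  followed by its dual, and a third literal would repeat the first.\<close>

lemma expr_net_literals:
  assumes "expr_net Xs" "\<forall>X\<in>set Xs. \<exists>q. X = Lit q"
  shows "\<exists>q. Xs = [Lit q, Lit (dual q)]"
proof -
  have T: "tensors Xs = {}"
    using assms(2) by (fastforce simp: tensors_def)
  obtain X Ys where Xs: "Xs = X # Ys" using assms(1) by (cases Xs) (auto simp: expr_net_def)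
  obtain q where X: "X = Lit q" using assms(2) Xs by auto
  have "Ys \<noteq> []"
    using expr_net_closed[OF assms(1)] Xs X by (auto simp: dual_closed_def)
  then obtain Y Zs where Ys: "Ys = Y # Zs" by (cases Ys) auto
  obtain r where Y: "Y = Lit r" using assms(2) Xs Ys by auto
  have r: "r = dual q"
    using expr_net_next[of "[]" X Y Zs "[]" q] assms(1) T Xs Ys X Y by auto
  have "Zs = []"
  proof (cases Zs)
    case (Cons Z Ws)
    then have "hd (lits Z) = dual r"
      using expr_net_next[of "[X]" Y Z Ws "[]" r] assms(1) T Xs Ys X Y by auto
    then have "q \<in> set (lits Z)" using r by (metis dual_dual hd_in_set lits_nonempty)
    then show ?thesis
      using expr_net_distinct[OF assms(1)] Xs Ys X Cons by auto
  qed
  then show ?thesis using Xs Ys X Y r by auto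
qed

lemma before_split:
  "distinct (A @ B) \<Longrightarrow> B \<noteq> [] \<Longrightarrow> before (A @ B) (hd B) = set A"
  by (cases B) (auto simp: before_append before_Cons)

text \<open>From an outermost tensor go to the par or diamond in its region. If that is a par inside
  some expression, it is dominated by the central connective of this expression, which is again an
  outermost tensor. By acyclicity the walk must end, and it ends at a diamond.\<close>

lemma expr_net_splitting_tensor:
  assumes net: "expr_net Xs" and nolits: "\<exists>X\<in>set Xs. \<forall>q. X \<noteq> Lit q"
    and nopar: "\<forall>X\<in>set Xs. \<forall>A B. X \<noteq> Par A B"
  obtains A B X where "Tensor A B \<in> set Xs" "X \<in> set Xs"
    "same_face (omega_lits Xs) (hd (lits B)) (hd (lits X))"
proof (rule ccontr)
  assume neg: "\<not> thesis"
  define L where "L = omega_lits Xs"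
  define R where "R = switches L (tensors Xs) \<union> dominations Xs"
  have memL: "same_face L q r \<Longrightarrow> q \<in> set L \<and> r \<in> set L" for q r
    by (simp add: same_face_def)
  have "R \<subseteq> set L \<times> set L"
    using memL Field_dominations[of Xs] tails_subset[of Xs]
    by (fastforce simp: R_def L_def switches_def Field_def)
  then have "finite R" by (rule finite_subset) simp
  moreover have "acyclic R"
    using net by (simp add: expr_net_def net_def R_def L_def)
  ultimately have wf: "wf ((R\<inverse>)\<^sup>+)"
    using finite_acyclic_wf_converse wf_trancl by blast
  define Q where "Q = {t. \<exists>A B. Tensor A B \<in> set Xs \<and> t = hd (lits B)}"
  have "Q \<noteq> {}"
  proof -
    obtain X where "X \<in> set Xs" "\<forall>q. X \<noteq> Lit q" using nolits by blast
    moreover obtain A B where "X = Tensor A B" using calculation nopar by (metis expr.exhaust)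
    ultimately show ?thesis by (auto simp: Q_def)
  qed
  \<comment> \<open>No outermost tensor is reachable from \<open>t\<close> by a nonempty
    path.\<close>
  then obtain t where t: "t \<in> Q" "\<And>y. (y, t) \<in> (R\<inverse>)\<^sup>+ \<Longrightarrow> y \<notin> Q"
    using wfE_min[OF wf] by (metis all_not_in_conv)
  obtain A B where AB: "Tensor A B \<in> set Xs" "t = hd (lits B)" using t(1) by (auto simp: Q_def)
  have tT: "t \<in> tensors Xs" using AB by (auto simp: tensors_def intro!: bexI[of _ "Tensor A B"])
  then have "t \<in> set L" using tensors_subset tails_subset L_def by blast
  then obtain r where r: "same_face L t r" "r \<notin> tensors Xs"
    using net by (auto simp: expr_net_def net_def L_def)
  then have tr: "(t, r) \<in> R" using tT by (auto simp: R_def switches_def)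
  obtain X where X: "X \<in> set Xs" "r \<in> set (lits X)"
    using memL[OF r(1)] by (auto simp: L_def omega_lits_def)
  have "r \<noteq> hd (lits X)"
    using neg that AB X r(1) L_def by blast
  then have "r \<in> set (tl (lits X))" using X(2) by (cases "lits X") auto
  then obtain A' B' where X': "X = Tensor A' B'"
    using X(1) nopar by (cases X) auto
  have "hd (lits B') \<in> tensors Xs"
    using X X' by (auto simp: tensors_def intro!: bexI[of _ X])
  \<comment> \<open>The central occurrence is a tensor, so \<open>r\<close> lies properly inside one
    of the two components.\<close>
  then have "r \<noteq> hd (lits B')" using r(2) by auto
  then have "r \<in> set (tl (lits A')) \<union> set (tl (lits B'))"
    using \<open>r \<in> set (tl (lits X))\<close> X' by (auto simp: set_conv_hd_tl[of "lits B'"])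
  then have "(r, hd (lits B')) \<in> doms X" using X' by simp
  then have "(r, hd (lits B')) \<in> R" using X(1) by (auto simp: R_def dominations_def)
  then have "(hd (lits B'), t) \<in> (R\<inverse>)\<^sup>+" using tr by (meson converse.intros trancl.simps)
  moreover have "hd (lits B') \<in> Q" using X X' by (auto simp: Q_def)
  ultimately show False using t(2) by blast
qed

text \<open>In the last case the list is rotated until the diamond in the region of the tensor comes
  first. This region is then the unbounded one, so the word falls apart at the tensor into two
  closed words. The equation for \<open>Q @ P\<close> expresses that \<open>U\<close> and
  \<open>V\<close> are taken from the rotated list.\<close>

lemma expr_net_cases:
  assumes net: "expr_net Xs"
  obtains (literals) q where "Xs = [Lit q, Lit (dual q)]"
  | (par) U A B V where "Xs = U @ [Par A B] @ V"
  | (tensor) P A B Q U V where "Xs = P @ [Tensor A B] @ Q" "Q @ P = V @ U"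
      "expr_net (U @ [A])" "expr_net (B # V)"
proof (cases "\<exists>X\<in>set Xs. \<exists>A B. X = Par A B")
  case True
  then show ?thesis using par by (metis append_Cons append_Nil split_list)
next
  case nopar: False
  show ?thesis
  proof (cases "\<forall>X\<in>set Xs. \<exists>q. X = Lit q")
    case True
    then show ?thesis using literals expr_net_literals[OF net] by blast
  next
    case False
    then obtain A B X where T: "Tensor A B \<in> set Xs" and X: "X \<in> set Xs"
      and sf: "same_face (omega_lits Xs) (hd (lits B)) (hd (lits X))"
      using expr_net_splitting_tensor[OF net] nopar by blast
    obtain R S where RS: "Xs = R @ X # S" using X by (meson split_list)
    let ?Ys = "X # S @ R"
    have netY: "expr_net ?Ys" using expr_net_rotate[of R "X # S"] net RS by simp
    obtain U V where UV: "?Ys = U @ [Tensor A B] @ V"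
      using T RS by (metis append_Cons append_Nil split_list in_set_conv_decomp list.set_intros Un_iff set_append set_ConsD)
    let ?L = "omega_lits (U @ [A])" and ?M = "omega_lits (B # V)"
    have L: "omega_lits ?Ys = ?L @ ?M" using UV by simp
    have h: "hd (lits X) = hd (?L @ ?M)" using L by (metis hd_omega_lits list.distinct(1) list.sel(1))
    have "same_face (?L @ ?M) (hd (lits B)) (hd (lits X))"
      using sf same_face_rotate[of "omega_lits R" "omega_lits (X # S)"] L RS
        expr_net_distinct[OF net] expr_net_closed[OF net] by simp
    \<comment> \<open>The position before \<open>B\<close> lies in the unbounded region: no link
      covers it, that is, none joins \<open>?L\<close> and \<open>?M\<close>.\<close>
    then have "\<not> under (?L @ ?M) (hd ?M) x" for x
      unfolding same_face_def h by (metis under_hd hd_append2 lits_nonempty omega_lits_simps(2) Nil_is_append_conv omega_lits_nonempty not_Cons_self2)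
    moreover have "before (?L @ ?M) (hd ?M) = set ?L"
      using expr_net_distinct[OF netY] unfolding L by (intro before_split) auto
    ultimately have "dual_closed (set ?L)"
      unfolding under_def dual_closed_def by metis
    then have s: "expr_net (U @ [A])" "expr_net (B # V)"
      using expr_net_split netY UV by metis+
    have eq: "X # S @ R = U @ Tensor A B # V" "Xs = R @ X # S" using UV RS by auto
    then have "(X # S) @ R = U @ (Tensor A B # V)" by simp
    \<comment> \<open>The tensor sits before or after the point where the rotated list was
      cut.\<close>
    then consider W where "X # S = U @ W" "W @ R = Tensor A B # V"
      | W where "U = (X # S) @ W" "R = W @ Tensor A B # V"
      by (metis append_eq_append_conv2)
    then show ?thesis
    proof cases
      case 1
      show ?thesis
      proof (cases W)
        case Nil
        then show ?thesis
          using 1 eq tensor[of "[]" A B "V @ X # S" V U] s by auto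
      next
        case (Cons w W')
        then show ?thesis
          using 1 eq tensor[of "R @ U" A B W' V U] s by auto
      qed
    next
      case 2
      then show ?thesis
        using eq tensor[of W A B "V @ X # S" V U] s by auto
    qed
  qed
qed

(* val is 1 on positive and -1 on negative translations, so that expr_net_count below says that
   exactly one expression of a sequent is positive. *)
primrec val :: "expr \<Rightarrow> int" where
  "val (Lit q) = (case q of Pos _ \<Rightarrow> 1 | Neg _ \<Rightarrow> -1)"
| "val (Par X Y) = val X + val Y + 1"
| "val (Tensor X Y) = val X + val Y - 1"

lemma val_dual: "val (Lit (dual q)) = - val (Lit q)"
  by (cases q) auto

text \<open>A pair of dual literals gives 0 + 2. A par adds to the value the one that it takes from
  the length. Joining two nets at a tensor takes one from each of the two summands: 2 + 2 - 1 -
  1.\<close>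

lemma expr_net_count:
  "expr_net Xs \<Longrightarrow> sum_list (map val Xs) + int (length Xs) = 2"
proof (induction "sum_list (map size Xs)" arbitrary: Xs rule: less_induct)
  case less
  from less.prems show ?case
  proof (cases rule: expr_net_cases)
    case (literals q)
    then show ?thesis by (simp add: val_dual del: val.simps)
  next
    case (par U A B V)
    then have "expr_net (U @ [A, B] @ V)" using less.prems expr_net_par by blast
    from less.hyps[OF _ this] show ?thesis using par by simp
  next
    case (tensor P A B Q U V)
    have "sum_list (map size (Q @ P)) = sum_list (map size (V @ U))"
      using tensor(2) by simp
    then have s: "sum_list (map size P) + sum_list (map size Q) =
        sum_list (map size U) + sum_list (map size V)" by simp
    have "sum_list (map val (Q @ P)) = sum_list (map val (V @ U))" "length (Q @ P) = length (V @ U)"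
      using tensor by metis+
    moreover have "sum_list (map val (U @ [A])) + int (length (U @ [A])) = 2"
      using s tensor by (intro less.hyps) auto
    moreover have "sum_list (map val (B # V)) + int (length (B # V)) = 2"
      using s tensor by (intro less.hyps) auto
    ultimately show ?thesis using tensor(1) by simp
  qed
qed

section \<open>Links between adjacent literals\<close>

text \<open>Both ends of the link are whole expressions, so \<open>expr_net_next\<close> applies to
  both: the cyclic successor of \<open>Lit q\<close> is its dual, and a further successor would
  start with \<open>q\<close> again.\<close>

lemma expr_net_literal_piece:
  assumes net: "expr_net (U @ [Lit q])" and mem: "Lit (dual q) \<in> set U"
  shows "U = [Lit (dual q)]"
proof -
  obtain Y V where U: "U = Y # V" using mem by (cases U) auto
  have n: "expr_net ([] @ [Lit q, Y] @ V)"
    using expr_net_rotate[OF net] U by simp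
  have T: "dual q \<notin> tensors ([] @ [Lit q, Y] @ V)"
    using head_notin_tensors[OF n, of "Lit (dual q)"] mem U by auto
  have h: "hd (lits Y) = dual q"
    using expr_net_next[OF n _ T, of "[]"] by simp
  have Y: "Y = Lit (dual q)"
  proof (rule ccontr)
    assume "Y \<noteq> Lit (dual q)"
    then have "Lit (dual q) \<in> set V" using mem U by auto
    then have "dual q \<in> set (omega_lits V)" by (force simp: omega_lits_def)
    moreover have "dual q \<in> set (lits Y)" using h by (metis hd_in_set lits_nonempty)
    ultimately show False using expr_net_distinct[OF n] by auto
  qed
  have "V = []"
  proof (cases V)
    case (Cons Z W)
    have n': "expr_net ([Lit q] @ [Y, Z] @ W)" using n Cons by simp
    have "hd (lits Z) = dual (dual q)"
      by (rule expr_net_next[OF n', of "[]"])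
        (use Y head_notin_tensors[OF n', of "Lit q"] in auto)
    then have "q \<in> set (lits Z)" by (metis dual_dual hd_in_set lits_nonempty)
    then show ?thesis using expr_net_distinct[OF n'] by auto
  qed
  then show ?thesis using U Y by simp
qed

text \<open>\<open>q\<close> ends its expression and its dual follows a diamond, so the two are
  adjacent. The rest of the word is closed, and \<open>expr_net_split\<close> cuts the pair
  off.\<close>

lemma expr_net_unlink:
  assumes net: "expr_net (Tensor X (Lit q) # V)" and mem: "Lit (dual q) \<in> set V"
  obtains V' where "V = Lit (dual q) # V'" "expr_net (X # V')"
proof -
  obtain Y V' where V: "V = Y # V'" using mem by (cases V) auto
  have n: "expr_net ([] @ [Tensor X (Lit q), Y] @ V')" using net V by simp
  have T: "dual q \<notin> tensors ([] @ [Tensor X (Lit q), Y] @ V')"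
    using head_notin_tensors[OF n, of "Lit (dual q)"] mem V by auto
  have h: "hd (lits Y) = dual q"
    using expr_net_next[OF n _ T, of "lits X"] by simp
  have Y: "Y = Lit (dual q)"
  proof (rule ccontr)
    assume "Y \<noteq> Lit (dual q)"
    then have "Lit (dual q) \<in> set V'" using mem V by auto
    then have "dual q \<in> set (omega_lits V')" by (force simp: omega_lits_def)
    moreover have "dual q \<in> set (lits Y)" using h by (metis hd_in_set lits_nonempty)
    ultimately show False using expr_net_distinct[OF n] by auto
  qed
  have "expr_net (V' @ [Tensor X (Lit q)] @ [Y])"
    using expr_net_rotate[of "[Tensor X (Lit q), Y]" V'] net V by simp
  moreover have "dual_closed (set (omega_lits (V' @ [X])))"
    using expr_net_closed[OF net] expr_net_distinct[OF net] V Y unfolding dual_closed_def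
    by (auto simp: Ball_def)
  ultimately have "expr_net (V' @ [X])" by (rule expr_net_split)
  then show ?thesis
    using that V Y expr_net_rotate[of V' "[X]"] by simp
qed

subsection \<open>Formulas with labelled atoms\<close>

(* An occurrence is named by the variable whose index encodes a label together with the original
   atom: 0 for the opening bracket, 1 for the closing bracket, and i + 2 for the variable p_i. *)
definition name :: "nat \<Rightarrow> nat \<Rightarrow> atom" where
  "name l a = Prim (prod_encode (l, a))"

primrec label_atom :: "atom \<Rightarrow> nat" where
  "label_atom (Prim n) = fst (prod_decode n)"
| "label_atom Opening = 0"
| "label_atom Closing = 0"

primrec erase_atom :: "atom \<Rightarrow> atom" where
  "erase_atom (Prim n) = (case snd (prod_decode n) of
      0 \<Rightarrow> Opening | Suc a \<Rightarrow> (case a of 0 \<Rightarrow> Closing | Suc i \<Rightarrow> Prim i))"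
| "erase_atom Opening = Opening"
| "erase_atom Closing = Closing"

primrec label :: "literal \<Rightarrow> nat" where
  "label (Pos a) = label_atom a"
| "label (Neg a) = label_atom a"

primrec erase_lit :: "literal \<Rightarrow> literal" where
  "erase_lit (Pos a) = Pos (erase_atom a)"
| "erase_lit (Neg a) = Neg (erase_atom a)"

primrec erase :: "expr \<Rightarrow> expr" where
  "erase (Lit q) = Lit (erase_lit q)"
| "erase (Par X Y) = Par (erase X) (erase Y)"
| "erase (Tensor X Y) = Tensor (erase X) (erase Y)"

lemma name_simps [simp]:
  "name l a = name l' a' \<longleftrightarrow> l = l' \<and> a = a'" "label_atom (name l a) = l"
  "erase_atom (name l 0) = Opening" "erase_atom (name l (Suc 0)) = Closing"
  "erase_atom (name l (Suc (Suc i))) = Prim i"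
  by (auto simp: name_def)

text \<open>A modality has one label for both of its brackets, and so has a bracketed item. Thereby
  the dual of a bracket brings along the dual of its sister.\<close>

datatype lform =
    LVar nat nat
  | LLDiv lform lform
  | LRDiv lform lform
  | LProd lform lform
  | LDia nat lform
  | LBox nat lform

datatype litem = LFm lform | LBr nat "litem list"

primrec strip :: "lform \<Rightarrow> form" where
  "strip (LVar l i) = Var i"
| "strip (LLDiv A B) = LDiv (strip A) (strip B)"
| "strip (LRDiv B A) = RDiv (strip B) (strip A)"
| "strip (LProd A B) = Prod (strip A) (strip B)"
| "strip (LDia k A) = Dia (strip A)"
| "strip (LBox k A) = Box (strip A)"

fun strip_item :: "litem \<Rightarrow> item" where
  "strip_item (LFm A) = Fm (strip A)"
| "strip_item (LBr k G) = Br (map strip_item G)"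

fun lpos :: "lform \<Rightarrow> expr" and lneg :: "lform \<Rightarrow> expr" where
  "lpos (LVar l i) = Lit (Pos (name l (Suc (Suc i))))"
| "lpos (LLDiv A B) = Par (lneg A) (lpos B)"
| "lpos (LRDiv B A) = Par (lpos B) (lneg A)"
| "lpos (LProd A B) = Tensor (lpos A) (lpos B)"
| "lpos (LDia k A) = Tensor (Lit (Pos (name k (Suc 0)))) (Tensor (lpos A) (Lit (Pos (name k 0))))"
| "lpos (LBox k A) = Par (Par (Lit (Neg (name k (Suc 0)))) (lpos A)) (Lit (Neg (name k 0)))"
| "lneg (LVar l i) = Lit (Neg (name l (Suc (Suc i))))"
| "lneg (LLDiv A B) = Tensor (lneg B) (lpos A)"
| "lneg (LRDiv B A) = Tensor (lpos A) (lneg B)"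
| "lneg (LProd A B) = Par (lneg B) (lneg A)"
| "lneg (LDia k A) = Par (Par (Lit (Neg (name k 0))) (lneg A)) (Lit (Neg (name k (Suc 0))))"
| "lneg (LBox k A) = Tensor (Lit (Pos (name k 0))) (Tensor (lneg A) (Lit (Pos (name k (Suc 0)))))"

(* Antecedents as words, in the reversed order of the translation. *)
datatype flat = FF lform | FO nat | FC nat

fun flat_item :: "litem \<Rightarrow> flat list" and flatten :: "litem list \<Rightarrow> flat list" where
  "flat_item (LFm A) = [FF A]"
| "flat_item (LBr k G) = FO k # flatten G @ [FC k]"
| "flatten [] = []"
| "flatten (x # G) = flatten G @ flat_item x"

primrec flat_expr :: "flat \<Rightarrow> expr" where
  "flat_expr (FF A) = lneg A"
| "flat_expr (FO k) = Lit (Neg (name k 0))"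
| "flat_expr (FC k) = Lit (Neg (name k (Suc 0)))"

definition lseq :: "flat list \<Rightarrow> lform \<Rightarrow> expr list" where
  "lseq Fs C = map flat_expr Fs @ [lpos C]"

lemma flatten_append [simp]: "flatten (G @ H) = flatten H @ flatten G"
  by (induction G) auto

lemma lpos_neq_Neg [simp]: "lpos C \<noteq> Lit (Neg a)"
  by (cases C) auto

text \<open>The codes 0 and 1 are kept for brackets, so a literal entry of a flat word reveals
  whether it is a bracket or a variable.\<close>

lemma lneg_literal: "lneg A = Lit q \<Longrightarrow> \<exists>l i. q = Neg (name l (Suc (Suc i)))"
  by (cases A) auto

lemma flat_expr_literal:
  "flat_expr f = Lit (Neg (name k 0)) \<longleftrightarrow> f = FO k"
  "flat_expr f = Lit (Neg (name k (Suc 0))) \<longleftrightarrow> f = FC k"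
  by (cases f; auto dest: lneg_literal)+

lemma flat_expr_literal_rev:
  "Lit (Neg (name k 0)) = flat_expr f \<longleftrightarrow> f = FO k"
  "Lit (Neg (name k (Suc 0))) = flat_expr f \<longleftrightarrow> f = FC k"
  using flat_expr_literal by metis+

lemma expr_net_rotate_iff: "expr_net (Xs @ Ys) \<longleftrightarrow> expr_net (Ys @ Xs)"
  using expr_net_rotate by blast

section \<open>Rules that introduce a par, in both directions\<close>

lemma lseq_ProdL:
  "expr_net (lseq (U @ [FF (LProd A B)] @ W) C) \<longleftrightarrow> expr_net (lseq (U @ [FF B, FF A] @ W) C)"
  using expr_net_par[of "map flat_expr U" "lneg B" "lneg A" "map flat_expr W @ [lpos C]"]
  by (simp add: lseq_def)

lemma lseq_DiaL:
  "expr_net (lseq (U @ [FF (LDia k A)] @ W) C) \<longleftrightarrow> expr_net (lseq (U @ [FO k, FF A, FC k] @ W) C)"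
  using expr_net_par[of "map flat_expr U" "Par (Lit (Neg (name k 0))) (lneg A)"
      "Lit (Neg (name k (Suc 0)))" "map flat_expr W @ [lpos C]"]
    expr_net_par[of "map flat_expr U" "Lit (Neg (name k 0))" "lneg A"
      "Lit (Neg (name k (Suc 0))) # map flat_expr W @ [lpos C]"]
  by (simp add: lseq_def)

lemma lseq_LDivR: "expr_net (lseq Fs (LLDiv A B)) \<longleftrightarrow> expr_net (lseq (Fs @ [FF A]) B)"
  using expr_net_par[of "map flat_expr Fs" "lneg A" "lpos B" "[]"] by (simp add: lseq_def)

text \<open>\<open>lneg A\<close> ends up behind the succedent, which in a cyclic list is the
  front.\<close>

lemma lseq_RDivR: "expr_net (lseq Fs (LRDiv B A)) \<longleftrightarrow> expr_net (lseq (FF A # Fs) B)"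
  using expr_net_par[of "map flat_expr Fs" "lpos B" "lneg A" "[]"]
    expr_net_rotate_iff[of "map flat_expr Fs @ [lpos B]" "[lneg A]"] by (simp add: lseq_def)

lemma lseq_BoxR: "expr_net (lseq Fs (LBox k A)) \<longleftrightarrow> expr_net (lseq (FO k # Fs @ [FC k]) A)"
  using expr_net_par[of "map flat_expr Fs" "Par (Lit (Neg (name k (Suc 0)))) (lpos A)"
      "Lit (Neg (name k 0))" "[]"]
    expr_net_par[of "map flat_expr Fs" "Lit (Neg (name k (Suc 0)))" "lpos A" "[Lit (Neg (name k 0))]"]
    expr_net_rotate_iff[of "map flat_expr Fs @ [Lit (Neg (name k (Suc 0))), lpos A]"
      "[Lit (Neg (name k 0))]"]
  by (simp add: lseq_def)

subsection \<open>From derivations to nets\<close>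

abbreviation names :: "flat list \<Rightarrow> lform \<Rightarrow> literal set" where
  "names Fs C \<equiv> set (omega_lits (lseq Fs C))"

lemma names_simps:
  "names Fs C = (\<Union>f\<in>set Fs. set (lits (flat_expr f))) \<union> set (lits (lpos C))"
  by (auto simp: lseq_def omega_lits_def)

text \<open>One premise is rotated until \<open>lneg B\<close> comes last and the other until
  \<open>lpos A\<close> comes first; there \<open>expr_net_join\<close> glues them.\<close>

lemma lseq_LDivL:
  assumes "expr_net (lseq P A)" "expr_net (lseq (U @ [FF B] @ W) C)"
    and "names P A \<inter> names (U @ [FF B] @ W) C = {}"
  shows "expr_net (lseq (U @ [FF (LLDiv A B)] @ P @ W) C)"
proof -
  have "expr_net ((map flat_expr W @ [lpos C] @ map flat_expr U) @ [lneg B])"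
    using assms(2) expr_net_rotate[of "map flat_expr U @ [lneg B]" "map flat_expr W @ [lpos C]"]
    by (simp add: lseq_def)
  moreover have "expr_net (lpos A # map flat_expr P)"
    using assms(1) expr_net_rotate[of "map flat_expr P" "[lpos A]"] by (simp add: lseq_def)
  ultimately have "expr_net ((map flat_expr W @ [lpos C] @ map flat_expr U) @
      [Tensor (lneg B) (lpos A)] @ map flat_expr P)"
    by (rule expr_net_join) (use assms(3) in \<open>auto simp: lseq_def\<close>)
  then show ?thesis
    using expr_net_rotate[of "map flat_expr W @ [lpos C]"
        "map flat_expr U @ [Tensor (lneg B) (lpos A)] @ map flat_expr P"]
    by (simp add: lseq_def)
qed

lemma lseq_RDivL:
  assumes "expr_net (lseq P A)" "expr_net (lseq (U @ [FF B] @ W) C)"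
    and "names P A \<inter> names (U @ [FF B] @ W) C = {}"
  shows "expr_net (lseq (U @ P @ [FF (LRDiv B A)] @ W) C)"
proof -
  have "expr_net (lneg B # (map flat_expr W @ [lpos C] @ map flat_expr U))"
    using assms(2) expr_net_rotate[of "map flat_expr U" "lneg B # map flat_expr W @ [lpos C]"]
    by (simp add: lseq_def)
  moreover have "expr_net (map flat_expr P @ [lpos A])"
    using assms(1) by (simp add: lseq_def)
  ultimately have "expr_net (map flat_expr P @
      [Tensor (lpos A) (lneg B)] @ (map flat_expr W @ [lpos C] @ map flat_expr U))"
    by (intro expr_net_join) (use assms(3) in \<open>auto simp: lseq_def\<close>)
  then show ?thesis
    using expr_net_rotate[of "map flat_expr P @ [Tensor (lpos A) (lneg B)] @ map flat_expr W @ [lpos C]"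
        "map flat_expr U"]
    by (simp add: lseq_def)
qed

lemma lseq_ProdR:
  assumes "expr_net (lseq G A)" "expr_net (lseq D B)" "names G A \<inter> names D B = {}"
  shows "expr_net (lseq (D @ G) (LProd A B))"
proof -
  have "expr_net (lpos B # map flat_expr D)"
    using assms(2) expr_net_rotate[of "map flat_expr D" "[lpos B]"] by (simp add: lseq_def)
  moreover have "expr_net (map flat_expr G @ [lpos A])"
    using assms(1) by (simp add: lseq_def)
  ultimately have "expr_net (map flat_expr G @ [Tensor (lpos A) (lpos B)] @ map flat_expr D)"
    by (intro expr_net_join) (use assms(3) in \<open>auto simp: lseq_def\<close>)
  then show ?thesis
    using expr_net_rotate[of "map flat_expr G @ [Tensor (lpos A) (lpos B)]" "map flat_expr D"]
    by (simp add: lseq_def)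
qed

text \<open>Two joins with axiom links, one for each bracket. The label \<open>k\<close> must be
  fresh to keep the names of the joined nets apart.\<close>

lemma lseq_DiaR:
  assumes "expr_net (lseq P A)" and fresh: "\<forall>q\<in>names P A. label q \<noteq> k"
  shows "expr_net (lseq (FO k # P @ [FC k]) (LDia k A))"
proof -
  let ?o = "name k 0" and ?c = "name k (Suc 0)"
  have fr: "Pos (name k a) \<notin> names P A" "Neg (name k a) \<notin> names P A" for a
    using fresh by force+
  have "expr_net (map flat_expr P @ [Tensor (lpos A) (Lit (Pos ?o))] @ [Lit (Neg ?o)])"
    using assms(1) expr_net_axiom[of "Pos ?o"]
    by (intro expr_net_join) (use fr in \<open>auto simp: lseq_def\<close>)
  then have "expr_net (Tensor (lpos A) (Lit (Pos ?o)) # Lit (Neg ?o) # map flat_expr P)"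
    using expr_net_rotate[of "map flat_expr P"] by fastforce
  then have "expr_net ([Lit (Neg ?c)] @ [Tensor (Lit (Pos ?c)) (Tensor (lpos A) (Lit (Pos ?o)))] @
      (Lit (Neg ?o) # map flat_expr P))"
    using expr_net_axiom[of "Neg ?c"]
    by (intro expr_net_join) (use fr in \<open>auto simp: lseq_def\<close>)
  then show ?thesis
    using expr_net_rotate[of "[Lit (Neg ?c), Tensor (Lit (Pos ?c)) (Tensor (lpos A) (Lit (Pos ?o)))]"
      "Lit (Neg ?o) # map flat_expr P"] by (simp add: lseq_def)
qed

lemma lseq_BoxL:
  assumes "expr_net (lseq (U @ [FF A] @ W) C)" and fresh: "\<forall>q\<in>names (U @ [FF A] @ W) C. label q \<noteq> k"
  shows "expr_net (lseq (U @ [FO k, FF (LBox k A), FC k] @ W) C)"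
proof -
  let ?o = "name k 0" and ?c = "name k (Suc 0)"
  let ?R = "map flat_expr W @ [lpos C] @ map flat_expr U"
  have fr: "Pos (name k a) \<notin> names (U @ [FF A] @ W) C" "Neg (name k a) \<notin> names (U @ [FF A] @ W) C" for a
    using fresh by force+
  have "expr_net (?R @ [lneg A])"
    using assms(1) expr_net_rotate[of "map flat_expr U @ [lneg A]" "map flat_expr W @ [lpos C]"]
    by (simp add: lseq_def)
  then have "expr_net (?R @ [Tensor (lneg A) (Lit (Pos ?c))] @ [Lit (Neg ?c)])"
    using expr_net_axiom[of "Pos ?c"]
    by (intro expr_net_join) (use fr in \<open>auto simp: lseq_def\<close>)
  then have "expr_net (Tensor (lneg A) (Lit (Pos ?c)) # Lit (Neg ?c) # ?R)"
    using expr_net_rotate[of ?R] by fastforce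
  then have "expr_net ([Lit (Neg ?o)] @ [Tensor (Lit (Pos ?o)) (Tensor (lneg A) (Lit (Pos ?c)))] @
      (Lit (Neg ?c) # ?R))"
    using expr_net_axiom[of "Neg ?o"]
    by (intro expr_net_join) (use fr in \<open>auto simp: lseq_def\<close>)
  then show ?thesis
    using expr_net_rotate[of "[Lit (Neg ?o), Tensor (Lit (Pos ?o)) (Tensor (lneg A) (Lit (Pos ?c))),
        Lit (Neg ?c)] @ map flat_expr W @ [lpos C]" "map flat_expr U"]
    by (simp add: lseq_def)
qed

section \<open>Contexts and flat words\<close>

lemma map_strip_item_eq_append:
  "map strip_item G = L @ X @ R \<Longrightarrow>
    \<exists>L' X' R'. G = L' @ X' @ R' \<and> map strip_item L' = L \<and> map strip_item X' = X \<and>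
      map strip_item R' = R"
  by (auto simp: map_eq_append_conv append_eq_map_conv)

lemma strip_item_eq [simp]:
  "strip_item x = Fm A \<longleftrightarrow> (\<exists>A'. x = LFm A' \<and> strip A' = A)"
  "strip_item x = Br G \<longleftrightarrow> (\<exists>k G'. x = LBr k G' \<and> map strip_item G' = G)"
  "Fm A = strip_item x \<longleftrightarrow> (\<exists>A'. x = LFm A' \<and> strip A' = A)"
  by (cases x; auto)+

text \<open>On flat words a context acts as a fixed left and right part, between which the brackets
  around the hole are divided. The last clause allows the hole to be refilled, as a rule of the
  calculus does.\<close>

lemma strip_plug:
  assumes "map strip_item G = plug D X"
  obtains U X' W where "map strip_item X' = X" "flatten G = U @ flatten X' @ W"
    "\<forall>Y. \<exists>H. map strip_item H = plug D (map strip_item Y) \<and> flatten H = U @ flatten Y @ W"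
  using assms
proof (induction D arbitrary: G thesis)
  case (Hole L R)
  then obtain L' X' R' where G: "G = L' @ X' @ R'" "map strip_item L' = L"
    "map strip_item X' = X" "map strip_item R' = R"
    using map_strip_item_eq_append[of G L X R] by (metis plug.simps(1))
  show ?case
  proof (rule Hole.prems(1)[of X' "flatten R'" "flatten L'"])
    show "\<forall>Y. \<exists>H. map strip_item H = plug (Hole L R) (map strip_item Y) \<and>
      flatten H = flatten R' @ flatten Y @ flatten L'"
    proof
      show "\<exists>H. map strip_item H = plug (Hole L R) (map strip_item Y) \<and>
        flatten H = flatten R' @ flatten Y @ flatten L'" for Y
        using G by (intro exI[of _ "L' @ Y @ R'"]) auto
    qed
  qed (use G in auto)
next
  case (InBr L D R)
  then obtain L' B' R' where G: "G = L' @ B' @ R'" "map strip_item L' = L"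
    "map strip_item B' = [Br (plug D X)]" "map strip_item R' = R"
    using map_strip_item_eq_append[of G L "[Br (plug D X)]" R] by (metis plug.simps(2))
  then obtain k F where B': "B' = [LBr k F]" "map strip_item F = plug D X"
    by auto
  obtain U X' W where IH: "map strip_item X' = X" "flatten F = U @ flatten X' @ W"
    "\<forall>Y. \<exists>H. map strip_item H = plug D (map strip_item Y) \<and> flatten H = U @ flatten Y @ W"
    using InBr.IH[OF _ B'(2)] by blast
  show ?case
  proof (rule InBr.prems(1)[of X' "flatten R' @ FO k # U" "W @ FC k # flatten L'"])
    show "\<forall>Y. \<exists>H. map strip_item H = plug (InBr L D R) (map strip_item Y) \<and>
      flatten H = (flatten R' @ FO k # U) @ flatten Y @ W @ FC k # flatten L'"
    proof
      fix Y
      obtain H where "map strip_item H = plug D (map strip_item Y)" "flatten H = U @ flatten Y @ W"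
        using IH(3) by blast
      then show "\<exists>H. map strip_item H = plug (InBr L D R) (map strip_item Y) \<and>
        flatten H = (flatten R' @ FO k # U) @ flatten Y @ W @ FC k # flatten L'"
        using G by (intro exI[of _ "L' @ [LBr k H] @ R'"]) auto
    qed
  qed (use G B' IH in auto)
qed

definition labelled_net :: "nat \<Rightarrow> meta \<Rightarrow> form \<Rightarrow> litem list \<Rightarrow> lform \<Rightarrow> bool" where
  "labelled_net b G C G' C' \<longleftrightarrow> map strip_item G' = G \<and> strip C' = C \<and>
    expr_net (lseq (flatten G') C') \<and> (\<forall>q\<in>names (flatten G') C'. b \<le> label q)"

lemma labelled_net_bound:
  obtains m where "b \<le> m" "\<forall>q\<in>names Fs C. label q < m"
proof -
  have "finite (label ` names Fs C)" by simp
  then obtain m where "\<forall>n\<in>label ` names Fs C. n < m"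
    using finite_nat_set_iff_bounded by blast
  then show ?thesis using that[of "max b m"] by fastforce
qed

(* The bound b makes it possible to choose the labels of two premises apart. *)
lemma derivable_labelled_net: "derivable G C \<Longrightarrow> \<exists>G' C'. labelled_net b G C G' C'"
proof (induction arbitrary: b rule: derivable.induct)
  case (ax i)
  have "labelled_net b [Fm (Var i)] (Var i) [LFm (LVar b i)] (LVar b i)"
    using expr_net_axiom[of "Neg (name b (Suc (Suc i)))"] by (auto simp: labelled_net_def lseq_def)
  then show ?case by blast
next
  case (LDivL P A D B C)
  obtain P' A' where 1: "labelled_net b P A P' A'" using LDivL.IH(1) by blast
  obtain m where m: "b \<le> m" "\<forall>q\<in>names (flatten P') A'. label q < m"
    by (rule labelled_net_bound)
  obtain G' C' where 2: "labelled_net m (plug D [Fm B]) C G' C'" using LDivL.IH(2) by blast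
  then have "map strip_item G' = plug D [Fm B]" by (simp add: labelled_net_def)
  then obtain U X' W where G': "map strip_item X' = [Fm B]" "flatten G' = U @ flatten X' @ W"
    and H: "\<forall>Y. \<exists>H. map strip_item H = plug D (map strip_item Y) \<and> flatten H = U @ flatten Y @ W"
    by (rule strip_plug) (rule that; assumption)
  obtain B' where B': "X' = [LFm B']" "strip B' = B" using G'(1) by auto
  obtain H where H': "map strip_item H = plug D (map strip_item (P' @ [LFm (LLDiv A' B')]))"
      "flatten H = U @ [FF (LLDiv A' B')] @ flatten P' @ W"
    using spec[OF H, of "P' @ [LFm (LLDiv A' B')]"] by auto
  have G'': "flatten G' = U @ [FF B'] @ W" using G' B' by simp
  have "names (flatten P') A' \<inter> names (flatten G') C' = {}"
    using m 2 by (fastforce simp: labelled_net_def)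
  then have "expr_net (lseq (flatten H) C')"
    using 1 2 H' G'' lseq_LDivL by (simp add: labelled_net_def)
  moreover have "names (flatten H) C' \<subseteq> names (flatten P') A' \<union> names (flatten G') C'"
    unfolding H' G'' by (auto simp: names_simps)
  moreover have "\<forall>q\<in>names (flatten P') A' \<union> names (flatten G') C'. b \<le> label q"
    using 1 2 m(1) by (fastforce simp: labelled_net_def)
  ultimately have "labelled_net b (plug D (P @ [Fm (LDiv A B)])) C H C'"
    using 1 2 H' B' by (auto simp: labelled_net_def)
  then show ?case by blast
next
  case (LDivR A P B)
  obtain G' B' where 1: "labelled_net b (Fm A # P) B G' B'" using LDivR.IH by blast
  then obtain A' P' where G': "G' = LFm A' # P'" "strip A' = A" "map strip_item P' = P"
    by (auto simp: labelled_net_def map_eq_Cons_conv)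
  have "names (flatten P') (LLDiv A' B') = names (flatten G') B'"
    using G' by (auto simp: names_simps)
  then have "labelled_net b P (LDiv A B) P' (LLDiv A' B')"
    using 1 G' lseq_LDivR by (auto simp: labelled_net_def)
  then show ?case by blast
next
  case (RDivL P A D B C)
  obtain P' A' where 1: "labelled_net b P A P' A'" using RDivL.IH(1) by blast
  obtain m where m: "b \<le> m" "\<forall>q\<in>names (flatten P') A'. label q < m"
    by (rule labelled_net_bound)
  obtain G' C' where 2: "labelled_net m (plug D [Fm B]) C G' C'" using RDivL.IH(2) by blast
  then have "map strip_item G' = plug D [Fm B]" by (simp add: labelled_net_def)
  then obtain U X' W where G': "map strip_item X' = [Fm B]" "flatten G' = U @ flatten X' @ W"
    and H: "\<forall>Y. \<exists>H. map strip_item H = plug D (map strip_item Y) \<and> flatten H = U @ flatten Y @ W"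
    by (rule strip_plug) (rule that; assumption)
  obtain B' where B': "X' = [LFm B']" "strip B' = B" using G'(1) by auto
  obtain H where H': "map strip_item H = plug D (map strip_item (LFm (LRDiv B' A') # P'))"
      "flatten H = U @ flatten P' @ [FF (LRDiv B' A')] @ W"
    using spec[OF H, of "LFm (LRDiv B' A') # P'"] by auto
  have G'': "flatten G' = U @ [FF B'] @ W" using G' B' by simp
  have "names (flatten P') A' \<inter> names (flatten G') C' = {}"
    using m 2 by (fastforce simp: labelled_net_def)
  then have "expr_net (lseq (flatten H) C')"
    using 1 2 H' G'' lseq_RDivL by (simp add: labelled_net_def)
  moreover have "names (flatten H) C' \<subseteq> names (flatten P') A' \<union> names (flatten G') C'"
    unfolding H' G'' by (auto simp: names_simps)
  moreover have "\<forall>q\<in>names (flatten P') A' \<union> names (flatten G') C'. b \<le> label q"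
    using 1 2 m(1) by (fastforce simp: labelled_net_def)
  ultimately have "labelled_net b (plug D (Fm (RDiv B A) # P)) C H C'"
    using 1 2 H' B' by (auto simp: labelled_net_def)
  then show ?case by blast
next
  case (RDivR P A B)
  obtain G' B' where 1: "labelled_net b (P @ [Fm A]) B G' B'" using RDivR.IH by blast
  then obtain A' P' where G': "G' = P' @ [LFm A']" "strip A' = A" "map strip_item P' = P"
    by (auto simp: labelled_net_def map_eq_append_conv)
  have "names (flatten P') (LRDiv B' A') = names (flatten G') B'"
    using G' by (auto simp: names_simps)
  then have "labelled_net b P (RDiv B A) P' (LRDiv B' A')"
    using 1 G' lseq_RDivR by (auto simp: labelled_net_def)
  then show ?case by blast
next
  case (ProdL D A B C)
  obtain G' C' where 1: "labelled_net b (plug D [Fm A, Fm B]) C G' C'" using ProdL.IH by blast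
  then have "map strip_item G' = plug D [Fm A, Fm B]" by (simp add: labelled_net_def)
  then obtain U X' W where G': "map strip_item X' = [Fm A, Fm B]" "flatten G' = U @ flatten X' @ W"
    and H: "\<forall>Y. \<exists>H. map strip_item H = plug D (map strip_item Y) \<and> flatten H = U @ flatten Y @ W"
    by (rule strip_plug) (rule that; assumption)
  obtain A' B' where X': "X' = [LFm A', LFm B']" "strip A' = A" "strip B' = B"
    using G'(1) by auto
  obtain H where H': "map strip_item H = plug D [Fm (Prod A B)]"
      "flatten H = U @ [FF (LProd A' B')] @ W"
    using spec[OF H, of "[LFm (LProd A' B')]"] X' by auto
  have "names (flatten H) C' = names (flatten G') C'"
    unfolding H' G' X' by (auto simp: names_simps)
  then have "labelled_net b (plug D [Fm (Prod A B)]) C H C'"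
    using 1 H' G' X' lseq_ProdL by (auto simp: labelled_net_def)
  then show ?case by blast
next
  case (ProdR G A D B)
  obtain G' A' where 1: "labelled_net b G A G' A'" using ProdR.IH(1) by blast
  obtain m where m: "b \<le> m" "\<forall>q\<in>names (flatten G') A'. label q < m"
    by (rule labelled_net_bound)
  obtain D' B' where 2: "labelled_net m D B D' B'" using ProdR.IH(2) by blast
  have "names (flatten G') A' \<inter> names (flatten D') B' = {}"
    using m 2 by (fastforce simp: labelled_net_def)
  then have "expr_net (lseq (flatten (G' @ D')) (LProd A' B'))"
    using 1 2 lseq_ProdR by (simp add: labelled_net_def)
  moreover have "names (flatten (G' @ D')) (LProd A' B') \<subseteq> names (flatten G') A' \<union> names (flatten D') B'"
    by (auto simp: names_simps)
  moreover have "\<forall>q\<in>names (flatten G') A' \<union> names (flatten D') B'. b \<le> label q"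
    using 1 2 m(1) by (fastforce simp: labelled_net_def)
  ultimately have "labelled_net b (G @ D) (Prod A B) (G' @ D') (LProd A' B')"
    using 1 2 by (auto simp: labelled_net_def)
  then show ?case by blast
next
  case (DiaL D A C)
  obtain G' C' where 1: "labelled_net b (plug D [Br [Fm A]]) C G' C'" using DiaL.IH by blast
  then have "map strip_item G' = plug D [Br [Fm A]]" by (simp add: labelled_net_def)
  then obtain U X' W where G': "map strip_item X' = [Br [Fm A]]" "flatten G' = U @ flatten X' @ W"
    and H: "\<forall>Y. \<exists>H. map strip_item H = plug D (map strip_item Y) \<and> flatten H = U @ flatten Y @ W"
    by (rule strip_plug) (rule that; assumption)
  obtain k A' where X': "X' = [LBr k [LFm A']]" "strip A' = A"
    using G'(1) by auto
  obtain H where H': "map strip_item H = plug D [Fm (Dia A)]"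
      "flatten H = U @ [FF (LDia k A')] @ W"
    using spec[OF H, of "[LFm (LDia k A')]"] X' by auto
  have "names (flatten H) C' = names (flatten G') C'"
    unfolding H' G' X' by (auto simp: names_simps)
  then have "labelled_net b (plug D [Fm (Dia A)]) C H C'"
    using 1 H' G' X' lseq_DiaL by (auto simp: labelled_net_def)
  then show ?case by blast
next
  case (DiaR P A)
  obtain P' A' where 1: "labelled_net b P A P' A'" using DiaR.IH by blast
  obtain k where k: "b \<le> k" "\<forall>q\<in>names (flatten P') A'. label q < k"
    by (rule labelled_net_bound)
  have "expr_net (lseq (flatten [LBr k P']) (LDia k A'))"
    using lseq_DiaR[of "flatten P'" A' k] 1 k by (auto simp: labelled_net_def)
  moreover have "\<forall>q\<in>names (flatten [LBr k P']) (LDia k A'). q \<in> names (flatten P') A' \<or> label q = k"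
    by (auto simp: names_simps)
  ultimately have "labelled_net b [Br P] (Dia A) [LBr k P'] (LDia k A')"
    using 1 k(1) by (fastforce simp: labelled_net_def)
  then show ?case by blast
next
  case (BoxL D A C)
  obtain G' C' where 1: "labelled_net b (plug D [Fm A]) C G' C'" using BoxL.IH by blast
  then have "map strip_item G' = plug D [Fm A]" by (simp add: labelled_net_def)
  then obtain U X' W where G': "map strip_item X' = [Fm A]" "flatten G' = U @ flatten X' @ W"
    and H: "\<forall>Y. \<exists>H. map strip_item H = plug D (map strip_item Y) \<and> flatten H = U @ flatten Y @ W"
    by (rule strip_plug) (rule that; assumption)
  obtain A' where X': "X' = [LFm A']" "strip A' = A" using G'(1) by auto
  obtain k where k: "b \<le> k" "\<forall>q\<in>names (flatten G') C'. label q < k"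
    by (rule labelled_net_bound)
  obtain H where H': "map strip_item H = plug D [Br [Fm (Box A)]]"
      "flatten H = U @ [FO k, FF (LBox k A'), FC k] @ W"
    using spec[OF H, of "[LBr k [LFm (LBox k A')]]"] X' by auto
  have G'': "flatten G' = U @ [FF A'] @ W" using G' X' by simp
  have "expr_net (lseq (flatten H) C')"
    using lseq_BoxL[of U A' W C' k] 1 k unfolding H' G'' labelled_net_def by auto
  moreover have "\<forall>q\<in>names (flatten H) C'. q \<in> names (flatten G') C' \<or> label q = k"
    unfolding H' G'' by (auto simp: names_simps)
  ultimately have "labelled_net b (plug D [Br [Fm (Box A)]]) C H C'"
    using 1 k(1) H' by (fastforce simp: labelled_net_def)
  then show ?case by blast
next
  case (BoxR P A)
  obtain G' A' where 1: "labelled_net b [Br P] A G' A'" using BoxR.IH by blast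
  then obtain k P' where G': "G' = [LBr k P']" "map strip_item P' = P"
    by (auto simp: labelled_net_def)
  have "names (flatten P') (LBox k A') = names (flatten G') A'"
    using G' by (auto simp: names_simps)
  then have "labelled_net b P (Box A) P' (LBox k A')"
    using 1 G' lseq_BoxR by (auto simp: labelled_net_def)
  then show ?case by blast
qed

subsection \<open>From nets to derivations\<close>

text \<open>Neither order nor nesting is demanded: for factors of a flattened antecedent with
  distinct entries, proper nesting follows.\<close>

definition brackets_closed :: "flat list \<Rightarrow> bool" where
  "brackets_closed Fs \<longleftrightarrow> (\<forall>k. FO k \<in> set Fs \<longleftrightarrow> FC k \<in> set Fs)"

lemma brackets_closed_flatten:
  "brackets_closed (flat_item x)" "brackets_closed (flatten G)"
  by (induction x and G rule: flat_item_flatten.induct) (auto simp: brackets_closed_def)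

lemma brackets_closed_cancel:
  "distinct (U @ V) \<Longrightarrow> brackets_closed (U @ V) \<Longrightarrow> brackets_closed U \<longleftrightarrow> brackets_closed V"
  unfolding brackets_closed_def by (auto simp: disjoint_iff)

text \<open>A nonempty prefix of a bracketed item contains the opening bracket, and then also the
  closing one, which is the last entry.\<close>

lemma prefix_flat_item:
  assumes "flat_item x = V @ U" "distinct (flat_item x)" "brackets_closed V"
  shows "V = [] \<or> U = []"
proof (cases x)
  case (LBr k H)
  show ?thesis
  proof (rule ccontr)
    assume "\<not> ?thesis"
    then obtain V' U' where V: "V = FO k # V'" "U = U' @ [FC k]" "flatten H = V' @ U'"
      using assms(1) LBr by (cases V; cases U rule: rev_cases) auto
    then have "FC k \<in> set V'" using assms(3) by (auto simp: brackets_closed_def)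
    then show False using assms(2) V LBr by auto
  qed
qed (use assms in \<open>auto simp: Cons_eq_append_conv\<close>)

text \<open>By \<open>prefix_flat_item\<close> a closed prefix cannot end inside an item. The parts
  come in reverse order because \<open>flatten\<close> reverses.\<close>

lemma flatten_split:
  assumes "flatten G = V @ U" "distinct (flatten G)" "brackets_closed V"
  shows "\<exists>G1 G2. G = G1 @ G2 \<and> flatten G1 = U \<and> flatten G2 = V"
  using assms
proof (induction G arbitrary: U)
  case (Cons x G)
  from Cons.prems(1) consider us where "V = flatten G @ us" "flat_item x = us @ U"
    | us where "flatten G = V @ us" "U = us @ flat_item x"
    by (auto simp: append_eq_append_conv2)
  then show ?case
  proof cases
    case 1
    have "brackets_closed us"
      using brackets_closed_cancel[of "flatten G" us] brackets_closed_flatten(2)[of G]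
        Cons.prems 1 by auto
    then consider "us = []" | "U = []"
      using prefix_flat_item[OF 1(2)] Cons.prems(2) by auto
    then show ?thesis
    proof cases
      case a: 1
      then show ?thesis using 1 by (intro exI[of _ "[x]"] exI[of _ G]) auto
    next
      case 2
      then show ?thesis using 1 by (intro exI[of _ "[]"] exI[of _ "x # G"]) auto
    qed
  next
    case 2
    then obtain G1 G2 where "G = G1 @ G2" "flatten G1 = us" "flatten G2 = V"
      using Cons by auto
    then show ?thesis using 2 by (intro exI[of _ "x # G1"] exI[of _ G2]) auto
  qed
qed auto

fun cons_ctxt :: "item \<Rightarrow> ctxt \<Rightarrow> ctxt" where
  "cons_ctxt x (Hole L R) = Hole (x # L) R"
| "cons_ctxt x (InBr L D R) = InBr (x # L) D R"

lemma plug_cons_ctxt [simp]: "plug (cons_ctxt x D) X = x # plug D X"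
  by (cases D) auto

text \<open>Reads the factor \<open>V\<close> of a flat word back as the content of a hole, in the
  opposite direction to \<open>strip_plug\<close>.\<close>

definition fills :: "litem list \<Rightarrow> flat list \<Rightarrow> flat list \<Rightarrow> flat list \<Rightarrow> bool" where
  "fills G U V W \<longleftrightarrow> (\<exists>D X. flatten X = V \<and> map strip_item G = plug D (map strip_item X) \<and>
    (\<forall>Y. \<exists>H. map strip_item H = plug D (map strip_item Y) \<and> flatten H = U @ flatten Y @ W))"

lemma fills_Cons:
  assumes "fills G U V W"
  shows "fills (x # G) U V (W @ flat_item x)"
proof -
  obtain D X where D: "flatten X = V" "map strip_item G = plug D (map strip_item X)"
    "\<And>Y. \<exists>H. map strip_item H = plug D (map strip_item Y) \<and> flatten H = U @ flatten Y @ W"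
    using assms unfolding fills_def by blast
  have "\<exists>H. map strip_item H = plug (cons_ctxt (strip_item x) D) (map strip_item Y) \<and>
      flatten H = U @ flatten Y @ W @ flat_item x" for Y
  proof -
    obtain H where "map strip_item H = plug D (map strip_item Y)" "flatten H = U @ flatten Y @ W"
      using D(3) by blast
    then show ?thesis by (intro exI[of _ "x # H"]) auto
  qed
  then show ?thesis
    unfolding fills_def using D(1,2)
    by (intro exI[of _ "cons_ctxt (strip_item x) D"] exI[of _ X]) auto
qed

lemma fills_LBr:
  assumes "fills H U V W"
  shows "fills (LBr k H # G) (flatten G @ FO k # U) V (W @ [FC k])"
proof -
  obtain D X where D: "flatten X = V" "map strip_item H = plug D (map strip_item X)"
    "\<And>Y. \<exists>H. map strip_item H = plug D (map strip_item Y) \<and> flatten H = U @ flatten Y @ W"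
    using assms unfolding fills_def by blast
  have "\<exists>H. map strip_item H = plug (InBr [] D (map strip_item G)) (map strip_item Y) \<and>
      flatten H = (flatten G @ FO k # U) @ flatten Y @ W @ [FC k]" for Y
  proof -
    obtain H where "map strip_item H = plug D (map strip_item Y)" "flatten H = U @ flatten Y @ W"
      using D(3) by blast
    then show ?thesis by (intro exI[of _ "LBr k H # G"]) auto
  qed
  then show ?thesis
    unfolding fills_def using D(1,2)
    by (intro exI[of _ "InBr [] D (map strip_item G)"] exI[of _ X]) auto
qed

text \<open>If \<open>U\<close> is closed, then \<open>V\<close> consists of whole items at the top
  level. Otherwise \<open>V\<close> lies inside one item or in the rest of the list, and the
  induction descends there.\<close>

lemma flatten_infix:
  assumes "flatten G = U @ V @ W" "distinct (flatten G)" "brackets_closed V" "V \<noteq> []"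
  shows "fills G U V W"
  using assms
proof (induction "length (flatten G)" arbitrary: G U W rule: less_induct)
  case less
  show ?case
  proof (cases "brackets_closed U")
    case True
    then have "brackets_closed (U @ V)" using less.prems(3) by (auto simp: brackets_closed_def)
    then obtain G1 G2 where G: "G = G1 @ G2" "flatten G1 = W" "flatten G2 = U @ V"
      using flatten_split[of G "U @ V" W] less.prems by auto
    then obtain G3 G4 where G2: "G2 = G3 @ G4" "flatten G3 = V" "flatten G4 = U"
      using flatten_split[of G2 U V] True less.prems by auto
    have "\<exists>H. map strip_item H = plug (Hole (map strip_item G1) (map strip_item G4)) (map strip_item Y) \<and>
        flatten H = U @ flatten Y @ W" for Y
      using G G2 by (intro exI[of _ "G1 @ Y @ G4"]) auto
    then show ?thesis
      unfolding fills_def using G G2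
      by (intro exI[of _ "Hole (map strip_item G1) (map strip_item G4)"] exI[of _ G3]) auto
  next
    case nU: False
    have "G \<noteq> []" using less.prems by auto
    then obtain x G' where G: "G = x # G'" by (cases G) auto
    have d: "distinct (flatten G')" "distinct (flat_item x)" using less.prems(2) G by auto
    have ne: "flat_item x \<noteq> []" by (cases x) auto
    from less.prems(1) G consider us where "U = flatten G' @ us" "flat_item x = us @ V @ W"
      | us where "flatten G' = U @ us" "V @ W = us @ flat_item x"
      by (metis append_eq_append_conv2 flatten.simps(2))
    then show ?thesis
    proof cases
      case 1
      have nus: "\<not> brackets_closed us"
        using nU 1(1) brackets_closed_flatten(2)[of G'] by (auto simp: brackets_closed_def)
      show ?thesis
      proof (cases x)
        case (LFm A)
        then show ?thesis using 1(2) less.prems(4) nus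
          by (auto simp: Cons_eq_append_conv brackets_closed_def)
      next
        case (LBr k H)
        obtain us' where us: "us = FO k # us'"
          using 1(2) LBr nus by (cases us) (auto simp: brackets_closed_def)
        then have eq: "flatten H @ [FC k] = us' @ V @ W" using 1(2) LBr by simp
        \<comment> \<open>The final \<open>FC k\<close> does not belong to \<open>V\<close>, since
          its partner \<open>FO k\<close> is the first entry of \<open>us\<close>.\<close>
        have "W \<noteq> []"
        proof
          assume "W = []"
          then have "last V = FC k" using eq less.prems(4) by (metis append_Nil2 last_appendR last_snoc)
          then have "FC k \<in> set V" using less.prems(4) by (metis last_in_set)
          then have "FO k \<in> set V" using less.prems(3) by (auto simp: brackets_closed_def)
          then show False using d(2) 1(2) us by auto
        qed
        then obtain W' where W: "W = W' @ [FC k]" "flatten H = us' @ V @ W'"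
          using eq by (cases W rule: rev_cases) auto
        then have "fills H us' V W'"
          using less.hyps[of H us' W'] less.prems d LBr G by auto
        then show ?thesis using fills_LBr[of H us' V W' k G'] W us 1 LBr G by simp
      qed
    next
      case 2
      from 2(2) consider vs where "us = V @ vs" "W = vs @ flat_item x"
        | vs where "V = us @ vs" "flat_item x = vs @ W"
        by (auto simp: append_eq_append_conv2)
      then show ?thesis
      proof cases
        case a: 1
        then have "fills G' U V vs"
          using less.hyps[of G' U vs] less.prems d 2 G ne by auto
        then show ?thesis using fills_Cons a G by simp
      next
        \<comment> \<open>This case is impossible: as \<open>U\<close> is not closed, neither are
          \<open>us\<close> and \<open>vs\<close>, whereas the prefix \<open>vs\<close> of
          \<open>flat_item x\<close> can only be empty or the whole item.\<close>
        case b: 2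
        have "\<not> brackets_closed us"
          using nU brackets_closed_cancel[of U us] brackets_closed_flatten(2)[of G'] 2(1) d by auto
        moreover have dV: "distinct V" using less.prems by auto
        ultimately have nvs: "\<not> brackets_closed vs"
          using brackets_closed_cancel[of us vs] less.prems(3) b(1) by auto
        show ?thesis
        proof (cases x)
          case (LFm A)
          then show ?thesis using b nvs by (auto simp: Cons_eq_append_conv brackets_closed_def)
        next
          case (LBr k H)
          obtain vs' where vs: "vs = FO k # vs'" using b LBr nvs by (cases vs) (auto simp: brackets_closed_def)
          have "FC k \<in> set V" using less.prems(3) b(1) vs by (auto simp: brackets_closed_def)
          moreover have "FC k \<notin> set us"
          proof
            assume "FC k \<in> set us"
            then have "FC k \<in> set (flatten G')" using 2(1) by auto
            then show False using less.prems(2) G LBr by auto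
          qed
          ultimately have "FC k \<in> set vs" using b(1) by auto
          then have "W = []"
            using b(2) LBr vs d(2) by (cases W rule: rev_cases) auto
          then have "brackets_closed vs" using b(2) brackets_closed_flatten(1)[of x] by simp
          then show ?thesis using nvs by simp
        qed
      qed
    qed
  qed
qed

lemma fillsE:
  assumes "fills G U V W"
  obtains D X where "flatten X = V" "map strip_item G = plug D (map strip_item X)"
    "\<And>Y. \<exists>H. map strip_item H = plug D (map strip_item Y) \<and> flatten H = U @ flatten Y @ W"
  using assms unfolding fills_def by blast

lemma flat_item_nonempty [simp]: "flat_item x \<noteq> []"
  by (cases x) auto

lemma flatten_eq_Nil [simp]: "flatten G = [] \<longleftrightarrow> G = []"
  by (cases G) auto

lemma flatten_eq_FF [simp]: "flatten G = [FF A] \<longleftrightarrow> G = [LFm A]"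
proof
  assume *: "flatten G = [FF A]"
  then obtain x G' where G: "G = x # G'" by (cases G) auto
  then have "flatten G' = []" using * by (cases x; cases "flatten G'") auto
  then show "G = [LFm A]" using * G by (cases x) auto
qed auto

text \<open>By distinctness the final \<open>FC k\<close> is the partner of the initial
  \<open>FO k\<close>, so a single item spans the word.\<close>

lemma flatten_eq_bracket:
  assumes "flatten G = FO k # Fs @ [FC k]" "distinct (flatten G)"
  shows "\<exists>H. G = [LBr k H] \<and> flatten H = Fs"
proof -
  have "G \<noteq> []" using assms by auto
  then obtain G' x where G: "G = G' @ [x]" by (cases G rule: rev_cases) auto
  then have eq: "flat_item x @ flatten G' = FO k # Fs @ [FC k]" using assms(1) by simp
  then obtain H where x: "x = LBr k H" by (cases x) auto
  have "G' = []"
  proof (rule ccontr)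
    assume "G' \<noteq> []"
    then obtain Hs where "flatten G' = Hs @ [FC k]"
      using eq by (cases "flatten G'" rule: rev_cases) auto
    then show False using assms(2) G x by auto
  qed
  then show ?thesis using G x eq by auto
qed

section \<open>The pieces of a split net\<close>

lemma val_translations [simp]: "val (lpos A) = 1" "val (lneg A) = -1"
  by (induction A) auto

lemma val_flat_expr [simp]: "val (flat_expr f) = -1"
  by (cases f) auto

lemma sum_val_flat [simp]: "sum_list (map (val \<circ> flat_expr) Fs) = - int (length Fs)"
  by (induction Fs) auto

lemma twin_brackets:
  "Pos (name k 0) \<in> set (lits (lpos A)) \<longleftrightarrow> Pos (name k (Suc 0)) \<in> set (lits (lpos A))"
  "Neg (name k 0) \<in> set (lits (lpos A)) \<longleftrightarrow> Neg (name k (Suc 0)) \<in> set (lits (lpos A))"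
  "Pos (name k 0) \<in> set (lits (lneg A)) \<longleftrightarrow> Pos (name k (Suc 0)) \<in> set (lits (lneg A))"
  "Neg (name k 0) \<in> set (lits (lneg A)) \<longleftrightarrow> Neg (name k (Suc 0)) \<in> set (lits (lneg A))"
  by (induction A) auto

lemma distinct_if_distinct_lits: "distinct (omega_lits Xs) \<Longrightarrow> distinct Xs"
proof (induction Xs)
  case (Cons X Xs)
  then have "hd (lits X) \<notin> set (omega_lits Xs)"
    by (metis disjoint_iff distinct_append hd_in_set lits_nonempty omega_lits_simps(2))
  then have "X \<notin> set Xs"
    by (force simp: omega_lits_def)
  then show ?case using Cons by simp
qed simp

lemma lseq_distinct:
  assumes "expr_net (lseq Fs C)"
  shows "distinct Fs"
  using distinct_if_distinct_lits[OF expr_net_distinct[OF assms]]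
  by (simp add: lseq_def distinct_map)

lemma in_omega_lits: "q \<in> set (omega_lits Xs) \<longleftrightarrow> (\<exists>X\<in>set Xs. q \<in> set (lits X))"
  by (auto simp: omega_lits_def)

lemma occurrence_unique:
  "distinct (omega_lits Xs) \<Longrightarrow> X \<in> set Xs \<Longrightarrow> Y \<in> set Xs \<Longrightarrow> q \<in> set (lits X) \<Longrightarrow>
    q \<in> set (lits Y) \<Longrightarrow> X = Y"
  by (induction Xs) (fastforce simp: in_omega_lits disjoint_iff)+

text \<open>Positive brackets occur only inside formulas, hence with their twins, and closure under
  duals transfers this to negative ones. The twin of a bracket that is an entry of \<open>Fs\<close>
  is an entry itself, since a formula that contained it would repeat the bracket.\<close>

lemma closed_piece_brackets:
  assumes net: "expr_net (map flat_expr Fs @ [lpos A])"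
  shows "brackets_closed Fs"
proof -
  let ?Xs = "map flat_expr Fs @ [lpos A]"
  let ?L = "omega_lits ?Xs"
  have cl: "dual q \<in> set ?L \<longleftrightarrow> q \<in> set ?L" for q
    using dual_closedD[OF expr_net_closed[OF net]] .
  have pos: "Pos (name k 0) \<in> set ?L \<longleftrightarrow> Pos (name k (Suc 0)) \<in> set ?L" for k
  proof -
    have "Pos (name k 0) \<in> set (lits (flat_expr f)) \<longleftrightarrow> Pos (name k (Suc 0)) \<in> set (lits (flat_expr f))" for f
      by (cases f) (auto simp: twin_brackets)
    then show ?thesis using twin_brackets(1)[of k A] by (auto simp: in_omega_lits)
  qed
  have neg: "Neg (name k 0) \<in> set ?L \<longleftrightarrow> Neg (name k (Suc 0)) \<in> set ?L" for k
    using pos[of k] cl[of "Pos (name k 0)"] cl[of "Pos (name k (Suc 0))"] by simp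
  note uniq = occurrence_unique[OF expr_net_distinct[OF net]]
  have "FC k \<in> set Fs" if "FO k \<in> set Fs" for k
  proof -
    have o: "Lit (Neg (name k 0)) \<in> set ?Xs" using that by force
    then have "Neg (name k 0) \<in> set ?L" unfolding in_omega_lits by (rule rev_bexI) simp
    then have "Neg (name k (Suc 0)) \<in> set ?L" by (simp only: neg)
    then obtain X where X: "X \<in> set ?Xs" "Neg (name k (Suc 0)) \<in> set (lits X)"
      unfolding in_omega_lits by blast
    have "Neg (name k 0) \<notin> set (lits X)"
      using uniq[OF X(1) o, of "Neg (name k 0)"] X(2) by auto
    then obtain f where f: "f \<in> set Fs" "X = flat_expr f"
      using X twin_brackets(2)[of k A] by auto
    have "f = FC k"
      using X(2) f(2) \<open>Neg (name k 0) \<notin> set (lits X)\<close> twin_brackets(4) by (cases f) auto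
    then show ?thesis using f by simp
  qed
  moreover have "FO k \<in> set Fs" if "FC k \<in> set Fs" for k
  proof -
    have c: "Lit (Neg (name k (Suc 0))) \<in> set ?Xs" using that by force
    then have "Neg (name k (Suc 0)) \<in> set ?L" unfolding in_omega_lits by (rule rev_bexI) simp
    then have "Neg (name k 0) \<in> set ?L" by (simp only: neg)
    then obtain X where X: "X \<in> set ?Xs" "Neg (name k 0) \<in> set (lits X)"
      unfolding in_omega_lits by blast
    have "Neg (name k (Suc 0)) \<notin> set (lits X)"
      using uniq[OF X(1) c, of "Neg (name k (Suc 0))"] X(2) by auto
    then obtain f where f: "f \<in> set Fs" "X = flat_expr f"
      using X twin_brackets(2)[of k A] by auto
    have "f = FO k"
      using X(2) f(2) \<open>Neg (name k (Suc 0)) \<notin> set (lits X)\<close> twin_brackets(4) by (cases f) auto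
    then show ?thesis using f by simp
  qed
  ultimately show ?thesis by (auto simp: brackets_closed_def)
qed

text \<open>Inside a formula the dual of the bracket would come with its twin. So it is an entry by
  itself, and \<open>expr_net_literal_piece\<close> applies.\<close>

lemma lonely_opening:
  assumes "expr_net (map flat_expr F @ [Lit (Pos (name k 0))])"
    "Neg (name k (Suc 0)) \<notin> set (omega_lits (map flat_expr F))"
  shows "F = [FO k]"
proof -
  have "Neg (name k 0) \<in> set (omega_lits (map flat_expr F))"
    using dual_closedD[OF expr_net_closed[OF assms(1)], of "Pos (name k 0)"] by simp
  then obtain f where f: "f \<in> set F" "Neg (name k 0) \<in> set (lits (flat_expr f))"
    by (auto simp: in_omega_lits)
  have "Neg (name k (Suc 0)) \<notin> set (lits (flat_expr f))"
    using f(1) assms(2) by (auto simp: in_omega_lits)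
  then have "f = FO k" using f(2) twin_brackets(4) by (cases f) auto
  then have "Lit (dual (Pos (name k 0))) \<in> set (map flat_expr F)" using f(1) by force
  then show ?thesis
    using expr_net_literal_piece[OF assms(1)] by (auto simp: flat_expr_literal flat_expr_literal_rev)
qed

lemma lonely_closing:
  assumes "expr_net (map flat_expr F @ [Lit (Pos (name k (Suc 0)))])"
    "Neg (name k 0) \<notin> set (omega_lits (map flat_expr F))"
  shows "F = [FC k]"
proof -
  have "Neg (name k (Suc 0)) \<in> set (omega_lits (map flat_expr F))"
    using dual_closedD[OF expr_net_closed[OF assms(1)], of "Pos (name k (Suc 0))"] by simp
  then obtain f where f: "f \<in> set F" "Neg (name k (Suc 0)) \<in> set (lits (flat_expr f))"
    by (auto simp: in_omega_lits)
  have "Neg (name k 0) \<notin> set (lits (flat_expr f))"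
    using f(1) assms(2) by (auto simp: in_omega_lits)
  then have "f = FC k" using f(2) twin_brackets(4) by (cases f) auto
  then have "Lit (dual (Pos (name k (Suc 0)))) \<in> set (map flat_expr F)" using f(1) by force
  then show ?thesis
    using expr_net_literal_piece[OF assms(1)] by (auto simp: flat_expr_literal flat_expr_literal_rev)
qed

text \<open>A cut of the cyclic list leaves the succedent \<open>c\<close> on one side;
  \<open>expr_net_count\<close> tells on which.\<close>

lemma split_sides:
  assumes "map flat_expr F2 @ [c] @ map flat_expr F1 = V @ U"
  obtains (right) F1a F1b where "F1 = F1a @ F1b" "U = map flat_expr F1b"
      "V = map flat_expr F2 @ [c] @ map flat_expr F1a"
  | (left) F2a F2b where "F2 = F2a @ F2b" "V = map flat_expr F2a"
      "U = map flat_expr F2b @ [c] @ map flat_expr F1"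
proof -
  from assms consider us where "V = map flat_expr F2 @ us" "c # map flat_expr F1 = us @ U"
    | us where "map flat_expr F2 = V @ us" "U = us @ c # map flat_expr F1"
    by (auto simp: append_eq_append_conv2)
  then show ?thesis
  proof cases
    case 1
    show ?thesis
    proof (cases us)
      case Nil
      then show ?thesis using left[of F2 "[]"] 1 by auto
    next
      case (Cons u us')
      then obtain F1a F1b where "F1 = F1a @ F1b" "us' = map flat_expr F1a" "U = map flat_expr F1b"
        using 1(2) by (auto simp: map_eq_append_conv)
      then show ?thesis using right 1 Cons by auto
    qed
  next
    case 2
    then obtain F2a F2b where "F2 = F2a @ F2b" "V = map flat_expr F2a" "us = map flat_expr F2b"
      by (auto simp: map_eq_append_conv)
    then show ?thesis using left 2 by auto
  qed
qed

lemma split_disjoint: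
  assumes "expr_net (P @ [Tensor X Y] @ Q)" "Q @ P = V @ U"
  shows "set (omega_lits U) \<inter> set (omega_lits (Y # V)) = {}"
proof -
  have "expr_net ([Tensor X Y] @ V @ U)"
    using assms expr_net_rotate[of P "[Tensor X Y] @ Q"] by simp
  then show ?thesis using expr_net_distinct by fastforce
qed

text \<open>The outer tensor splits off the opening bracket. The dual of the closing bracket lies in
  the other piece, so \<open>lonely_opening\<close> leaves nothing but \<open>FO k\<close> in the
  first. Closedness then makes \<open>FC k\<close> an entry, and \<open>expr_net_unlink\<close>
  removes it together with its dual.\<close>

lemma box_piece:
  assumes net: "expr_net (lseq (F1 @ [FF (LBox k A)] @ F2) C)"
    and closed: "brackets_closed (F1 @ [FF (LBox k A)] @ F2)"
    and VU: "map flat_expr F2 @ [lpos C] @ map flat_expr F1 = V @ U"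
    and U: "expr_net (U @ [Lit (Pos (name k 0))])"
    and V: "expr_net (Tensor (lneg A) (Lit (Pos (name k (Suc 0)))) # V)"
  shows "\<exists>F1' F2'. F1 = F1' @ [FO k] \<and> F2 = FC k # F2' \<and> expr_net (lseq (F1' @ [FF A] @ F2') C)"
proof -
  let ?Y = "Tensor (lneg A) (Lit (Pos (name k (Suc 0))))"
  \<comment> \<open>An antecedent entry counts 0 and the succedent 2, so the succedent is not in
    \<open>U\<close>.\<close>
  have cnt: "sum_list (map val U) + int (length U) = 0"
    using expr_net_count[OF U] by simp
  from VU obtain F1a F1b where F1: "F1 = F1a @ F1b" "U = map flat_expr F1b"
      "V = map flat_expr F2 @ [lpos C] @ map flat_expr F1a"
    by (cases rule: split_sides) (use cnt in auto)
  have "Neg (name k (Suc 0)) \<in> set (omega_lits (?Y # V))"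
    using dual_closedD[OF expr_net_closed[OF V], of "Pos (name k (Suc 0))"] by simp
  moreover have "set (omega_lits U) \<inter> set (omega_lits (?Y # V)) = {}"
    using split_disjoint[of "map flat_expr F1" "Lit (Pos (name k 0))" ?Y
        "map flat_expr F2 @ [lpos C]" V U] net VU by (simp add: lseq_def)
  ultimately have F1b: "F1b = [FO k]"
    using U F1(2) by (intro lonely_opening) auto
  have "FC k \<in> set (F1a @ F2)"
    using closed F1(1) F1b by (auto simp: brackets_closed_def)
  then have "Lit (dual (Pos (name k (Suc 0)))) \<in> set V"
    using F1(3) by force
  then obtain V' where V': "V = Lit (Neg (name k (Suc 0))) # V'" "expr_net (lneg A # V')"
    using expr_net_unlink[OF V] by auto
  then obtain F2' where F2: "F2 = FC k # F2'" "V' = map flat_expr F2' @ [lpos C] @ map flat_expr F1a"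
    using F1(3) by (cases F2) (auto simp: flat_expr_literal flat_expr_literal_rev dest: sym)
  have "expr_net (lseq (F1a @ [FF A] @ F2') C)"
    using V'(2) F2(2) expr_net_rotate[of "lneg A # map flat_expr F2' @ [lpos C]" "map flat_expr F1a"]
    by (simp add: lseq_def)
  then show ?thesis using F1 F1b F2 by auto
qed

text \<open>As for the box, with the roles of the two brackets exchanged: here the outer tensor
  splits off the closing one.\<close>

lemma dia_piece:
  assumes net: "expr_net (lseq Fs (LDia k A))" and closed: "brackets_closed Fs"
    and VU: "map flat_expr Fs = V @ U"
    and U: "expr_net (U @ [Lit (Pos (name k (Suc 0)))])"
    and V: "expr_net (Tensor (lpos A) (Lit (Pos (name k 0))) # V)"
  shows "\<exists>F. Fs = FO k # F @ [FC k] \<and> expr_net (lseq F A)"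
proof -
  let ?Y = "Tensor (lpos A) (Lit (Pos (name k 0)))"
  from VU obtain Fa Fb where F: "Fs = Fa @ Fb" "V = map flat_expr Fa" "U = map flat_expr Fb"
    by (auto simp: map_eq_append_conv)
  have "Neg (name k 0) \<in> set (omega_lits (?Y # V))"
    using dual_closedD[OF expr_net_closed[OF V], of "Pos (name k 0)"] by simp
  moreover have "set (omega_lits U) \<inter> set (omega_lits (?Y # V)) = {}"
    using split_disjoint[of "map flat_expr Fs" "Lit (Pos (name k (Suc 0)))" ?Y "[]" V U] net VU
    by (simp add: lseq_def)
  ultimately have Fb: "Fb = [FC k]"
    using U F(3) by (intro lonely_closing) auto
  have "FO k \<in> set Fa"
    using closed F(1) Fb by (auto simp: brackets_closed_def)
  then have "Lit (dual (Pos (name k 0))) \<in> set V"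
    using F(2) by force
  then obtain V' where V': "V = Lit (Neg (name k 0)) # V'" "expr_net (lpos A # V')"
    using expr_net_unlink[OF V] by auto
  then obtain F' where F': "Fa = FO k # F'" "V' = map flat_expr F'"
    using F(2) by (cases Fa) (auto simp: flat_expr_literal flat_expr_literal_rev)
  have "expr_net (lseq F' A)"
    using V'(2) F'(2) expr_net_rotate[of "[lpos A]" "map flat_expr F'"] by (simp add: lseq_def)
  then show ?thesis using F Fb F' by auto
qed

text \<open>Brackets weigh nothing, so that replacing a modality by its brackets lowers the measure
  of \<open>net_derivable\<close>.\<close>

primrec weight :: "flat \<Rightarrow> nat" where
  "weight (FF A) = size A"
| "weight (FO k) = 0"
| "weight (FC k) = 0"

lemma net_derivable:
  "expr_net (lseq (flatten G) C) \<Longrightarrow> derivable (map strip_item G) (strip C)"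
proof (induction "sum_list (map weight (flatten G)) + size C" arbitrary: G C rule: less_induct)
  case less
  note net = less.prems
  have dist: "distinct (flatten G)" using lseq_distinct[OF net] .
  have closed: "brackets_closed (flatten G)" by (rule brackets_closed_flatten)
  \<comment> \<open>Turns a closed factor of the antecedent into the content of a hole; all left
    rules are applied in this way.\<close>
  note fill = fillsE[OF flatten_infix[OF _ dist]]
  have single: "brackets_closed [FF A]" for A by (simp add: brackets_closed_def)
  show ?case
  proof (cases "\<exists>A B. FF (LProd A B) \<in> set (flatten G)")
    case True
    then obtain A B U W where G: "flatten G = U @ [FF (LProd A B)] @ W"
      by (metis append_Cons append_Nil split_list)
    obtain D X where X: "flatten X = [FF (LProd A B)]" "map strip_item G = plug D (map strip_item X)"
      and H: "\<And>Y. \<exists>H. map strip_item H = plug D (map strip_item Y) \<and> flatten H = U @ flatten Y @ W"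
      by (rule fill[OF G single]) auto
    obtain H where H': "map strip_item H = plug D [Fm (strip A), Fm (strip B)]"
        "flatten H = U @ [FF B, FF A] @ W"
      using H[of "[LFm A, LFm B]"] by auto
    have "derivable (map strip_item H) (strip C)"
      using net lseq_ProdL G H' by (intro less.hyps) auto
    then show ?thesis using X H' by (auto intro: derivable.ProdL)
  next
    case noprod: False
    show ?thesis
    proof (cases "\<exists>k A. FF (LDia k A) \<in> set (flatten G)")
      case True
      then obtain k A U W where G: "flatten G = U @ [FF (LDia k A)] @ W"
        by (metis append_Cons append_Nil split_list)
      obtain D X where X: "flatten X = [FF (LDia k A)]" "map strip_item G = plug D (map strip_item X)"
        and H: "\<And>Y. \<exists>H. map strip_item H = plug D (map strip_item Y) \<and> flatten H = U @ flatten Y @ W"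
        by (rule fill[OF G single]) auto
      obtain H where H': "map strip_item H = plug D [Br [Fm (strip A)]]"
          "flatten H = U @ [FO k, FF A, FC k] @ W"
        using H[of "[LBr k [LFm A]]"] by auto
      have "derivable (map strip_item H) (strip C)"
        using net lseq_DiaL G H' by (intro less.hyps) auto
      then show ?thesis using X H' by (auto intro: derivable.DiaL)
    next
      case nodia: False
      consider (ldiv) A B where "C = LLDiv A B" | (rdiv) A B where "C = LRDiv B A"
        | (box) k A where "C = LBox k A"
        | (other) "\<And>A B. C \<noteq> LLDiv A B" "\<And>A B. C \<noteq> LRDiv B A" "\<And>k A. C \<noteq> LBox k A"
        by blast
      then show ?thesis
      proof cases
        case ldiv
        have "derivable (map strip_item (LFm A # G)) (strip B)"
          using net lseq_LDivR ldiv by (intro less.hyps) auto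
        then show ?thesis using ldiv by (auto intro: derivable.LDivR)
      next
        case rdiv
        have "derivable (map strip_item (G @ [LFm A])) (strip B)"
          using net lseq_RDivR rdiv by (intro less.hyps) auto
        then show ?thesis using rdiv by (auto intro: derivable.RDivR)
      next
        case box
        have "derivable (map strip_item [LBr k G]) (strip A)"
          using net lseq_BoxR box by (intro less.hyps) auto
        then show ?thesis using box by (auto intro: derivable.BoxR)
      next
        \<comment> \<open>No outermost par is left, as products and diamonds are gone from the
          antecedent, divisions and boxes from the succedent.\<close>
        case other
        from net show ?thesis
        proof (cases rule: expr_net_cases)
          case (literals q)
          then obtain f where f: "flatten G = [f]" "flat_expr f = Lit q" "lpos C = Lit (dual q)"
            by (auto simp: lseq_def map_eq_Cons_conv append_eq_Cons_conv)
          obtain l i where C: "C = LVar l i" using f(3) by (cases C) auto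
          then have q: "q = Neg (name l (Suc (Suc i)))" using f(3) by (cases q) auto
          obtain A where A: "f = FF A" using f(2) q by (cases f) auto
          then have "A = LVar l i" using f(2) q by (cases A) auto
          then have "G = [LFm (LVar l i)]" using f(1) A by simp
          then show ?thesis using C by (simp add: derivable.ax)
        next
          case (par U A B V)
          then have "Par A B \<in> set (lseq (flatten G) C)" by simp
          then consider "Par A B = lpos C" | f where "f \<in> set (flatten G)" "Par A B = flat_expr f"
            by (auto simp: lseq_def)
          then show ?thesis
          proof cases
            case 1
            then show ?thesis using other by (cases C) auto
          next
            case 2
            obtain F where F: "f = FF F" using 2(2) by (cases f) auto
            then show ?thesis using noprod nodia 2 by (cases F) auto
          qed
        next
          case (tensor P X Y Q U V)
          show ?thesis
          proof (cases Q rule: rev_cases)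
            \<comment> \<open>The tensor is the succedent.\<close>
            case Nil
            then have CT: "lpos C = Tensor X Y" and P: "map flat_expr (flatten G) = P"
              using tensor(1) by (auto simp: lseq_def)
            then have VU: "map flat_expr (flatten G) = V @ U" using tensor(2) Nil by simp
            from CT consider (prod) A B where "C = LProd A B" "X = lpos A" "Y = lpos B"
              | (dia) k A where "C = LDia k A" "X = Lit (Pos (name k (Suc 0)))"
                "Y = Tensor (lpos A) (Lit (Pos (name k 0)))"
              by (cases C) auto
            then show ?thesis
            proof cases
              case prod
              obtain Fa Fb where F: "flatten G = Fa @ Fb" "V = map flat_expr Fa" "U = map flat_expr Fb"
                using VU by (auto simp: map_eq_append_conv)
              have n1: "expr_net (lseq Fb A)" using tensor(3) prod F by (simp add: lseq_def)
              have n2: "expr_net (lseq Fa B)"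
                using tensor(4) prod F expr_net_rotate[of "[lpos B]" "map flat_expr Fa"]
                by (simp add: lseq_def)
              \<comment> \<open>A piece that is a sequent has closed brackets, so the cut falls
                between items.\<close>
              have "brackets_closed Fa"
                using n2 by (intro closed_piece_brackets) (simp add: lseq_def)
              then obtain G1 G2 where G: "G = G1 @ G2" "flatten G1 = Fb" "flatten G2 = Fa"
                using flatten_split[OF F(1) dist] by blast
              have "derivable (map strip_item G1) (strip A)" "derivable (map strip_item G2) (strip B)"
                using n1 n2 F(1) G prod by (auto intro!: less.hyps)
              then show ?thesis using G prod by (auto intro: derivable.ProdR)
            next
              case dia
              obtain F where F: "flatten G = FO k # F @ [FC k]" "expr_net (lseq F A)"
                using dia_piece[of "flatten G" k A V U] net closed VU tensor(3,4) dia by auto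
              then obtain H where H: "G = [LBr k H]" "flatten H = F"
                using flatten_eq_bracket dist by blast
              have "derivable (map strip_item H) (strip A)"
                using F H dia by (intro less.hyps) auto
              then show ?thesis using H dia by (auto intro: derivable.DiaR)
            qed
          next
            \<comment> \<open>The tensor is an antecedent formula.\<close>
            case (snoc Q' c)
            then have eq: "map flat_expr (flatten G) = P @ Tensor X Y # Q'" "c = lpos C"
              using tensor(1) by (auto simp: lseq_def)
            then obtain F1 f F2 where F: "flatten G = F1 @ [f] @ F2" "P = map flat_expr F1"
              "flat_expr f = Tensor X Y" "Q' = map flat_expr F2"
              by (auto simp: map_eq_append_conv map_eq_Cons_conv)
            then have VU: "map flat_expr F2 @ [lpos C] @ map flat_expr F1 = V @ U"
              using tensor(2) snoc eq by simp
            obtain T where T: "f = FF T" using F(3) by (cases f) auto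
            with F(3) consider (ldiv) A B where "T = LLDiv A B" "X = lneg B" "Y = lpos A"
              | (rdiv) A B where "T = LRDiv B A" "X = lpos A" "Y = lneg B"
              | (box) k A where "T = LBox k A" "X = Lit (Pos (name k 0))"
                "Y = Tensor (lneg A) (Lit (Pos (name k (Suc 0))))"
              by (cases T) auto
            then show ?thesis
            proof cases
              case ldiv
              \<comment> \<open>\<open>lpos A\<close> is the one positive expression of its piece,
                so the succedent is in \<open>U\<close>.\<close>
              have "sum_list (map val V) + int (length V) = 0"
                using expr_net_count[OF tensor(4)] ldiv by simp
              with VU obtain Fa Fb where F2: "F2 = Fa @ Fb" "V = map flat_expr Fa"
                "U = map flat_expr Fb @ [lpos C] @ map flat_expr F1"
                by (cases rule: split_sides) auto
              have n1: "expr_net (lseq Fa A)"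
                using tensor(4) ldiv F2 expr_net_rotate[of "[lpos A]" "map flat_expr Fa"]
                by (simp add: lseq_def)
              have n2: "expr_net (lseq (F1 @ [FF B] @ Fb) C)"
                using tensor(3) ldiv F2
                  expr_net_rotate[of "map flat_expr Fb @ [lpos C]" "map flat_expr F1 @ [lneg B]"]
                by (simp add: lseq_def)
              have "brackets_closed Fa"
                using n1 by (intro closed_piece_brackets) (simp add: lseq_def)
              \<comment> \<open>The principal formula together with \<open>Fa\<close> is the factor
                that the rule replaces.\<close>
              then have cl: "brackets_closed (FF T # Fa)" by (simp add: brackets_closed_def)
              have G: "flatten G = F1 @ (FF T # Fa) @ Fb" using F T F2 by simp
              obtain D Z where Z: "flatten Z = FF T # Fa" "map strip_item G = plug D (map strip_item Z)"
                and H: "\<And>Y. \<exists>H. map strip_item H = plug D (map strip_item Y) \<and> flatten H = F1 @ flatten Y @ Fb"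
                by (rule fill[OF G cl]) auto
              have "flatten Z = [FF T] @ Fa" "distinct (flatten Z)" using Z dist G by auto
              then obtain P' Z' where Z': "Z = P' @ Z'" "flatten P' = Fa" "flatten Z' = [FF T]"
                using flatten_split[of Z "[FF T]" Fa] single by blast
              obtain H where H': "map strip_item H = plug D [Fm (strip B)]" "flatten H = F1 @ [FF B] @ Fb"
                using H[of "[LFm B]"] by auto
              have "derivable (map strip_item P') (strip A)"
                using n1 Z'(2) G ldiv by (intro less.hyps) auto
              moreover have "derivable (map strip_item H) (strip C)"
                using n2 H'(2) G ldiv by (intro less.hyps) auto
              ultimately show ?thesis
                using Z Z' H' ldiv by (auto intro: derivable.LDivL)
            next
              case rdiv
              have "sum_list (map val U) + int (length U) = 0"
                using expr_net_count[OF tensor(3)] rdiv by simp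
              with VU obtain Fa Fb where F1: "F1 = Fa @ Fb" "U = map flat_expr Fb"
                "V = map flat_expr F2 @ [lpos C] @ map flat_expr Fa"
                by (cases rule: split_sides) auto
              have n1: "expr_net (lseq Fb A)"
                using tensor(3) rdiv F1 by (simp add: lseq_def)
              have n2: "expr_net (lseq (Fa @ [FF B] @ F2) C)"
                using tensor(4) rdiv F1
                  expr_net_rotate[of "lneg B # map flat_expr F2 @ [lpos C]" "map flat_expr Fa"]
                by (simp add: lseq_def)
              have Fb: "brackets_closed Fb"
                using n1 by (intro closed_piece_brackets) (simp add: lseq_def)
              then have cl: "brackets_closed (Fb @ [FF T])" by (simp add: brackets_closed_def)
              have G: "flatten G = Fa @ (Fb @ [FF T]) @ F2" using F T F1 by simp
              obtain D Z where Z: "flatten Z = Fb @ [FF T]" "map strip_item G = plug D (map strip_item Z)"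
                and H: "\<And>Y. \<exists>H. map strip_item H = plug D (map strip_item Y) \<and> flatten H = Fa @ flatten Y @ F2"
                by (rule fill[OF G cl]) auto
              have "distinct (flatten Z)" using Z dist G by auto
              then obtain Z' P' where Z': "Z = Z' @ P'" "flatten P' = Fb" "flatten Z' = [FF T]"
                using flatten_split[of Z Fb "[FF T]"] Fb Z(1) by blast
              obtain H where H': "map strip_item H = plug D [Fm (strip B)]" "flatten H = Fa @ [FF B] @ F2"
                using H[of "[LFm B]"] by auto
              have "derivable (map strip_item P') (strip A)"
                using n1 Z'(2) G rdiv by (intro less.hyps) auto
              moreover have "derivable (map strip_item H) (strip C)"
                using n2 H'(2) G rdiv by (intro less.hyps) auto
              ultimately show ?thesis
                using Z Z' H' rdiv by (auto intro: derivable.RDivL)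
            next
              case box
              then obtain F1' F2' where F': "F1 = F1' @ [FO k]" "F2 = FC k # F2'"
                "expr_net (lseq (F1' @ [FF A] @ F2') C)"
                using box_piece[of F1 k A F2 C V U] net closed VU tensor(3,4) F T by auto
              have G: "flatten G = F1' @ [FO k, FF (LBox k A), FC k] @ F2'" using F F' T box by simp
              have cl: "brackets_closed [FO k, FF (LBox k A), FC k]" by (auto simp: brackets_closed_def)
              obtain D Z where Z: "flatten Z = [FO k, FF (LBox k A), FC k]"
                  "map strip_item G = plug D (map strip_item Z)"
                and H: "\<And>Y. \<exists>H. map strip_item H = plug D (map strip_item Y) \<and> flatten H = F1' @ flatten Y @ F2'"
                by (rule fill[OF G cl]) auto
              obtain Z' where Z': "Z = [LBr k Z']" "flatten Z' = [FF (LBox k A)]"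
                using flatten_eq_bracket[of Z k "[FF (LBox k A)]"] Z(1) by auto
              obtain H where H': "map strip_item H = plug D [Fm (strip A)]" "flatten H = F1' @ [FF A] @ F2'"
                using H[of "[LFm A]"] by auto
              have "derivable (map strip_item H) (strip C)"
                using F' H' G by (intro less.hyps) auto
              then show ?thesis using Z Z' H' by (auto intro: derivable.BoxL)
            qed
          qed
        qed
      qed
    qed
  qed
qed

subsection \<open>Indices and names\<close>

text \<open>The proof structure that is read off the names.\<close>

definition links :: "literal list \<Rightarrow> (nat \<times> nat) set" where
  "links L = {(i, j). i < length L \<and> j < length L \<and> L ! j = dual (L ! i)}"

text \<open>Ties a subexpression to its range of indices, so that inductions over expressions can
  keep the whole word \<open>L\<close> fixed.\<close>

primrec occurs_at :: "literal list \<Rightarrow> nat \<Rightarrow> literal list \<Rightarrow> bool" where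
  "occurs_at L k [] \<longleftrightarrow> True"
| "occurs_at L k (q # w) \<longleftrightarrow> k < length L \<and> L ! k = q \<and> occurs_at L (Suc k) w"

lemma occurs_at_append [simp]:
  "occurs_at L k (v @ w) \<longleftrightarrow> occurs_at L k v \<and> occurs_at L (k + length v) w"
  by (induction v arbitrary: k) auto

lemma occurs_at_Cons: "occurs_at (q # L) (Suc k) w \<longleftrightarrow> occurs_at L k w"
  by (induction w arbitrary: k) auto

lemma occurs_at_self: "occurs_at L 0 L"
  by (induction L) (auto simp: occurs_at_Cons)

lemma occurs_at_nth_image: "occurs_at L k w \<Longrightarrow> (!) L ` {k..<k + length w} = set w"
proof (induction w arbitrary: k)
  case (Cons q w)
  have "{k..<k + length (q # w)} = insert k {Suc k..<Suc k + length w}" by auto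
  then show ?case using Cons.IH[of "Suc k"] Cons.prems by simp
qed simp

lemma occurs_at_nth_image_tl:
  assumes "occurs_at L k w" "w \<noteq> []"
  shows "(!) L ` {k<..<k + length w} = set (tl w)"
proof -
  obtain q v where w: "w = q # v" using assms(2) by (cases w) auto
  have "{k<..<k + length w} = {Suc k..<Suc k + length v}" using w by auto
  then show ?thesis using occurs_at_nth_image[of L "Suc k" v] assms(1) w by simp
qed

lemma length_conns: "width X = Suc (length (conns X))"
  by (induction X) auto

lemma length_omega_conns [simp]: "length (omega_conns Xs) = length (omega_lits Xs)"
  by (induction Xs) (auto simp: omega_conns_def length_conns)

lemma tens_subset_lits: "tens X \<subseteq> set (lits X)"
  using tens_subset[of X] set_tl_subset[of "lits X"] by blast

text \<open>An expression has one literal more than connectives; prepending the connective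
  \<open>c\<close> that stands before it aligns the two lists.\<close>

lemma conns_tens:
  "distinct (lits X) \<Longrightarrow> i < width X \<Longrightarrow>
    (c # conns X) ! i = CTensor \<longleftrightarrow> (if i = 0 then c = CTensor else lits X ! i \<in> tens X)"
proof (induction X arbitrary: c i)
  case (Par X Y)
  have hd: "lits Y ! 0 = hd (lits Y)" by (rule hd_conv_nth[symmetric]) simp
  have nin: "hd (lits Y) \<notin> tens X" "hd (lits Y) \<notin> tens Y"
    using head_notin_tails[of "[X, Y]" Y] Par.prems(1) tens_subset[of X] tens_subset[of Y] by auto
  have sub: "tens X \<subseteq> set (lits X)" "tens Y \<subseteq> set (lits Y)"
    by (rule tens_subset_lits)+
  \<comment> \<open>The central connective plays the part of \<open>c\<close> for
    \<open>Y\<close>.\<close>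
  have eq: "c # conns (Par X Y) = (c # conns X) @ (CPar # conns Y)" by simp
  show ?case
  proof (cases "i < width X")
    case True
    then have "(c # conns (Par X Y)) ! i = (c # conns X) ! i"
      unfolding eq by (simp add: nth_append length_conns del: append_Cons)
    moreover have "lits X ! i \<in> set (lits X)" using True by simp
    then have "lits X ! i \<notin> tens Y" using sub Par.prems(1) by auto
    ultimately show ?thesis
      using Par.IH(1)[of i c] Par.prems True by (simp add: nth_append)
  next
    case False
    then obtain j where j: "i = width X + j" by (metis add_diff_inverse_nat)
    then have jw: "j < width Y" using Par.prems by simp
    have "(c # conns (Par X Y)) ! i = (CPar # conns Y) ! j"
      unfolding eq j by (simp add: nth_append length_conns del: append_Cons)
    moreover have "lits Y ! j \<in> set (lits Y)" using jw by simp
    then have "lits Y ! j \<notin> tens X" using sub Par.prems(1) by auto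
    ultimately show ?thesis
      using Par.IH(2)[of j CPar] Par.prems(1) jw j hd nin by (auto simp: nth_append length_conns)
  qed
next
  case (Tensor X Y)
  have hd: "lits Y ! 0 = hd (lits Y)" by (rule hd_conv_nth[symmetric]) simp
  have sub: "tens X \<subseteq> set (lits X)" "tens Y \<subseteq> set (lits Y)"
    by (rule tens_subset_lits)+
  have eq: "c # conns (Tensor X Y) = (c # conns X) @ (CTensor # conns Y)" by simp
  have hdY: "hd (lits Y) \<in> set (lits Y)" by (rule hd_in_set) simp
  show ?case
  proof (cases "i < width X")
    case True
    then have "(c # conns (Tensor X Y)) ! i = (c # conns X) ! i"
      unfolding eq by (simp add: nth_append length_conns del: append_Cons)
    moreover have "lits X ! i \<in> set (lits X)" using True by simp
    then have "lits X ! i \<notin> tens Y" "lits X ! i \<noteq> hd (lits Y)"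
      using sub Tensor.prems(1) hdY by (auto simp del: hd_in_set)
    ultimately show ?thesis
      using Tensor.IH(1)[of i c] Tensor.prems True by (simp add: nth_append)
  next
    case False
    then obtain j where j: "i = width X + j" by (metis add_diff_inverse_nat)
    then have jw: "j < width Y" using Tensor.prems by simp
    have "(c # conns (Tensor X Y)) ! i = (CTensor # conns Y) ! j"
      unfolding eq j by (simp add: nth_append length_conns del: append_Cons)
    moreover have "lits Y ! j \<in> set (lits Y)" using jw by simp
    then have "lits Y ! j \<notin> tens X" using sub Tensor.prems(1) by auto
    moreover have "lits Y ! j = hd (lits Y) \<longleftrightarrow> j = 0"
      using Tensor.prems(1) jw hd nth_eq_iff_index_eq[of "lits Y" j 0] by auto
    ultimately show ?thesis
      using Tensor.IH(2)[of j CTensor] Tensor.prems(1) jw j by (auto simp: nth_append length_conns)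
  qed
qed simp

lemma omega_conns_tensors:
  "distinct (omega_lits Xs) \<Longrightarrow> i < length (omega_lits Xs) \<Longrightarrow>
    omega_conns Xs ! i = CTensor \<longleftrightarrow> omega_lits Xs ! i \<in> tensors Xs"
proof (induction Xs arbitrary: i)
  case (Cons X Xs)
  have eq: "omega_conns (X # Xs) = (CDiamond # conns X) @ omega_conns Xs"
    by (simp add: omega_conns_def)
  have sub: "tens X \<subseteq> set (lits X)" "tensors Xs \<subseteq> set (omega_lits Xs)"
    using tens_subset_lits tensors_subset[of Xs] tails_subset[of Xs] by auto
  show ?case
  proof (cases "i < width X")
    case True
    then have "omega_conns (X # Xs) ! i = (CDiamond # conns X) ! i"
      unfolding eq by (simp add: nth_append length_conns del: append_Cons)
    moreover have "lits X ! i \<in> set (lits X)" using True by simp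
    then have "lits X ! i \<notin> tensors Xs" using sub Cons.prems(1) by auto
    moreover have "hd (lits X) \<notin> tens X"
      using head_notin_tails[of "[X]" X] Cons.prems(1) tens_subset[of X] by auto
    ultimately show ?thesis
      using conns_tens[of X i CDiamond] Cons.prems True by (auto simp: nth_append hd_conv_nth)
  next
    case False
    then obtain j where j: "i = width X + j" by (metis add_diff_inverse_nat)
    then have jw: "j < length (omega_lits Xs)" using Cons.prems by simp
    have "omega_conns (X # Xs) ! i = omega_conns Xs ! j"
      unfolding eq j by (simp add: nth_append length_conns del: append_Cons)
    moreover have "omega_lits Xs ! j \<in> set (omega_lits Xs)" using jw by simp
    then have "omega_lits Xs ! j \<notin> tens X" using sub Cons.prems(1) by auto
    ultimately show ?thesis
      using Cons.IH[of j] Cons.prems(1) jw j by (auto simp: nth_append)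
  qed
qed simp

lemma map_prod_image_Times: "map_prod f g ` (A \<times> B) = f ` A \<times> g ` B"
  by (auto simp: image_iff map_prod_def)

lemma expr_dominance_doms:
  "occurs_at L k (lits X) \<Longrightarrow> map_prod ((!) L) ((!) L) ` expr_dominance k X = doms X"
proof (induction X arbitrary: k)
  case (Par X Y)
  have "L ! (k + width X) = hd (lits Y)"
    using Par.prems by (cases "lits Y") auto
  moreover have "(!) L ` {k <..< k + width X} = set (tl (lits X))"
    "(!) L ` {k + width X <..< k + width X + width Y} = set (tl (lits Y))"
    using Par.prems by (auto intro!: occurs_at_nth_image_tl)
  ultimately show ?case
    using Par by (simp add: image_Un map_prod_image_Times)
next
  case (Tensor X Y)
  have "L ! (k + width X) = hd (lits Y)"
    using Tensor.prems by (cases "lits Y") auto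
  moreover have "(!) L ` {k <..< k + width X} = set (tl (lits X))"
    "(!) L ` {k + width X <..< k + width X + width Y} = set (tl (lits Y))"
    using Tensor.prems by (auto intro!: occurs_at_nth_image_tl)
  ultimately show ?case
    using Tensor by (simp add: image_Un map_prod_image_Times)
qed simp

lemma dominance_from_dominations:
  "occurs_at L k (omega_lits Xs) \<Longrightarrow>
    map_prod ((!) L) ((!) L) ` dominance_from k Xs = dominations Xs"
  by (induction Xs arbitrary: k) (simp_all add: image_Un expr_dominance_doms)

lemma expr_dominance_bounded:
  "(a, b) \<in> expr_dominance k X \<Longrightarrow> a < k + width X \<and> b < k + width X \<and> k < a \<and> k < b"
proof (induction X arbitrary: k)
  case (Par X Y)
  then show ?case using length_conns[of X] length_conns[of Y] by (auto dest!: Par.IH)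
next
  case (Tensor X Y)
  then show ?case using length_conns[of X] length_conns[of Y] by (auto dest!: Tensor.IH)
qed simp

lemma dominance_from_bounded:
  "(a, b) \<in> dominance_from k Xs \<Longrightarrow>
    a < k + length (omega_lits Xs) \<and> b < k + length (omega_lits Xs)"
proof (induction Xs arbitrary: k)
  case (Cons X Xs)
  then show ?case by (auto dest!: Cons.IH expr_dominance_bounded)
qed simp

lemma before_nth:
  "distinct L \<Longrightarrow> i < length L \<Longrightarrow> before L (L ! i) = set (take i L)"
  using before_split[of "take i L" "drop i L"] by (simp add: hd_drop_conv_nth)

lemma in_before_nth:
  assumes "distinct L" "i < length L" "a < length L"
  shows "L ! a \<in> before L (L ! i) \<longleftrightarrow> a < i"
proof -
  have "L ! a \<in> set (take i L) \<longleftrightarrow> a < i"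
    using assms by (auto simp: in_set_conv_nth nth_eq_iff_index_eq)
  then show ?thesis using before_nth[OF assms(1,2)] by simp
qed

text \<open>For \<open>a < b\<close> the right-hand side is \<open>beneath i (a, b)\<close>.\<close>

lemma under_nth:
  assumes "distinct L" "(a, b) \<in> links L" "i < length L"
  shows "under L (L ! i) (L ! a) \<longleftrightarrow> (a < i) \<noteq> (b < i)"
proof -
  have ab: "a < length L" "b < length L" "dual (L ! a) = L ! b"
    using assms(2) by (auto simp: links_def)
  show ?thesis
    unfolding under_def ab(3) using in_before_nth[OF assms(1,3)] ab by simp
qed

lemma linksE:
  assumes "dual_closed (set L)" "x \<in> set L"
  obtains a b where "(a, b) \<in> links L" "x = L ! a" "dual x = L ! b"
proof -
  have "dual x \<in> set L" using assms by (simp add: dual_closedD)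
  then show ?thesis
    using assms(2) that unfolding in_set_conv_nth links_def by force
qed

lemma links_sym: "(a, b) \<in> links L \<Longrightarrow> (b, a) \<in> links L"
  by (auto simp: links_def)

lemma links_bound: "(a, b) \<in> links L \<Longrightarrow> a < length L \<and> b < length L \<and> a \<noteq> b"
  by (auto simp: links_def)

lemma same_region_links:
  assumes "distinct L" "dual_closed (set L)"
  shows "(i, j) \<in> same_region (length L) (links L) \<longleftrightarrow>
    i < length L \<and> j < length L \<and> same_face L (L ! i) (L ! j)"
proof (cases "i < length L \<and> j < length L")
  case ij: True
  have "(\<forall>(a, b)\<in>links L. a < b \<longrightarrow> beneath i (a, b) = beneath j (a, b)) \<longleftrightarrow>
      (\<forall>x. under L (L ! i) x = under L (L ! j) x)" (is "?l \<longleftrightarrow> ?r")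
  proof
    assume l: ?l
    show ?r
    proof
      fix x
      show "under L (L ! i) x = under L (L ! j) x"
      proof (cases "x \<in> set L")
        case True
        then obtain a b where ab: "(a, b) \<in> links L" "x = L ! a"
          using linksE[OF assms(2)] by metis
        have "a < b \<Longrightarrow> beneath i (a, b) = beneath j (a, b)" "b < a \<Longrightarrow> beneath i (b, a) = beneath j (b, a)"
          using l ab(1) links_sym by blast+
        then show ?thesis
          using under_nth[OF assms(1) ab(1)] ij ab links_bound[OF ab(1)]
          by (auto simp: beneath_def)
      next
        case False
        then have "dual x \<notin> set L" using dual_closedD[OF assms(2)] by simp
        then show ?thesis
          using False before_subset[of L] unfolding under_def by blast
      qed
    qed
  next
    assume r: ?r
    have "beneath i (a, b) = beneath j (a, b)" if "(a, b) \<in> links L" "a < b" for a b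
      using spec[OF r, of "L ! a"] under_nth[OF assms(1) that(1)] ij that(2)
      by (auto simp: beneath_def)
    then show ?l by blast
  qed
  then show ?thesis using ij by (auto simp: same_region_def same_face_def)
qed (auto simp: same_region_def)

lemma planar_links:
  assumes "distinct L" "dual_closed (set L)"
  shows "planar (links L) \<longleftrightarrow> noncrossing L"
proof
  assume pl: "planar (links L)"
  show "noncrossing L"
    unfolding noncrossing_def
  proof (intro ballI allI impI)
    fix x y assume x: "x \<in> set L" and y: "y \<noteq> x" "y \<noteq> dual x"
    show "under L x y = under L (dual x) y"
    proof (cases "y \<in> set L")
      case True
      obtain i k where ik: "(i, k) \<in> links L" "x = L ! i" "dual x = L ! k"
        using linksE[OF assms(2) x] by metis
      obtain j l where jl: "(j, l) \<in> links L" "y = L ! j" "dual y = L ! l"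
        using linksE[OF assms(2) True] by metis
      have b: "i < length L" "k < length L" using links_bound ik by blast+
      have ne: "i \<noteq> j" "i \<noteq> l" "k \<noteq> j" "k \<noteq> l" "i \<noteq> k" "j \<noteq> l"
        using y ik jl links_bound by (auto; metis dual_dual)+
      have no: "\<not> (p < q \<and> q < r \<and> r < s)" if "(p, r) \<in> links L" "(q, s) \<in> links L" for p q r s
        using pl that unfolding planar_def by blast
      note * = links_sym[OF ik(1)] links_sym[OF jl(1)] ik(1) jl(1)
      \<comment> \<open>\<open>planar\<close> speaks only of increasing indices, so both links are
        tried in both directions and both orders.\<close>
      have "((j < i) \<noteq> (l < i)) = ((j < k) \<noteq> (l < k))"
        using ne no[OF *(3) *(4)] no[OF *(3) *(2)] no[OF *(1) *(4)] no[OF *(1) *(2)]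
          no[OF *(4) *(3)] no[OF *(4) *(1)] no[OF *(2) *(3)] no[OF *(2) *(1)]
        by (metis linorder_neqE_nat)
      then show ?thesis
        unfolding ik(3) using under_nth[OF assms(1) jl(1)] b ik(2) jl(2) by simp
    next
      case False
      then have "dual y \<notin> set L" using dual_closedD[OF assms(2)] by simp
      then show ?thesis
        using False before_subset[of L] unfolding under_def by blast
    qed
  qed
next
  assume nc: "noncrossing L"
  show "planar (links L)"
    unfolding planar_def
  proof
    assume "\<exists>i j k l. (i, k) \<in> links L \<and> (j, l) \<in> links L \<and> i < j \<and> j < k \<and> k < l"
    then obtain i j k l where *: "(i, k) \<in> links L" "(j, l) \<in> links L" "i < j" "j < k" "k < l"
      by blast
    have b: "i < length L" "k < length L" "j < length L" "L ! k = dual (L ! i)"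
      using * by (auto simp: links_def)
    have "L ! j \<noteq> L ! i" "L ! j \<noteq> L ! k"
      using nth_eq_iff_index_eq[OF assms(1), of j i] nth_eq_iff_index_eq[OF assms(1), of j k]
        b(1-3) *(3,4) by simp_all
    then have "under L (L ! i) (L ! j) = under L (L ! k) (L ! j)"
      using nc b unfolding noncrossing_def by simp
    then show False
      using under_nth[OF assms(1) *(2) b(1)] under_nth[OF assms(1) *(2) b(2)] *(3-5) by simp
  qed
qed

lemma acyclic_if_acyclic_image:
  assumes "acyclic (map_prod f f ` R)"
  shows "acyclic R"
proof -
  have "(f x, f y) \<in> (map_prod f f ` R)\<^sup>+" if "(x, y) \<in> R\<^sup>+" for x y
    using that
  proof (induction rule: trancl_induct)
    case (base y)
    then show ?case by (auto intro!: r_into_trancl' image_eqI)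
  next
    case (step y z)
    have "(f y, f z) \<in> map_prod f f ` R" using step(2) by (auto intro: image_eqI)
    then show ?case using step.IH by (rule trancl_into_trancl[rotated])
  qed
  then show ?thesis using assms unfolding acyclic_def by blast
qed

text \<open>\<open>acyclic_if_acyclic_image\<close> is applied to \<open>f\<close> and to its
  inverse on \<open>A\<close>.\<close>

lemma acyclic_image:
  assumes "inj_on f A" "R \<subseteq> A \<times> A"
  shows "acyclic (map_prod f f ` R) \<longleftrightarrow> acyclic R"
proof -
  let ?g = "inv_into A f"
  have "(map_prod ?g ?g \<circ> map_prod f f) p = p" if "p \<in> R" for p
    using that assms by (cases p) (auto simp: inv_into_f_f)
  then have "map_prod ?g ?g ` (map_prod f f ` R) = R"
    unfolding image_comp by simp
  then show ?thesis
    using acyclic_if_acyclic_image[of f R] acyclic_if_acyclic_image[of ?g "map_prod f f ` R"] by auto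
qed

section \<open>Erasing labels\<close>

lemma lits_erase [simp]: "lits (erase X) = map erase_lit (lits X)"
  by (induction X) auto

lemma conns_erase [simp]: "conns (erase X) = conns X"
  by (induction X) auto

lemma expr_dominance_erase [simp]: "expr_dominance k (erase X) = expr_dominance k X"
  by (induction X arbitrary: k) auto

lemma omega_erase [simp]:
  "omega_lits (map erase Xs) = map erase_lit (omega_lits Xs)"
  "omega_conns (map erase Xs) = omega_conns Xs"
  by (induction Xs) (auto simp: omega_conns_def)

lemma dominance_from_erase [simp]: "dominance_from k (map erase Xs) = dominance_from k Xs"
  by (induction Xs arbitrary: k) auto

lemma erase_lit_dual: "erase_lit (dual q) = dual (erase_lit q)"
  by (cases q) auto

lemma proof_structure_links:
  assumes "distinct L" "dual_closed (set L)"
  shows "proof_structure (map erase_lit L) (links L)"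
  unfolding proof_structure_def
proof (intro conjI allI impI)
  show "links L \<subseteq> {..<length (map erase_lit L)} \<times> {..<length (map erase_lit L)}"
    by (auto simp: links_def)
  show "sym (links L)"
    by (auto intro: symI links_sym)
  show "\<forall>(i, j)\<in>links L. map erase_lit L ! j = dual (map erase_lit L ! i)"
    by (auto simp: links_def erase_lit_dual)
next
  fix i assume i: "i < length (map erase_lit L)"
  then have "dual (L ! i) \<in> set L" using assms(2) by (simp add: dual_closedD)
  then obtain j where j: "j < length L" "L ! j = dual (L ! i)"
    by (auto simp: in_set_conv_nth)
  show "\<exists>!j. (i, j) \<in> links L"
  proof (rule ex1I[of _ j])
    show "(i, j) \<in> links L" using i j by (simp add: links_def)
  next
    fix j' assume "(i, j') \<in> links L"
    then show "j' = j"
      using j nth_eq_iff_index_eq[OF assms(1), of j' j] by (simp add: links_def)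
  qed
qed

lemma region_condition_links:
  assumes L: "distinct L" "dual_closed (set L)"
    and len: "length cs = length L"
    and cs: "\<And>i. i < length L \<Longrightarrow> cs ! i = CTensor \<longleftrightarrow> L ! i \<in> T"
  shows "(\<forall>R\<in>regions (length cs) (links L). \<exists>!i. i \<in> R \<and> cs ! i \<in> {CPar, CDiamond}) \<longleftrightarrow>
    (\<forall>q\<in>set L. \<exists>!r. same_face L q r \<and> r \<notin> T)"
proof -
  let ?S = "same_region (length L) (links L)"
  have par: "cs ! i \<in> {CPar, CDiamond} \<longleftrightarrow> L ! i \<notin> T" if "i < length L" for i
    using cs[OF that] by (cases "cs ! i") auto
  have "(\<exists>!j. j \<in> ?S `` {i} \<and> cs ! j \<in> {CPar, CDiamond}) \<longleftrightarrow> (\<exists>!r. same_face L (L ! i) r \<and> r \<notin> T)"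
    (is "?l \<longleftrightarrow> ?r") if i: "i < length L" for i
  proof
    assume ?l
    then obtain j where j: "(i, j) \<in> ?S" "cs ! j \<in> {CPar, CDiamond}"
      "\<And>j'. (i, j') \<in> ?S \<Longrightarrow> cs ! j' \<in> {CPar, CDiamond} \<Longrightarrow> j' = j"
      by blast
    show ?r
    proof (rule ex1I[of _ "L ! j"])
      show "same_face L (L ! i) (L ! j) \<and> L ! j \<notin> T"
        using j(1,2) same_region_links[OF L] par by auto
    next
      fix r assume r: "same_face L (L ! i) r \<and> r \<notin> T"
      then obtain j' where j': "j' < length L" "r = L ! j'"
        by (auto simp: same_face_def in_set_conv_nth)
      then have "j' = j" using r i by (intro j(3)) (auto simp: same_region_links[OF L] par simp del: insert_iff)
      then show "r = L ! j" using j' by simp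
    qed
  next
    assume ?r
    then obtain r where r: "same_face L (L ! i) r" "r \<notin> T"
      "\<And>s. same_face L (L ! i) s \<Longrightarrow> s \<notin> T \<Longrightarrow> s = r"
      by blast
    then obtain j where j: "j < length L" "r = L ! j"
      by (auto simp: same_face_def in_set_conv_nth)
    show ?l
    proof (rule ex1I[of _ j])
      show "j \<in> ?S `` {i} \<and> cs ! j \<in> {CPar, CDiamond}"
        using r(1,2) j i par[OF j(1)] same_region_links[OF L] by auto
    next
      fix j' assume j': "j' \<in> ?S `` {i} \<and> cs ! j' \<in> {CPar, CDiamond}"
      then have s: "j' < length L" "same_face L (L ! i) (L ! j')"
        using same_region_links[OF L] by auto
      then have "L ! j' = r" using j' par[OF s(1)] by (intro r(3)) auto
      then show "j' = j" using s(1) j L(1) by (simp add: nth_eq_iff_index_eq)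
    qed
  qed
  then have "(\<forall>i<length L. \<exists>!j. j \<in> ?S `` {i} \<and> cs ! j \<in> {CPar, CDiamond}) \<longleftrightarrow>
      (\<forall>q\<in>set L. \<exists>!r. same_face L q r \<and> r \<notin> T)"
    unfolding all_set_conv_all_nth by (rule all_cong)
  moreover have "(\<forall>R\<in>regions (length cs) (links L). P R) \<longleftrightarrow> (\<forall>i<length L. P (?S `` {i}))" for P
    unfolding regions_def quotient_def len by blast
  ultimately show ?thesis by simp
qed

text \<open>Erasure changes the literals alone, while connectives, dominance and links are given by
  indices. The map from indices to names is injective, so it preserves and reflects cycles.\<close>

lemma proof_net_links:
  assumes L: "distinct (omega_lits Xs)" "dual_closed (set (omega_lits Xs))" and ne: "Xs \<noteq> []"
  shows "proof_net (map erase Xs) (links (omega_lits Xs)) \<longleftrightarrow> expr_net Xs"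
proof -
  let ?L = "omega_lits Xs" and ?cs = "omega_conns Xs" and ?T = "tensors Xs"
  let ?f = "(!) ?L"
  have cs: "?cs ! i = CTensor \<longleftrightarrow> ?L ! i \<in> ?T" if "i < length ?L" for i
    using omega_conns_tensors[OF L(1) that] .
  have par: "?cs ! i \<in> {CPar, CDiamond} \<longleftrightarrow> ?L ! i \<notin> ?T" if "i < length ?L" for i
    using cs[OF that] by (cases "?cs ! i") auto
  have "map_prod ?f ?f ` region_graph ?cs (links ?L) = switches ?L ?T"
  proof (intro equalityI subsetI)
    fix p assume "p \<in> map_prod ?f ?f ` region_graph ?cs (links ?L)"
    then show "p \<in> switches ?L ?T"
      using same_region_links[OF L] cs par by (auto simp: region_graph_def switches_def)
  next
    fix p assume "p \<in> switches ?L ?T"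
    then obtain q r where p: "p = (q, r)" "same_face ?L q r" "q \<in> ?T" "r \<notin> ?T"
      by (auto simp: switches_def)
    then obtain i j where ij: "i < length ?L" "j < length ?L" "q = ?L ! i" "r = ?L ! j"
      by (auto simp: same_face_def in_set_conv_nth)
    then have "(i, j) \<in> region_graph ?cs (links ?L)"
      using p same_region_links[OF L] cs par[OF ij(2)] by (simp add: region_graph_def)
    then show "p \<in> map_prod ?f ?f ` region_graph ?cs (links ?L)"
      using p ij by (auto intro: rev_image_eqI)
  qed
  moreover have "map_prod ?f ?f ` dominance Xs = dominations Xs"
    unfolding dominance_def by (rule dominance_from_dominations[OF occurs_at_self])
  moreover have "region_graph ?cs (links ?L) \<union> dominance Xs \<subseteq> {..<length ?L} \<times> {..<length ?L}"
    using dominance_from_bounded[of _ _ 0 Xs]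
    by (auto simp: region_graph_def same_region_def dominance_def)
  moreover have "inj_on ?f {..<length ?L}"
    using L(1) by (auto simp: inj_on_def nth_eq_iff_index_eq)
  ultimately have "acyclic (region_graph ?cs (links ?L) \<union> dominance Xs) \<longleftrightarrow>
      acyclic (switches ?L ?T \<union> dominations Xs)"
    using acyclic_image by (metis image_Un)
  then show ?thesis
    using L ne proof_structure_links[OF L] planar_links[OF L]
      region_condition_links[OF L _ cs] unfolding proof_net_def expr_net_def net_def
    by (simp add: dominance_def)
qed

subsection \<open>Sisters and labels\<close>

text \<open>What sisterhood becomes on names: equal sign and label, and the two bracket codes in
  either order.\<close>

definition twins :: "literal \<Rightarrow> literal \<Rightarrow> bool" where
  "twins q r \<longleftrightarrow> (\<exists>k a b. {a, b} = {0, Suc 0} \<and>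
    (q = Pos (name k a) \<and> r = Pos (name k b) \<or> q = Neg (name k a) \<and> r = Neg (name k b)))"

text \<open>The range from \<open>l\<close> to \<open>h\<close> lets the parts of a translation be
  composed. The last clause provides a sister for every bracket in the range, which labelling a
  given net relies on.\<close>

definition sisters_ok :: "(nat \<times> nat) set \<Rightarrow> literal list \<Rightarrow> nat \<Rightarrow> nat \<Rightarrow> bool" where
  "sisters_ok S L l h \<longleftrightarrow> sym S \<and>
    (\<forall>(i, j)\<in>S. i \<in> {l..<h} \<and> j \<in> {l..<h} \<and> twins (L ! i) (L ! j)) \<and>
    (\<forall>i\<in>{l..<h}. (\<exists>r. twins (L ! i) r) \<longrightarrow> i \<in> Domain S)"

lemma twins_fun: "twins q r \<Longrightarrow> twins q s \<Longrightarrow> r = s"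
  by (auto simp: twins_def doubleton_eq_iff)

lemma twins_dual: "twins q r \<Longrightarrow> twins (dual q) (dual r)"
  by (auto simp: twins_def)

lemma twins_sym: "twins q r \<Longrightarrow> twins r q"
  by (auto simp: twins_def doubleton_eq_iff)

lemma twins_simps [simp]:
  "\<not> twins (Pos (name l (Suc (Suc i)))) r" "\<not> twins (Neg (name l (Suc (Suc i)))) r"
  "twins (Pos (name k 0)) (Pos (name k (Suc 0)))" "twins (Pos (name k (Suc 0))) (Pos (name k 0))"
  "twins (Neg (name k 0)) (Neg (name k (Suc 0)))" "twins (Neg (name k (Suc 0))) (Neg (name k 0))"
  by (auto simp: twins_def doubleton_eq_iff)

lemma sisters_ok_empty: "sisters_ok {} L l l"
  by (simp add: sisters_ok_def sym_def)

lemma sisters_ok_var: "\<nexists>r. twins (L ! l) r \<Longrightarrow> sisters_ok {} L l (Suc l)"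
  by (auto simp: sisters_ok_def sym_def less_Suc_eq_le)

lemma sisters_ok_Un:
  assumes "sisters_ok S L l m" "sisters_ok S' L m h" "l \<le> m" "m \<le> h"
  shows "sisters_ok (S \<union> S') L l h"
proof -
  have "{l..<h} = {l..<m} \<union> {m..<h}" using assms(3,4) by auto
  then show ?thesis
    using assms(1,2) unfolding sisters_ok_def by (auto simp: sym_Un) 
qed

lemma sisters_ok_bracket:
  assumes "sisters_ok S L (Suc l) m" "twins (L ! l) (L ! m)" "l < m"
  shows "sisters_ok (S \<union> sister_pair l m) L l (Suc m)"
proof -
  have "{l..<Suc m} = insert l (insert m {Suc l..<m})" using assms(3) by auto
  moreover have "sym (sister_pair l m)" by (auto simp: sister_pair_def sym_def)
  then have "sym (S \<union> sister_pair l m)" using assms(1) by (simp add: sisters_ok_def sym_Un)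
  ultimately show ?thesis
    using assms twins_sym[OF assms(2)] unfolding sisters_ok_def
    by (intro conjI) (auto simp: sister_pair_def)
qed

lemma erase_translations [simp]:
  "erase (lpos A) = pos (strip A)" "erase (lneg A) = neg (strip A)"
  by (induction A) auto

lemma width_strip [simp]: "width (pos (strip A)) = width (lpos A)" "width (neg (strip A)) = width (lneg A)"
  by (metis length_map lits_erase erase_translations)+

lemma sisters_ok_form:
  "(occurs_at L k (lits (lpos A)) \<longrightarrow> sisters_ok (pos_sisters k (strip A)) L k (k + width (lpos A))) \<and>
   (occurs_at L k (lits (lneg A)) \<longrightarrow> sisters_ok (neg_sisters k (strip A)) L k (k + width (lneg A)))"
proof (induction A arbitrary: k)
  case (LVar l i)
  then show ?case by (auto intro!: sisters_ok_var)
next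
  case (LLDiv A B)
  show ?case
    using LLDiv.IH(1)[of k] LLDiv.IH(2)[of k] LLDiv.IH(1)[of "k + width (lneg B)"] LLDiv.IH(2)[of "k + width (lneg A)"]
    by (auto simp: add.assoc intro: sisters_ok_Un)
next
  case (LRDiv B A)
  show ?case
    using LRDiv.IH(1)[of k] LRDiv.IH(2)[of k] LRDiv.IH(1)[of "k + width (lpos A)"] LRDiv.IH(2)[of "k + width (lpos B)"]
    by (auto simp: add.assoc intro: sisters_ok_Un)
next
  case (LProd A B)
  show ?case
    using LProd.IH(1)[of k] LProd.IH(2)[of k] LProd.IH(1)[of "k + width (lneg B)"] LProd.IH(2)[of "k + width (lpos A)"]
    by (auto simp: add.assoc intro: sisters_ok_Un)
next
  case (LDia n A)
  show ?case
    using LDia.IH[of "Suc k"] by (auto intro!: sisters_ok_bracket)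
next
  case (LBox n A)
  show ?case
    using LBox.IH[of "Suc k"] by (auto intro!: sisters_ok_bracket)
qed

lemma erase_flat:
  "map erase (map flat_expr (flat_item x)) = item_neg (strip_item x)"
  "map erase (map flat_expr (flatten G)) = meta_neg (map strip_item G)"
  by (induction x and G rule: flat_item_flatten.induct) auto

lemma length_meta_neg [simp]:
  "length (omega_lits (meta_neg (map strip_item G))) = length (omega_lits (map flat_expr (flatten G)))"
  "length (omega_lits (item_neg (strip_item x))) = length (omega_lits (map flat_expr (flat_item x)))"
  by (metis erase_flat(2) omega_erase(1) length_map, metis erase_flat(1) omega_erase(1) length_map)

lemma sisters_ok_meta:
  "occurs_at L k (omega_lits (map flat_expr (flat_item x))) \<Longrightarrow>
    sisters_ok (item_sisters k (strip_item x)) L k (k + length (omega_lits (map flat_expr (flat_item x))))"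
  "occurs_at L k (omega_lits (map flat_expr (flatten G))) \<Longrightarrow>
    sisters_ok (meta_sisters k (map strip_item G)) L k (k + length (omega_lits (map flat_expr (flatten G))))"
proof (induction x and G arbitrary: k and k rule: flat_item_flatten.induct)
  case (1 A)
  then show ?case using sisters_ok_form[of L k A] by simp
next
  case (2 n G)
  then show ?case using 2(1)[of "Suc k"] by (auto intro!: sisters_ok_bracket)
next
  case 3
  then show ?case by (simp add: sisters_ok_empty)
next
  case (4 x G)
  let ?n = "length (omega_lits (map flat_expr (flatten G)))"
  have "sisters_ok (meta_sisters k (map strip_item G)) L k (k + ?n)"
    using 4(3) by (intro 4(1)) simp
  moreover have "sisters_ok (item_sisters (k + ?n) (strip_item x)) L (k + ?n)
      (k + ?n + length (omega_lits (map flat_expr (flat_item x))))"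
    using 4(3) by (intro 4(2)) simp
  ultimately show ?case
    using sisters_ok_Un by (simp add: add.assoc)
qed

lemma erase_lseq: "map erase (lseq (flatten G) C) = sequent_exprs (map strip_item G) (strip C)"
  using erase_flat(2)[of G] by (simp add: lseq_def sequent_exprs_def)

lemma sisters_ok_sequent:
  fixes G C defines "L \<equiv> omega_lits (lseq (flatten G) C)"
  shows "sisters_ok (sisters (map strip_item G) (strip C)) L 0 (length L)"
proof -
  have L: "L = omega_lits (map flat_expr (flatten G)) @ lits (lpos C)"
    by (simp add: L_def lseq_def)
  have "occurs_at L 0 L" by (rule occurs_at_self)
  then have "occurs_at L 0 (omega_lits (map flat_expr (flatten G)))"
    "occurs_at L (length (omega_lits (map flat_expr (flatten G)))) (lits (lpos C))"
    unfolding L by simp_all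
  then have "sisters_ok (meta_sisters 0 (map strip_item G)) L 0 (length (omega_lits (map flat_expr (flatten G))))"
    "sisters_ok (pos_sisters (length (omega_lits (map flat_expr (flatten G)))) (strip C)) L
      (length (omega_lits (map flat_expr (flatten G)))) (length L)"
    using sisters_ok_meta(2)[of L 0 G] sisters_ok_form[of L _ C] by (auto simp: L)
  then show ?thesis
    by (auto simp: sisters_def L intro: sisters_ok_Un)
qed

text \<open>Duality maps twins to twins, and a literal has at most one twin.\<close>

lemma respects_links:
  assumes "sisters_ok S L 0 (length L)"
  shows "respects_sisterhood S (links L)"
  unfolding respects_sisterhood_def
proof (intro allI impI)
  fix i i' j j' assume a: "(i, i') \<in> links L \<and> (i, j) \<in> S \<and> (i', j') \<in> S"
  then have "twins (L ! i) (L ! j)" "twins (L ! i') (L ! j')" "j < length L" "j' < length L"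
    using assms by (auto simp: sisters_ok_def)
  moreover have "L ! i' = dual (L ! i)" using a by (auto simp: links_def)
  ultimately show "(j, j') \<in> links L"
    using twins_dual twins_fun by (fastforce simp: links_def)
qed

section \<open>Labelling a given net\<close>

text \<open>\<open>m\<close> assigns labels to indices. A modality takes the label of its opening
  bracket, which comes last in positive and first in negative translations.\<close>

fun label_pos :: "(nat \<Rightarrow> nat) \<Rightarrow> nat \<Rightarrow> form \<Rightarrow> lform"
  and label_neg :: "(nat \<Rightarrow> nat) \<Rightarrow> nat \<Rightarrow> form \<Rightarrow> lform" where
  "label_pos m k (Var i) = LVar (m k) i"
| "label_pos m k (LDiv A B) = LLDiv (label_neg m k A) (label_pos m (k + width (neg A)) B)"
| "label_pos m k (RDiv B A) = LRDiv (label_pos m k B) (label_neg m (k + width (pos B)) A)"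
| "label_pos m k (Prod A B) = LProd (label_pos m k A) (label_pos m (k + width (pos A)) B)"
| "label_pos m k (Dia A) = LDia (m (Suc k + width (pos A))) (label_pos m (Suc k) A)"
| "label_pos m k (Box A) = LBox (m (Suc k + width (pos A))) (label_pos m (Suc k) A)"
| "label_neg m k (Var i) = LVar (m k) i"
| "label_neg m k (LDiv A B) = LLDiv (label_pos m (k + width (neg B)) A) (label_neg m k B)"
| "label_neg m k (RDiv B A) = LRDiv (label_neg m (k + width (pos A)) B) (label_pos m k A)"
| "label_neg m k (Prod A B) = LProd (label_neg m (k + width (neg B)) A) (label_neg m k B)"
| "label_neg m k (Dia A) = LDia (m k) (label_neg m (Suc k) A)"
| "label_neg m k (Box A) = LBox (m k) (label_neg m (Suc k) A)"

fun label_item :: "(nat \<Rightarrow> nat) \<Rightarrow> nat \<Rightarrow> item \<Rightarrow> litem"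
  and label_meta :: "(nat \<Rightarrow> nat) \<Rightarrow> nat \<Rightarrow> meta \<Rightarrow> litem list" where
  "label_item m k (Fm A) = LFm (label_neg m k A)"
| "label_item m k (Br G) = LBr (m k) (label_meta m (Suc k) G)"
| "label_meta m k [] = []"
| "label_meta m k (x # G) =
    label_item m (k + length (omega_lits (meta_neg G))) x # label_meta m k G"

lemma strip_label [simp]: "strip (label_pos m k A) = A" "strip (label_neg m k A) = A"
  by (induction A arbitrary: k) auto

lemma strip_label_meta [simp]:
  "strip_item (label_item m k x) = x" "map strip_item (label_meta m k G) = G"
  by (induction m k x and m k G rule: label_item_label_meta.induct) auto

text \<open>Closing brackets are exempt, as they carry the label of their sister.\<close>

definition labelled_at :: "(nat \<Rightarrow> nat) \<Rightarrow> literal list \<Rightarrow> nat \<Rightarrow> nat \<Rightarrow> bool" where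
  "labelled_at m L l h \<longleftrightarrow> (\<forall>i\<in>{l..<h}. (\<forall>k. L ! i \<noteq> Pos (name k (Suc 0)) \<and> L ! i \<noteq> Neg (name k (Suc 0))) \<longrightarrow>
    label (L ! i) = m i)"

lemma labelled_at_Un:
  "labelled_at m L l n \<Longrightarrow> labelled_at m L n h \<Longrightarrow> labelled_at m L l h"
  by (fastforce simp: labelled_at_def)

lemma labelled_at_Suc:
  "labelled_at m L l (Suc l) \<longleftrightarrow>
    (\<exists>k. L ! l = Pos (name k (Suc 0)) \<or> L ! l = Neg (name k (Suc 0))) \<or> label (L ! l) = m l"
  by (auto simp: labelled_at_def less_Suc_eq_le)

lemma width_label [simp]:
  "width (lpos (label_pos m k A)) = width (pos A)" "width (lpos (label_neg m k A)) = width (pos A)"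
  "width (lneg (label_pos m k A)) = width (neg A)" "width (lneg (label_neg m k A)) = width (neg A)"
  by (metis strip_label width_strip)+

lemma labelled_at_form:
  "(occurs_at L k (lits (lpos (label_pos m k A))) \<longrightarrow> labelled_at m L k (k + width (pos A))) \<and>
   (occurs_at L k (lits (lneg (label_neg m k A))) \<longrightarrow> labelled_at m L k (k + width (neg A)))"
proof (induction A arbitrary: k)
  case (Var i)
  then show ?case by (auto simp: labelled_at_Suc)
next
  case (LDiv A B)
  show ?case
    using LDiv.IH(1)[of k] LDiv.IH(2)[of k] LDiv.IH(1)[of "k + width (neg B)"] LDiv.IH(2)[of "k + width (neg A)"]
    by (auto simp: add.assoc intro: labelled_at_Un)
next
  case (RDiv B A)
  show ?case
    using RDiv.IH(1)[of k] RDiv.IH(2)[of k] RDiv.IH(1)[of "k + width (pos A)"] RDiv.IH(2)[of "k + width (pos B)"]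
    by (auto simp: add.assoc intro: labelled_at_Un)
next
  case (Prod A B)
  show ?case
    using Prod.IH(1)[of k] Prod.IH(2)[of k] Prod.IH(1)[of "k + width (neg B)"] Prod.IH(2)[of "k + width (pos A)"]
    by (auto simp: add.assoc intro: labelled_at_Un)
next
  case (Dia A)
  show ?case
    using Dia.IH[of "Suc k"] labelled_at_Suc[of m L k] labelled_at_Suc[of m L "Suc (k + width (pos A))"]
      labelled_at_Suc[of m L "Suc (k + width (neg A))"]
    by (auto intro: labelled_at_Un)
next
  case (Box A)
  show ?case
    using Box.IH[of "Suc k"] labelled_at_Suc[of m L k] labelled_at_Suc[of m L "Suc (k + width (pos A))"]
      labelled_at_Suc[of m L "Suc (k + width (neg A))"]
    by (auto intro: labelled_at_Un)
qed

lemma length_label_meta [simp]: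
  "length (omega_lits (map flat_expr (flatten (label_meta m k G)))) = length (omega_lits (meta_neg G))"
  "length (omega_lits (map flat_expr (flat_item (label_item m k x)))) = length (omega_lits (item_neg x))"
  by (metis length_meta_neg(1) strip_label_meta(2), metis length_meta_neg(2) strip_label_meta(1))

lemma labelled_at_meta:
  "occurs_at L k (omega_lits (map flat_expr (flat_item (label_item m k x)))) \<Longrightarrow>
    labelled_at m L k (k + length (omega_lits (item_neg x)))"
  "occurs_at L k (omega_lits (map flat_expr (flatten (label_meta m k G)))) \<Longrightarrow>
    labelled_at m L k (k + length (omega_lits (meta_neg G)))"
proof (induction m k x and m k G rule: label_item_label_meta.induct)
  case (1 m k A)
  then show ?case using labelled_at_form[of L k m A] by simp
next
  case (2 m k G)
  then show ?case
    using labelled_at_Suc[of m L k] labelled_at_Suc[of m L "Suc (k + length (omega_lits (meta_neg G)))"]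
    by (auto intro: labelled_at_Un)
next
  case (3 m k)
  then show ?case by (simp add: labelled_at_def)
next
  case (4 m k x G)
  then show ?case
    by (auto simp: add.assoc intro: labelled_at_Un)
qed

definition is_named :: "literal \<Rightarrow> bool" where
  "is_named q \<longleftrightarrow> (\<exists>l a. q = Pos (name l a) \<or> q = Neg (name l a))"

lemma is_named_translations:
  "q \<in> set (lits (lpos A)) \<union> set (lits (lneg A)) \<Longrightarrow> is_named q"
  by (induction A) (auto simp: is_named_def)

lemma is_named_lseq: "q \<in> names Fs C \<Longrightarrow> is_named q"
proof -
  have "is_named q" if "q \<in> set (lits (flat_expr f))" for f
    using that is_named_translations by (cases f) (auto simp: is_named_def)
  then show "q \<in> names Fs C \<Longrightarrow> is_named q"
    using is_named_translations by (auto simp: names_simps)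
qed

lemma erase_name_inj: "erase_atom (name l a) = erase_atom (name l' b) \<Longrightarrow> a = b"
  by (cases a; cases b; cases "a - 1"; cases "b - 1") auto

lemma named_eqI:
  assumes "is_named q" "is_named r" "erase_lit q = erase_lit r" "label q = label r"
  shows "q = r"
  using assms by (auto simp: is_named_def dest: erase_name_inj)

lemma closing_twin:
  assumes "is_named q" "erase_lit q = Pos Closing \<or> erase_lit q = Neg Closing"
  shows "\<exists>r. twins q r \<and> label r = label q \<and> erase_lit r \<notin> {Pos Closing, Neg Closing}"
proof -
  obtain k a where q: "q = Pos (name k a) \<or> q = Neg (name k a)" using assms(1) by (auto simp: is_named_def)
  then have "erase_atom (name k a) = erase_atom (name k (Suc 0))" using assms(2) by auto
  then have "a = Suc 0" by (rule erase_name_inj)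
  then show ?thesis
    using q twins_simps(4,6)[of k] by (elim disjE) fastforce+
qed

(* An occurrence is labelled with the smaller end of its link, except that a closing bracket takes
   the label of its sister. *)
lemma proof_net_labelled:
  assumes net: "proof_net (sequent_exprs G C) E"
    and resp: "respects_sisterhood (sisters G C) E"
  shows "\<exists>G' C'. map strip_item G' = G \<and> strip C' = C \<and> expr_net (lseq (flatten G') C')"
proof -
  define e where "e i = (THE j. (i, j) \<in> E)" for i
  define m where "m i = min i (e i)" for i
  define G' where "G' = label_meta m 0 G"
  define C' where "C' = label_pos m (length (omega_lits (meta_neg G))) C"
  define Xs where "Xs = lseq (flatten G') C'"
  define L where "L = omega_lits Xs"
  define S where "S = sisters G C"
  have strip: "map strip_item G' = G" "strip C' = C" by (simp_all add: G'_def C'_def)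
  then have Xs: "map erase Xs = sequent_exprs G C"
    using erase_lseq by (simp add: Xs_def)
  have ps: "proof_structure (map erase_lit L) E"
    using net unfolding proof_net_def Xs[symmetric] L_def by simp
  have E: "i < length L" "j < length L" "erase_lit (L ! j) = dual (erase_lit (L ! i))" "(j, i) \<in> E"
    if "(i, j) \<in> E" for i j
    using ps that unfolding proof_structure_def by (fastforce dest: symD)+
  have uniq: "j = k" if "(i, j) \<in> E" "(i, k) \<in> E" for i j k
    using ps that E(1) unfolding proof_structure_def by (metis length_map)
  have ex: "(i, e i) \<in> E" if "i < length L" for i
    using ps that unfolding proof_structure_def e_def by (metis length_map theI')
  have e: "e i = j" "e j = i" if "(i, j) \<in> E" for i j
    using uniq[OF ex that] uniq[OF ex E(4)[OF that]] E(1,2)[OF that] by blast+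
  have m: "m i = m j" if "(i, j) \<in> E" for i j
    using e[OF that] by (simp add: m_def)
  have sis: "sisters_ok S L 0 (length L)"
    using sisters_ok_sequent[of G' C'] strip by (simp add: S_def L_def Xs_def)
  have symS: "(j, i) \<in> S" and twinS: "twins (L ! i) (L ! j)" and boundS: "i < length L" "j < length L"
    if "(i, j) \<in> S" for i j
    using sis that by (auto simp: sisters_ok_def dest: symD)
  have resp': "(j, j') \<in> E" if "(i, i') \<in> E" "(i, j) \<in> S" "(i', j') \<in> S" for i i' j j'
    using resp that unfolding respects_sisterhood_def S_def by blast
  have named: "is_named (L ! i)" if "i < length L" for i
    using that is_named_lseq[of "L ! i" "flatten G'" C'] by (simp add: L_def Xs_def)
  let ?cl = "\<lambda>i. erase_lit (L ! i) \<in> {Pos Closing, Neg Closing}"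
  have lab: "label (L ! i) = m i" if "i < length L" "\<not> ?cl i" for i
  proof -
    have Lsplit: "L = omega_lits (map flat_expr (flatten G')) @ lits (lpos C')"
      by (simp add: L_def Xs_def lseq_def)
    let ?n = "length (omega_lits (meta_neg G))"
    have "occurs_at L 0 (omega_lits (map flat_expr (flatten G')))" "occurs_at L ?n (lits (lpos C'))"
      using occurs_at_self[of L] unfolding Lsplit by (simp_all add: G'_def)
    then have "labelled_at m L 0 ?n" "labelled_at m L ?n (?n + width (pos C))"
      using labelled_at_meta(2)[of L 0 m G] labelled_at_form[of L ?n m C]
      by (simp_all add: G'_def C'_def)
    then have "labelled_at m L 0 (length L)"
      using labelled_at_Un by (simp add: Lsplit G'_def C'_def)
    moreover have "L ! i \<noteq> Pos (name k (Suc 0)) \<and> L ! i \<noteq> Neg (name k (Suc 0))" for k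
      using that(2) by auto
    ultimately show ?thesis using that(1) unfolding labelled_at_def by simp
  qed
  have sister: "\<exists>j. (i, j) \<in> S \<and> label (L ! i) = label (L ! j) \<and> \<not> ?cl j"
    if i: "i < length L" "?cl i" for i
  proof -
    obtain r where r: "twins (L ! i) r" "label r = label (L ! i)"
        "erase_lit r \<notin> {Pos Closing, Neg Closing}"
      using closing_twin[OF named[OF i(1)]] i(2) by auto
    then have "i \<in> Domain S" using sis i(1) unfolding sisters_ok_def by auto
    then obtain j where j: "(i, j) \<in> S" by blast
    then have "L ! j = r" using r(1) twinS twins_fun by blast
    then show ?thesis using r j by auto
  qed
  have linked: "L ! j = dual (L ! i)" if ij: "(i, j) \<in> E" for i j
  proof (rule named_eqI)
    show "is_named (L ! j)" using named E(2)[OF ij] .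
    show "is_named (dual (L ! i))" using named[OF E(1)[OF ij]] by (auto simp: is_named_def)
    show "erase_lit (L ! j) = erase_lit (dual (L ! i))" using E(3)[OF ij] by (simp add: erase_lit_dual)
    have cl: "?cl i \<longleftrightarrow> ?cl j" using E(3)[OF ij] by (cases "erase_lit (L ! i)") auto
    have "label (L ! i) = label (L ! j)"
    proof (cases "?cl i")
      \<comment> \<open>Linked closing brackets have linked sisters, as \<open>E\<close> respects
        sisterhood, and these opening brackets carry the label given by \<open>m\<close>.\<close>
      case True
      obtain i2 where i2: "(i, i2) \<in> S" "label (L ! i) = label (L ! i2)" "\<not> ?cl i2"
        using sister[OF E(1)[OF ij] True] by blast
      obtain j2 where j2: "(j, j2) \<in> S" "label (L ! j) = label (L ! j2)" "\<not> ?cl j2"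
        using sister[OF E(2)[OF ij]] True cl by blast
      show ?thesis
        using lab[OF boundS(2)[OF i2(1)] i2(3)] lab[OF boundS(2)[OF j2(1)] j2(3)]
          m[OF resp'[OF ij i2(1) j2(1)]] i2 j2 by simp
    next
      case False
      then show ?thesis using lab E(1,2)[OF ij] m[OF ij] cl by simp
    qed
    then show "label (L ! j) = label (dual (L ! i))" by (cases "L ! i") auto
  qed
  have inj0: "i = j" if "i < length L" "j < length L" "\<not> ?cl i" "L ! i = L ! j" for i j
  proof -
    have "m i = m j" using lab[OF that(1,3)] lab[OF that(2)] that by simp
    \<comment> \<open>Equal minima mean that the links share an end, so the indices are equal or
      linked; but linked literals are dual and hence different.\<close>
    then consider "i = j" | "i = e j" | "e i = j" | "e i = e j"
      by (auto simp: m_def min_def split: if_splits)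
    then show ?thesis
    proof cases
      case 2
      then show ?thesis using linked[OF ex[OF that(2)]] that(4) by simp
    next
      case 3
      then show ?thesis using linked[OF ex[OF that(1)]] that(4) by simp
    next
      case 4
      then show ?thesis
        using uniq E(4)[OF ex[OF that(1)]] E(4)[OF ex[OF that(2)]] by simp
    qed simp
  qed
  have inj: "i = j" if ij: "i < length L" "j < length L" "L ! i = L ! j" for i j
  proof (cases "?cl i")
    case True
    obtain i2 where i2: "(i, i2) \<in> S" "\<not> ?cl i2"
      using sister[OF ij(1) True] by blast
    obtain j2 where j2: "(j, j2) \<in> S"
      using sister[OF ij(2)] True ij(3) by auto
    have "L ! i2 = L ! j2"
      using twinS[OF i2(1)] twinS[OF j2] ij(3) twins_fun by simp
    then have eq: "j2 = i2" using inj0[of i2 j2] boundS(2)[OF i2(1)] boundS(2)[OF j2] i2(2) by blast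
    \<comment> \<open>It has not been shown that an occurrence has only one sister. So
      \<open>i\<close> and \<open>j\<close> are identified through \<open>p2\<close>, the sister of
      the partner of \<open>i2\<close>: both are linked to it.\<close>
    let ?p = "e i2"
    have p: "(i2, ?p) \<in> E" using ex[OF boundS(2)[OF i2(1)]] .
    have "twins (L ! ?p) (dual (L ! i))"
      using twins_dual[OF twins_sym[OF twinS[OF i2(1)]]] linked[OF p] by simp
    then have "?p \<in> Domain S"
      using sis E(2)[OF p] unfolding sisters_ok_def by auto
    then obtain p2 where p2: "(?p, p2) \<in> S" by blast
    have "(i, p2) \<in> E" "(j, p2) \<in> E"
      using resp'[OF p symS[OF i2(1)] p2] resp'[OF p symS[OF j2[unfolded eq]] p2] by blast+
    then show ?thesis using e(2) by blast
  next
    case False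
    then show ?thesis using inj0 ij by blast
  qed
  have dist: "distinct L"
    using inj by (auto simp: distinct_conv_nth)
  have closed: "dual_closed (set L)"
    unfolding dual_closed_def
  proof
    fix q assume "q \<in> set L"
    then obtain i where i: "i < length L" "q = L ! i" by (auto simp: in_set_conv_nth)
    then have "dual q = L ! e i" "e i < length L" using linked[OF ex] E(2)[OF ex] by simp_all
    then show "dual q \<in> set L" by simp
  qed
  have "E = links L"
  proof (intro equalityI subrelI)
    fix i j assume "(i, j) \<in> E"
    then show "(i, j) \<in> links L" using E linked by (simp add: links_def)
  next
    fix i j assume ij: "(i, j) \<in> links L"
    then have "L ! e i = L ! j" "i < length L" "j < length L" using linked ex by (auto simp: links_def)
    then have "e i = j" using inj E(2) ex by blast
    then show "(i, j) \<in> E" using ex \<open>i < length L\<close> by blast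
  qed
  then have "expr_net Xs"
    using proof_net_links[of Xs] net dist closed Xs by (simp add: L_def Xs_def lseq_def)
  then show ?thesis using strip Xs_def by blast
qed

theorem theorem14:
  fixes G :: meta and C :: form
  shows "derivable G C \<longleftrightarrow>
    (\<exists>E. proof_net (sequent_exprs G C) E \<and> respects_sisterhood (sisters G C) E)"
proof
  assume "derivable G C"
  then obtain G' C' where "labelled_net 0 G C G' C'" using derivable_labelled_net by blast
  then have *: "map strip_item G' = G" "strip C' = C" "expr_net (lseq (flatten G') C')"
    by (auto simp: labelled_net_def)
  let ?Xs = "lseq (flatten G') C'"
  have "proof_net (map erase ?Xs) (links (omega_lits ?Xs))"
    using proof_net_links[of ?Xs] expr_net_distinct[OF *(3)] expr_net_closed[OF *(3)] *(3)
    by (simp add: expr_net_def)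
  then have "proof_net (sequent_exprs G C) (links (omega_lits ?Xs))"
    using erase_lseq[of G' C'] * by simp
  moreover have "respects_sisterhood (sisters G C) (links (omega_lits ?Xs))"
    using respects_links[OF sisters_ok_sequent[of G' C']] * by simp
  ultimately show "\<exists>E. proof_net (sequent_exprs G C) E \<and> respects_sisterhood (sisters G C) E"
    by blast
next
  assume "\<exists>E. proof_net (sequent_exprs G C) E \<and> respects_sisterhood (sisters G C) E"
  then obtain G' C' where "map strip_item G' = G" "strip C' = C" "expr_net (lseq (flatten G') C')"
    using proof_net_labelled by blast
  then show "derivable G C" using net_derivable by blast
qed

end
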